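(* Let $n\ge1$, $s\in(0,1]$, $p\in(n/(n+s),\infty)$, $\ell\in\mathbb Z_+$ and $m\in(n+1,\infty)$. Then $M^{s,p}(\mathbb R^n)=\mathcal A^\ell_{0,m}F^s_{p,\infty}(\mathbb R^n)$ with equivalent norms.
   Context: $\mathbb Z_+=\{0,1,2,\dots\}$. $\mathcal S(\mathbb R^n)$ is the Schwartz space and $\mathcal S'(\mathbb R^n)$ its dual. For $k\in\mathbb Z_+$ and $m\in(0,\infty)$ put $\|\varphi\|_{\mathcal S_{k,m}(\mathbb R^n)}=\sup_{|\alpha|\le k}\sup_{x\in\mathbb R^n}(1+|x|)^m|\partial^\alpha\varphi(x)|$. For $N\in\mathbb Z_+$, $\mathcal S_N(\mathbb R^n)$ is the set of $f\in\mathcal S(\mathbb R^n)$ with $\int_{\mathbb R^n} x^\alpha f(x)\,dx=0$ for all $|\alpha|\le N$; $\mathcal S_{-1}(\mathbb R^n)=\mathcal S(\mathbb R^n)$. For $\ell\in\mathbb Z_+$, $N\in\mathbb Z_+\cup\{-1\}$ and $m\in(0,\infty)$, $\mathcal A^\ell_{N,m}=\{\phi\in\mathcal S_N(\mathbb R^n):\|\phi\|_{\mathcal S_{N+\ell+1,m}(\mathbb R^n)}\le 1\}$. For $t>0$, $\phi_t(x)=t^{-n}\phi(x/t)$. Inhomogeneous grand Triebel–Lizorkin space: $\mathcal A^\ell_{0,m}F^s_{p,\infty}(\mathbb R^n)$ is the set of all $f\in\mathcal S'(\mathbb R^n)$ with $$\|f\|_{\mathcal A^\ell_{0,m}F^s_{p,\infty}(\mathbb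 R^n)}=\Big\|\sup_{\phi\in\mathcal A^{\ell+1}_{-1,m}}|\phi*f|\Big\|_{L^p(\mathbb R^n)}+\Big\|\sup_{k\ge1}2^{ks}\sup_{\phi\in\mathcal A^\ell_{0,m}}|\phi_{2^{-k}}*f|\Big\|_{L^p(\mathbb R^n)}<\infty.$$ Hajłasz–Sobolev spaces: $\dot M^{s,p}(\mathbb R^n)$ is the set of all measurable $f\in L^p_{\rm loc}(\mathbb R^n)$ for which there exist a nonnegative $g\in L^p(\mathbb R^n)$ and a set $E$ of measure zero such that $|f(x)-f(y)|\le |x-y|^s[g(x)+g(y)]$ for all $x,y\in\mathbb R^n\setminus E$; $\|f\|_{\dot M^{s,p}(\mathbb R^n)}$ is the infimum of $\|g\|_{L^p(\mathbb R^n)}$ over all such $g$. $M^{s,p}(\mathbb R^n)$ is the set of all measurable $f\in L^p_{\rm loc}(\mathbb R^n)$ such that $f\in\dot M^{s,p}(\mathbb R^n)$ and $f\in h^p(\mathbb R^n)$, with $\|f\|_{M^{s,p}(\mathbb R^n)}=\|f\|_{h^p(\mathbb R^n)}+\|f\|_{\dot M^{s,p}(\mathbb R^n)}$, where $h^p(\mathbb R^n)$ is the local Hardy space of Goldberg (which equals the inhomogeneous Triebel–Lizorkin space $F^0_{p,2}(\mathbb R^n)$, and equals $L^p(\mathbb R^n)$ for $p>1$). Functions are viewed as tempered distributions; equality means that elements of each space can be identified with elements of the other, with (quasi-)norms comparable up to constants independent of $f$. *)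

theory Defs
  imports "HOL-Analysis.Analysis"
begin

section \<open>Multi-indices and partial derivatives\<close>

text \<open>A multi-index for \<open>\<real>\<^sup>n\<close> is a function from the coordinate type to \<^typ>\<open>nat\<close>.\<close>

definition mi_order :: "('n::finite \<Rightarrow> nat) \<Rightarrow> nat" where
  "mi_order \<alpha> = (\<Sum>i\<in>UNIV. \<alpha> i)"

definition mi_power :: "real ^ 'n \<Rightarrow> ('n::finite \<Rightarrow> nat) \<Rightarrow> real" where
  "mi_power x \<alpha> = (\<Prod>i\<in>UNIV. (x $ i) ^ \<alpha> i)"

definition partial :: "'n::finite \<Rightarrow> (real ^ 'n \<Rightarrow> complex) \<Rightarrow> real ^ 'n \<Rightarrow> complex" where
  "partial i f x = frechet_derivative f (at x) (axis i 1)"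

definition partials :: "'n::finite list \<Rightarrow> (real ^ 'n \<Rightarrow> complex) \<Rightarrow> real ^ 'n \<Rightarrow> complex" where
  "partials is f = foldr partial is f"

text \<open>Differentiability of all iterated partial derivatives makes them all continuous, so this is
  membership in \<open>C\<^sup>\<infinity>\<close>.\<close>

definition smooth :: "(real ^ 'n::finite \<Rightarrow> complex) \<Rightarrow> bool" where
  "smooth f \<longleftrightarrow> (\<forall>is x. partials is f differentiable (at x))"

text \<open>The coordinate type carries no order, so \<open>\<partial>\<^sup>\<alpha>\<close> takes the partial derivatives in some order;
  it is only applied to smooth functions, for which the order is irrelevant.\<close>

definition mi_deriv :: "('n::finite \<Rightarrow> nat) \<Rightarrow> (real ^ 'n \<Rightarrow> complex) \<Rightarrow> real ^ 'n \<Rightarrow> complex" where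
  "mi_deriv \<alpha> f = partials (SOME is. \<forall>i. count_list is i = \<alpha> i) f"


section \<open>Schwartz functions and tempered distributions\<close>

definition schwartz_norm :: "nat \<Rightarrow> real \<Rightarrow> (real ^ 'n::finite \<Rightarrow> complex) \<Rightarrow> ennreal" where
  "schwartz_norm k m \<phi> =
     (SUP \<alpha>\<in>{\<alpha>. mi_order \<alpha> \<le> k}. SUP x. ennreal ((1 + norm x) powr m * cmod (mi_deriv \<alpha> \<phi> x)))"

definition schwartz :: "(real ^ 'n::finite \<Rightarrow> complex) set" where
  "schwartz = {\<phi>. smooth \<phi> \<and> (\<forall>k. \<forall>m>0. schwartz_norm k m \<phi> < \<infinity>)}"

text \<open>Tempered distributions: linear functionals on the Schwartz space that are continuous for the
  topology of the (directed) family of norms \<^const>\<open>schwartz_norm\<close>, that is, bounded by a multiple of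
  one of them.  Outside \<^const>\<open>schwartz\<close> they are \<^const>\<open>undefined\<close>, so equality of functionals is
  equality on the Schwartz space.\<close>

definition tempered :: "((real ^ 'n::finite \<Rightarrow> complex) \<Rightarrow> complex) set" where
  "tempered = {T \<in> extensional schwartz.
     (\<forall>\<phi>\<in>schwartz. \<forall>\<psi>\<in>schwartz. T (\<lambda>x. \<phi> x + \<psi> x) = T \<phi> + T \<psi>) \<and>
     (\<forall>c. \<forall>\<phi>\<in>schwartz. T (\<lambda>x. c * \<phi> x) = c * T \<phi>) \<and>
     (\<exists>k. \<exists>m>0. \<exists>C::real. \<forall>\<phi>\<in>schwartz. ennreal (cmod (T \<phi>)) \<le> ennreal C * schwartz_norm k m \<phi>)}"

text \<open>\<open>\<phi> * T\<close> for a Schwartz function \<open>\<phi>\<close> and a tempered distribution \<open>T\<close>.\<close>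

definition conv :: "(real ^ 'n::finite \<Rightarrow> complex) \<Rightarrow> ((real ^ 'n \<Rightarrow> complex) \<Rightarrow> complex) \<Rightarrow> real ^ 'n \<Rightarrow> complex"
  where "conv \<phi> T x = T (\<lambda>y. \<phi> (x - y))"

text \<open>\<open>\<phi>\<^sub>t(x) = t\<^sup>-\<^sup>n \<phi>(x/t)\<close>.\<close>

definition dilate :: "real \<Rightarrow> (real ^ 'n::finite \<Rightarrow> complex) \<Rightarrow> real ^ 'n \<Rightarrow> complex" where
  "dilate t \<phi> x = \<phi> (x /\<^sub>R t) /\<^sub>R t ^ CARD('n)"

text \<open>A function \<open>f\<close> is viewed as a tempered distribution if \<open>f\<phi>\<close> is integrable for all Schwartz
  \<open>\<phi>\<close> and the functional \<open>\<phi> \<mapsto> \<integral>f\<phi>\<close> is tempered.\<close>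

definition regular_dist :: "(real ^ 'n::finite \<Rightarrow> complex) \<Rightarrow> (real ^ 'n \<Rightarrow> complex) \<Rightarrow> complex" where
  "regular_dist f = restrict (\<lambda>\<phi>. LINT x|lebesgue. f x * \<phi> x) schwartz"

definition is_tempered_fun :: "(real ^ 'n::finite \<Rightarrow> complex) \<Rightarrow> bool" where
  "is_tempered_fun f \<longleftrightarrow>
     (\<forall>\<phi>\<in>schwartz. integrable lebesgue (\<lambda>x. f x * \<phi> x)) \<and> regular_dist f \<in> tempered"


section \<open>Lebesgue quasi-norms\<close>

definition ennreal_powr :: "ennreal \<Rightarrow> real \<Rightarrow> ennreal" where
  "ennreal_powr u a = (if u = \<infinity> then \<infinity> else ennreal (enn2real u powr a))"

text \<open>Only used for \<open>0 < p < \<infinity>\<close>; for \<open>p < 1\<close> it is a quasi-norm.\<close>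

definition Lp_norm :: "real \<Rightarrow> (real ^ 'n::finite \<Rightarrow> ennreal) \<Rightarrow> ennreal" where
  "Lp_norm p h = ennreal_powr (\<integral>\<^sup>+ x. ennreal_powr (h x) p \<partial>lebesgue) (1 / p)"

definition Lp_loc :: "real \<Rightarrow> (real ^ 'n::finite \<Rightarrow> complex) set" where
  "Lp_loc p = {f \<in> borel_measurable lebesgue.
     \<forall>K. compact K \<longrightarrow> (\<integral>\<^sup>+ x\<in>K. ennreal (cmod (f x) powr p) \<partial>lebesgue) < \<infinity>}"


section \<open>Grand Triebel--Lizorkin spaces\<close>

text \<open>\<open>N\<close> ranges over the integers \<open>\<ge> -1\<close>; there is no moment condition for \<open>N = -1\<close>.\<close>

definition schwartz_moments :: "int \<Rightarrow> (real ^ 'n::finite \<Rightarrow> complex) set" where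
  "schwartz_moments N = {\<phi> \<in> schwartz.
     \<forall>\<alpha>. int (mi_order \<alpha>) \<le> N \<longrightarrow> (LINT x|lebesgue. of_real (mi_power x \<alpha>) * \<phi> x) = 0}"

definition test_class :: "nat \<Rightarrow> int \<Rightarrow> real \<Rightarrow> (real ^ 'n::finite \<Rightarrow> complex) set" where
  "test_class l N m = {\<phi> \<in> schwartz_moments N. schwartz_norm (nat (N + int l + 1)) m \<phi> \<le> 1}"

definition grand_TL_norm ::
    "nat \<Rightarrow> real \<Rightarrow> real \<Rightarrow> real \<Rightarrow> ((real ^ 'n::finite \<Rightarrow> complex) \<Rightarrow> complex) \<Rightarrow> ennreal" where
  "grand_TL_norm l m s p T =
     Lp_norm p (\<lambda>x. SUP \<phi>\<in>test_class (l + 1) (-1) m. ennreal (cmod (conv \<phi> T x))) +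
     Lp_norm p (\<lambda>x. SUP k\<in>{1::nat..}. ennreal (2 powr (real k * s)) *
       (SUP \<phi>\<in>test_class l 0 m. ennreal (cmod (conv (dilate (2 powr - real k) \<phi>) T x))))"

definition grand_TL ::
    "nat \<Rightarrow> real \<Rightarrow> real \<Rightarrow> real \<Rightarrow> ((real ^ 'n::finite \<Rightarrow> complex) \<Rightarrow> complex) set" where
  "grand_TL l m s p = {T \<in> tempered. grand_TL_norm l m s p T < \<infinity>}"


section \<open>Local Hardy spaces\<close>

text \<open>Goldberg's definition of \<open>h\<^sup>p\<close> by the maximal function
  \<open>sup\<^bsub>0<t<1\<^esub> |\<Phi>\<^sub>t * T|\<close>, where \<open>\<Phi>\<close> is a fixed Schwartz function with \<open>\<integral>\<Phi> \<noteq> 0\<close>.\<close>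

definition local_hardy_norm ::
    "(real ^ 'n::finite \<Rightarrow> complex) \<Rightarrow> real \<Rightarrow> ((real ^ 'n \<Rightarrow> complex) \<Rightarrow> complex) \<Rightarrow> ennreal" where
  "local_hardy_norm \<Phi> p T =
     Lp_norm p (\<lambda>x. SUP t\<in>{0<..<1::real}. ennreal (cmod (conv (dilate t \<Phi>) T x)))"

definition local_hardy ::
    "(real ^ 'n::finite \<Rightarrow> complex) \<Rightarrow> real \<Rightarrow> ((real ^ 'n \<Rightarrow> complex) \<Rightarrow> complex) set" where
  "local_hardy \<Phi> p = {T \<in> tempered. local_hardy_norm \<Phi> p T < \<infinity>}"


section \<open>Hajlasz--Sobolev spaces\<close>

definition hajlasz_gradients ::
    "real \<Rightarrow> real \<Rightarrow> (real ^ 'n::finite \<Rightarrow> complex) \<Rightarrow> (real ^ 'n \<Rightarrow> real) set" where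
  "hajlasz_gradients s p f = {g \<in> borel_measurable lebesgue.
     (\<forall>x. 0 \<le> g x) \<and> Lp_norm p (\<lambda>x. ennreal (g x)) < \<infinity> \<and>
     (\<exists>E\<in>null_sets lebesgue. \<forall>x\<in>- E. \<forall>y\<in>- E.
        cmod (f x - f y) \<le> norm (x - y) powr s * (g x + g y))}"

definition hajlasz_hom :: "real \<Rightarrow> real \<Rightarrow> (real ^ 'n::finite \<Rightarrow> complex) set" where
  "hajlasz_hom s p = {f \<in> Lp_loc p. hajlasz_gradients s p f \<noteq> {}}"

definition hajlasz_hom_norm :: "real \<Rightarrow> real \<Rightarrow> (real ^ 'n::finite \<Rightarrow> complex) \<Rightarrow> ennreal" where
  "hajlasz_hom_norm s p f = (INF g\<in>hajlasz_gradients s p f. Lp_norm p (\<lambda>x. ennreal (g x)))"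

definition hajlasz_sobolev ::
    "(real ^ 'n::finite \<Rightarrow> complex) \<Rightarrow> real \<Rightarrow> real \<Rightarrow> (real ^ 'n \<Rightarrow> complex) set" where
  "hajlasz_sobolev \<Phi> s p =
     {f \<in> hajlasz_hom s p. is_tempered_fun f \<and> regular_dist f \<in> local_hardy \<Phi> p}"

definition hajlasz_sobolev_norm ::
    "(real ^ 'n::finite \<Rightarrow> complex) \<Rightarrow> real \<Rightarrow> real \<Rightarrow> (real ^ 'n \<Rightarrow> complex) \<Rightarrow> ennreal" where
  "hajlasz_sobolev_norm \<Phi> s p f = local_hardy_norm \<Phi> p (regular_dist f) + hajlasz_hom_norm s p f"

end

theory Submission
  imports Defs
begin

text \<open>Put \<open>q = n/(n+s) < p\<close>.  If \<open>g\<close> is a Hajlasz gradient of \<open>f\<close>, a chain argument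
  through the level sets of \<open>g\<close> bounds the oscillation of \<open>f\<close> in a ball pointwise by
  \<open>g\<^sup>q\<close> and averages of it.  Hence convolutions of \<open>f\<close> with mean zero functions at scale
  \<open>t\<close> are at most \<open>t\<^sup>s M(g\<^sup>q)\<^bsup>1/q\<^esup>\<close>, and the maximal operator \<open>M\<close> is bounded on
  \<open>L\<^bsup>p/q\<^esup>\<close>.  Test functions without moment condition are compared with a multiple of a dilate of
  \<open>\<Phi>\<close>.

  Conversely, let \<open>h\<close> be the sum of the two grand maximal functions of a distribution \<open>T\<close>.
  Differences of mollifications of \<open>T\<close>, in scale or in space, are convolutions with mean zero
  functions.  So the mollifications have the common Hajlasz gradient \<open>C h\<close> and converge almost
  everywhere to a function \<open>f\<close>.  The oscillation bound dominates them by one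
  function that is integrable against Schwartz functions, so that \<open>f\<close> represents \<open>T\<close>.\<close>

section \<open>The Hardy--Littlewood maximal function\<close>

text \<open>For p \<le> 1 a gradient in L^p need not be locally integrable. What remains is g^q,
  which lies in L^(p/q) with p/q > 1. The value of q comes from scaling: if g^q has bounded mean
  over a ball of radius r, small values of g are found within a distance of order \<theta> r once
  \<theta>^n is a multiple of g^(-q), and 1 - q s/n = q turns the cost \<theta>^s g of such a jump
  into g^q. The oscillation grows like (t + |x-y|)^s and so spends s powers of the decay of a test
  function; the m - s > n powers left still control a maximal function. The two norms belong to
  different kinds of objects. The construction from T gives one representative of controlled norm,
  but the norm equivalence concerns every f. The gap is closed by showing that two functions of the
  Hajlasz space with the same functional agree almost everywhere.\<close>

text \<open>The balls are not centred at \<open>x\<close>, which makes the superlevel sets open for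
  arbitrary \<open>h\<close>. The normalisation is by r^n instead of the volume, so the volume of
  the unit ball appears in the constants below.\<close>

definition hl_max :: "('a::euclidean_space \<Rightarrow> ennreal) \<Rightarrow> 'a \<Rightarrow> ennreal" where
  "hl_max h x = (SUP (c, r)\<in>{(c, r). x \<in> ball c r}.
     (\<integral>\<^sup>+ y. h y * indicator (ball c r) y \<partial>lebesgue) / ennreal (r ^ DIM('a)))"

lemma ball_in_lebesgue [measurable]: "ball c r \<in> sets (lebesgue :: 'a::euclidean_space measure)"
  by simp

lemma hl_max_ball:
  fixes x :: "'a::euclidean_space"
  assumes "x \<in> ball c r"
  shows "(\<integral>\<^sup>+ y. h y * indicator (ball c r) y \<partial>lebesgue) \<le> hl_max h x * ennreal (r ^ DIM('a))"
proof -
  have r: "r > 0" using assms by (metis ball_eq_empty empty_iff not_le)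
  have "(\<integral>\<^sup>+ y. h y * indicator (ball c r) y \<partial>lebesgue) / ennreal (r ^ DIM('a)) \<le> hl_max h x"
    unfolding hl_max_def using assms by (intro SUP_upper2[where i="(c, r)"]) auto
  then have "(\<integral>\<^sup>+ y. h y * indicator (ball c r) y \<partial>lebesgue) / ennreal (r ^ DIM('a)) * ennreal (r ^ DIM('a))
      \<le> hl_max h x * ennreal (r ^ DIM('a))"
    by (intro mult_right_mono) auto
  then show ?thesis
    using r by (simp add: ennreal_divide_times ennreal_divide_self)
qed

lemma hl_max_le:
  fixes x :: "'a::euclidean_space"
  assumes "\<And>c r. x \<in> ball c r \<Longrightarrow>
    (\<integral>\<^sup>+ y. h y * indicator (ball c r) y \<partial>lebesgue) \<le> A * ennreal (r ^ DIM('a))"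
  shows "hl_max h x \<le> A"
  unfolding hl_max_def
proof (intro SUP_least, clarify)
  fix c r assume *: "x \<in> ball c r"
  then have r: "r > 0" by (metis ball_eq_empty empty_iff not_le)
  show "(\<integral>\<^sup>+ y. h y * indicator (ball c r) y \<partial>lebesgue) / ennreal (r ^ DIM('a)) \<le> A"
    using divide_right_mono_ennreal[OF assms[OF *], of "ennreal (r ^ DIM('a))"] r
    by (simp add: ennreal_mult_divide_eq)
qed

lemma open_hl_max: "open {x. l < hl_max h x}"
proof -
  have "{x. l < hl_max h x} = (\<Union>(c, r)\<in>{(c, r).
      l < (\<integral>\<^sup>+ y. h y * indicator (ball c r) y \<partial>lebesgue) / ennreal (r ^ DIM('a))}. ball c r)"
    unfolding hl_max_def less_SUP_iff by fastforce
  then show ?thesis by (auto intro!: open_UN)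
qed

lemma sets_hl_max: "{x. l < hl_max h x} \<in> sets lebesgue"
  using open_hl_max[of l h] by simp

lemma borel_measurable_hl_max [measurable]: "hl_max h \<in> borel_measurable lebesgue"
proof -
  have "hl_max h \<in> borel_measurable borel"
    by (rule borel_measurableI_greater) (use open_hl_max[of _ h] in \<open>auto intro!: borel_open\<close>)
  then have "hl_max h \<in> borel_measurable lborel" by simp
  then show ?thesis by (rule measurable_completion)
qed

text \<open>Vitali's covering argument: the level set is covered by balls with large integral, a
  countable disjoint subfamily covers it after enlargement by the factor 5, and the integrals over
  disjoint balls add up to at most the integral of \<open>h\<close>.\<close>

lemma hl_max_weak_type:
  fixes h :: "'a::euclidean_space \<Rightarrow> ennreal"
  assumes [measurable]: "h \<in> borel_measurable lebesgue" and l: "0 < l"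
  shows "emeasure lebesgue {x. ennreal l < hl_max h x} * ennreal l
    \<le> ennreal (5 ^ DIM('a) * unit_ball_vol DIM('a)) * (\<integral>\<^sup>+ x. h x \<partial>lebesgue)"
proof (cases "(\<integral>\<^sup>+ x. h x \<partial>lebesgue) = \<infinity>")
  case True
  moreover have "unit_ball_vol (real DIM('a)) \<noteq> 0" using unit_ball_vol_pos[of "real DIM('a)"] by linarith
  ultimately show ?thesis by (simp add: ennreal_mult_top)
next
  case False
  then obtain I where I: "(\<integral>\<^sup>+ x. h x \<partial>lebesgue) = ennreal I" "I \<ge> 0"
    by (metis ennreal_cases infinity_ennreal_def)
  let ?i = "\<lambda>c r. \<integral>\<^sup>+ y. h y * indicator (ball c r) y \<partial>lebesgue"
  define K where "K = {(c, r). 0 < r \<and> ennreal l * ennreal (r ^ DIM('a)) < ?i c r}"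
  have cov: "{x. ennreal l < hl_max h x} \<subseteq> (\<Union>i\<in>K. ball (fst i) (snd i))"
  proof
    fix x assume "x \<in> {x. ennreal l < hl_max h x}"
    then obtain c r where cr: "x \<in> ball c r" "ennreal l < ?i c r / ennreal (r ^ DIM('a))"
      by (auto simp: hl_max_def less_SUP_iff)
    have r: "r > 0" using cr(1) by (metis ball_eq_empty empty_iff not_le)
    have "ennreal l * ennreal (r ^ DIM('a)) < ?i c r"
    proof (rule ccontr)
      assume "\<not> ?thesis"
      then have "?i c r / ennreal (r ^ DIM('a)) \<le> ennreal l * ennreal (r ^ DIM('a)) / ennreal (r ^ DIM('a))"
        by (intro divide_right_mono_ennreal) auto
      with cr(2) r show False by (simp add: ennreal_mult_divide_eq)
    qed
    with cr(1) r show "x \<in> (\<Union>i\<in>K. ball (fst i) (snd i))"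
      by (intro UN_I[of "(c, r)"]) (auto simp: K_def)
  qed
  \<comment> \<open>The covering lemma needs bounded radii. A selected ball satisfies r^n < I / l,
    and r \<le> r^n once r > 1; this is why the case of an infinite integral was split off.\<close>
  define R where "R = max 1 (I / l)"
  have bd: "0 < snd i \<and> snd i \<le> R" if "i \<in> K" for i
  proof -
    obtain c r where i: "i = (c, r)" by force
    have *: "0 < r" "ennreal l * ennreal (r ^ DIM('a)) < ?i c r" using that by (auto simp: K_def i)
    have "?i c r \<le> ennreal I" unfolding I(1)[symmetric] by (intro nn_integral_mono) (auto split: split_indicator)
    with * have "ennreal l * ennreal (r ^ DIM('a)) < ennreal I" by (meson less_le_trans)
    then have "l * r ^ DIM('a) < I"
      using l * by (simp add: ennreal_mult[symmetric] ennreal_less_iff)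
    then have **: "r ^ DIM('a) < I / l" using l by (simp add: field_simps)
    have "r \<le> R"
    proof (cases "r \<le> 1")
      case False
      then have "r ^ 1 \<le> r ^ DIM('a)" by (intro power_increasing) auto
      then show ?thesis using ** by (simp add: R_def)
    qed (simp add: R_def)
    with * show ?thesis by (simp add: i)
  qed
  obtain C where C: "countable C" "C \<subseteq> K"
     "pairwise (\<lambda>i j. disjnt (ball (fst i) (snd i)) (ball (fst j) (snd j))) C"
     "{x. ennreal l < hl_max h x} \<subseteq> (\<Union>i\<in>C. ball (fst i) (5 * snd i))"
    by (rule Vitali_covering_lemma_balls[OF cov bd])
  have disj: "disjoint_family_on (\<lambda>i. ball (fst i) (snd i)) C"
    using C(3) by (auto simp: pairwise_def disjnt_def disjoint_family_on_def)
  let ?V = "5 ^ DIM('a) * unit_ball_vol (real DIM('a))"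
  have "emeasure lebesgue {x. ennreal l < hl_max h x}
      \<le> (\<integral>\<^sup>+ i. emeasure lebesgue (ball (fst i) (5 * snd i)) \<partial>count_space C)"
  proof -
    have "indicator {x. ennreal l < hl_max h x} x
        \<le> (\<integral>\<^sup>+ i. indicator (ball (fst i) (5 * snd i)) x \<partial>count_space C :: ennreal)" for x
    proof (cases "ennreal l < hl_max h x")
      case True
      then obtain i where i: "i \<in> C" "x \<in> ball (fst i) (5 * snd i)" using C(4) by blast
      show ?thesis
        using nn_integral_ge_point[OF i(1), of "\<lambda>i. indicator (ball (fst i) (5 * snd i)) x"] i(2) True by simp
    qed simp
    then have "(\<integral>\<^sup>+ x. indicator {x. ennreal l < hl_max h x} x \<partial>lebesgue) \<le>
      (\<integral>\<^sup>+ x. \<integral>\<^sup>+ i. indicator (ball (fst i) (5 * snd i)) x \<partial>count_space C \<partial>(lebesgue :: 'a measure))"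
      by (intro nn_integral_mono)
    also have "\<dots> = (\<integral>\<^sup>+ i. \<integral>\<^sup>+ x. indicator (ball (fst i) (5 * snd i)) x \<partial>(lebesgue :: 'a measure) \<partial>count_space C)"
      by (intro nn_integral_count_space_nn_integral C) auto
    finally show ?thesis using open_hl_max[of "ennreal l" h] by simp
  qed
  also have "\<dots> * ennreal l = (\<integral>\<^sup>+ i. emeasure lebesgue (ball (fst i) (5 * snd i)) * ennreal l \<partial>count_space C)"
    by (simp add: nn_integral_multc)
  \<comment> \<open>The integral of \<open>h\<close> over a ball is written as its measure for the
    density \<open>h\<close>, so that disjointness can be used as countable additivity.\<close>
  also have "\<dots> \<le> (\<integral>\<^sup>+ i. ennreal ?V * emeasure (density lebesgue h) (ball (fst i) (snd i)) \<partial>count_space C)"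
  proof (intro nn_integral_mono)
    fix i assume "i \<in> space (count_space C)"
    then have i: "i \<in> K" using C by auto
    obtain c r where ic: "i = (c, r)" by force
    have *: "0 < r" "ennreal l * ennreal (r ^ DIM('a)) < ?i c r" using i by (auto simp: K_def ic)
    have "emeasure lebesgue (ball c (5 * r)) = ennreal ?V * ennreal (r ^ DIM('a))"
      using * by (simp add: emeasure_ball power_mult_distrib ennreal_mult[symmetric] mult_ac)
    then have "emeasure lebesgue (ball c (5 * r)) * ennreal l = ennreal ?V * (ennreal l * ennreal (r ^ DIM('a)))"
      by (simp add: mult_ac)
    also have "\<dots> \<le> ennreal ?V * ?i c r" using * by (intro mult_left_mono) auto
    finally show "emeasure lebesgue (ball (fst i) (5 * snd i)) * ennreal l
        \<le> ennreal ?V * emeasure (density lebesgue h) (ball (fst i) (snd i))"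
      by (simp add: ic emeasure_density)
  qed
  also have "\<dots> = ennreal ?V * emeasure (density lebesgue h) (\<Union>i\<in>C. ball (fst i) (snd i))"
    by (subst emeasure_UN_countable) (use C disj in \<open>auto simp: nn_integral_cmult\<close>)
  also have "\<dots> \<le> ennreal ?V * (\<integral>\<^sup>+ x. h x \<partial>lebesgue)"
    by (subst emeasure_density)
      (use C in \<open>auto intro!: mult_left_mono nn_integral_mono sets.countable_UN' split: split_indicator\<close>)
  finally show ?thesis by (simp add: mult_right_mono)
qed

text \<open>Values of \<open>h\<close> up to l / (2w), with w the volume of the unit ball,
  contribute at most l / 2 to the maximal function. Hence the part of \<open>h\<close> above this
  height has maximal function above l / 2 on the whole level set, and the weak type estimate is
  applied to that part alone.\<close>

lemma hl_max_weak_type_truncated: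
  fixes h :: "'a::euclidean_space \<Rightarrow> real"
  assumes [measurable]: "h \<in> borel_measurable lebesgue" and l: "0 < l"
  shows "emeasure lebesgue {x. ennreal l < hl_max (\<lambda>x. ennreal (h x)) x} * ennreal l
    \<le> ennreal (2 * 5 ^ DIM('a) * unit_ball_vol DIM('a)) *
      (\<integral>\<^sup>+ x. ennreal (h x) * indicator {x. l < 2 * unit_ball_vol DIM('a) * h x} x \<partial>lebesgue)"
proof -
  define w where "w = unit_ball_vol (real DIM('a))"
  have w: "w > 0" by (simp add: w_def)
  define h1 where "h1 x = ennreal (h x) * indicator {x. l < 2 * w * h x} x" for x
  have [measurable]: "h1 \<in> borel_measurable lebesgue" unfolding h1_def by measurable
  have "hl_max (\<lambda>x. ennreal (h x)) x \<le> hl_max h1 x + ennreal (l / 2)" for x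
  proof (rule hl_max_le)
    fix c r assume *: "x \<in> ball c r"
    then have r: "r > 0" by (metis ball_eq_empty empty_iff not_le)
    have "h y \<le> l / (2 * w)" if "\<not> l < 2 * w * h y" for y
      using that w by (simp add: field_simps)
    then have "ennreal (h y) \<le> h1 y + ennreal (l / (2 * w))" for y
      by (auto simp: h1_def split: split_indicator intro!: ennreal_leI)
    then have "(\<integral>\<^sup>+ y. ennreal (h y) * indicator (ball c r) y \<partial>lebesgue)
        \<le> (\<integral>\<^sup>+ y. h1 y * indicator (ball c r) y + ennreal (l / (2 * w)) * indicator (ball c r) y \<partial>lebesgue)"
      by (intro nn_integral_mono) (auto split: split_indicator)
    also have "\<dots> = (\<integral>\<^sup>+ y. h1 y * indicator (ball c r) y \<partial>lebesgue) + ennreal (l / (2 * w)) * emeasure lebesgue (ball c r)"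
      by (subst nn_integral_add) (auto simp: nn_integral_cmult_indicator)
    also have "\<dots> \<le> hl_max h1 x * ennreal (r ^ DIM('a)) + ennreal (l / 2) * ennreal (r ^ DIM('a))"
    proof (intro add_mono hl_max_ball *)
      show "ennreal (l / (2 * w)) * emeasure lebesgue (ball c r) \<le> ennreal (l / 2) * ennreal (r ^ DIM('a))"
        using r l w by (simp add: emeasure_ball flip: w_def ennreal_mult)
    qed
    finally show "(\<integral>\<^sup>+ y. ennreal (h y) * indicator (ball c r) y \<partial>lebesgue)
      \<le> (hl_max h1 x + ennreal (l / 2)) * ennreal (r ^ DIM('a))" by (simp add: distrib_right)
  qed
  then have "ennreal (l / 2) < hl_max h1 x" if "ennreal l < hl_max (\<lambda>x. ennreal (h x)) x" for x
  proof (rule_tac ccontr)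
    assume "\<not> ennreal (l / 2) < hl_max h1 x"
    then have "hl_max h1 x + ennreal (l / 2) \<le> ennreal (l / 2) + ennreal (l / 2)"
      by (intro add_mono) auto
    also have "\<dots> = ennreal l" using l by (simp flip: ennreal_plus)
    finally show False using that \<open>\<And>x. hl_max (\<lambda>x. ennreal (h x)) x \<le> hl_max h1 x + ennreal (l / 2)\<close>[of x]
      by (meson leD order_trans)
  qed
  then have "emeasure lebesgue {x. ennreal l < hl_max (\<lambda>x. ennreal (h x)) x} * ennreal l
      \<le> emeasure lebesgue {x. ennreal (l / 2) < hl_max h1 x} * ennreal l"
    by (intro mult_right_mono emeasure_mono) (auto intro!: lborelD borel_open open_hl_max)
  also have "\<dots> = emeasure lebesgue {x. ennreal (l / 2) < hl_max h1 x} * (ennreal 2 * ennreal (l / 2))"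
    using l ennreal_mult[of 2 "l / 2"] by simp
  also have "\<dots> = ennreal 2 * (emeasure lebesgue {x. ennreal (l / 2) < hl_max h1 x} * ennreal (l / 2))"
    by (simp add: mult_ac)
  also have "\<dots> \<le> ennreal 2 * (ennreal (5 ^ DIM('a) * w) * (\<integral>\<^sup>+ x. h1 x \<partial>lebesgue))"
    unfolding w_def using l by (intro mult_left_mono hl_max_weak_type) auto
  also have "\<dots> = ennreal (2 * 5 ^ DIM('a) * w) * (\<integral>\<^sup>+ x. h1 x \<partial>lebesgue)"
    using w by (simp add: ennreal_mult mult_ac)
  finally show ?thesis by (simp add: h1_def w_def)
qed

section \<open>Real powers of extended nonnegative reals\<close>

lemma ennreal_powr_ennreal [simp]: "0 \<le> a \<Longrightarrow> ennreal_powr (ennreal a) b = ennreal (a powr b)"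
  by (simp add: ennreal_powr_def)

lemma ennreal_powr_top [simp]: "ennreal_powr \<infinity> b = \<infinity>" "ennreal_powr top b = top"
  by (simp_all add: ennreal_powr_def)

lemma ennreal_powr_0 [simp]: "ennreal_powr 0 b = 0"
  by (simp add: ennreal_powr_def)

lemma ennreal_powr_mono: "u \<le> v \<Longrightarrow> 0 \<le> b \<Longrightarrow> ennreal_powr u b \<le> ennreal_powr v b"
  by (cases u; cases v) (auto simp: powr_mono2 top_unique)

lemma ennreal_powr_mult: "0 < b \<Longrightarrow> ennreal_powr (u * v) b = ennreal_powr u b * ennreal_powr v b"
proof (cases u; cases v)
  fix x y assume "0 < b" "u = ennreal x" "v = ennreal y" "0 \<le> x" "0 \<le> y"
  then show ?thesis by (simp flip: ennreal_mult add: powr_mult)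
next
  fix x assume "0 < b" "u = ennreal x" "v = top" "0 \<le> x"
  then show ?thesis by (cases "x = 0") (auto simp: ennreal_mult_top)
next
  fix x assume "0 < b" "v = ennreal x" "u = top" "0 \<le> x"
  then show ?thesis by (cases "x = 0") (auto simp: ennreal_top_mult)
qed auto

lemma ennreal_powr_powr: "ennreal_powr (ennreal_powr u a) b = ennreal_powr u (a * b)"
  by (cases u) (auto simp: powr_powr)

lemma ennreal_powr_one [simp]: "ennreal_powr u 1 = u"
  by (cases u) auto

lemma borel_measurable_ennreal_powr [measurable]:
  assumes [measurable]: "f \<in> borel_measurable M"
  shows "(\<lambda>x. ennreal_powr (f x) a) \<in> borel_measurable M"
  unfolding ennreal_powr_def by measurable

text \<open>A dyadic layer cake decomposition, which avoids Fubini's theorem.\<close>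

lemma hl_max_strong_type:
  assumes r: "1 < r"
  shows "\<exists>C>0. \<forall>h::'a::euclidean_space \<Rightarrow> real. h \<in> borel_measurable lebesgue \<longrightarrow> (\<forall>x. 0 \<le> h x) \<longrightarrow>
    (\<integral>\<^sup>+ x. ennreal_powr (hl_max (\<lambda>x. ennreal (h x)) x) r \<partial>lebesgue)
      \<le> ennreal C * (\<integral>\<^sup>+ x. ennreal (h x powr r) \<partial>lebesgue)"
proof -
  define w where "w = unit_ball_vol (real DIM('a))"
  have w: "w > 0" by (simp add: w_def)
  define V where "V = 2 * 5 ^ DIM('a) * w"
  have V: "V > 0" using w by (simp add: V_def)
  \<comment> \<open>This is the sum of 2^(k(r-1)) over all k with 2^k < 2 w h, a geometric series
    with ratio 2^(1-r) below its largest term, multiplied by h and compared with h^r.\<close>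
  define D where "D = (2 * w) powr (r - 1) / (1 - 2 powr (1 - r))"
  have r2: "2 powr (1 - r) < (1::real)" using r by (simp add: powr_less_one)
  have D: "D > 0" using w r2 by (auto simp: D_def)
  define C where "C = 2 powr r * V * D"
  show ?thesis
  proof (intro exI[of _ C] conjI allI impI)
    show "C > 0" using V D by (simp add: C_def)
    fix h :: "'a \<Rightarrow> real" assume [measurable]: "h \<in> borel_measurable lebesgue" and h0: "\<forall>x. 0 \<le> h x"
    let ?M = "hl_max (\<lambda>x. ennreal (h x))"
    define P where "P k = 2 powr real_of_int k" for k :: int
    let ?p = P
    have P0: "0 < P k" for k by (simp add: P_def)
    define Q where "Q k = 2 powr (real_of_int k * (r - 1))" for k :: int
    have Q0: "0 \<le> Q k" for k by (simp add: Q_def)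
    have lower: "ennreal_powr (?M x) r \<le> (\<integral>\<^sup>+ k. ennreal (2 powr ((real_of_int k + 1) * r)) *
          indicator {x. ennreal (?p k) < ?M x} x \<partial>count_space UNIV)" (is "_ \<le> ?S x") for x
    proof (cases "?M x")
      case (real u)
      show ?thesis
      proof (cases "u = 0")
        case False
        then have u: "u > 0" using real by simp
        \<comment> \<open>The layer with 2^k < u \<le> 2^(k+1). This single term already dominates
          u^r, since its weight is the r-th power of the upper end of the layer.\<close>
        define k where "k = \<lceil>log 2 u\<rceil> - 1"
        have k: "real_of_int k < log 2 u" "log 2 u \<le> real_of_int k + 1" unfolding k_def by linarith+
        have "?p k < u" using k(1) u by (simp add: less_log_iff P_def)
        moreover have "u \<le> 2 powr (real_of_int k + 1)" using k(2) u by (simp add: log_le_iff)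
        then have "u powr r \<le> 2 powr ((real_of_int k + 1) * r)"
          using powr_mono2[of r u "2 powr (real_of_int k + 1)"] r u by (simp add: powr_powr)
        moreover have "ennreal (P k) < ?M x"
          using real \<open>P k < u\<close> P0[of k] by (simp add: ennreal_less_iff)
        ultimately show ?thesis
          using real u
          by (intro order_trans[OF _ nn_integral_ge_point[of k]]) (auto intro!: ennreal_leI)
      qed (use real in simp)
    next
      case top
      have "ennreal B \<le> ?S x" if "B > 0" for B
      proof -
        define k where "k = \<lceil>log 2 B\<rceil> + 1"
        have "log 2 B \<le> real_of_int k + 1" "0 \<le> real_of_int k + 1 \<or> log 2 B < 0" unfolding k_def by linarith+
        \<comment> \<open>Where the maximal function is infinite every level is exceeded, so terms
          of arbitrarily large weight occur. The maximum with 0 keeps j + 1 nonnegative, so that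
          multiplying by r > 1 does not decrease it.\<close>
        define j where "j = max k 0"
        have j: "log 2 B \<le> real_of_int j + 1" "0 \<le> real_of_int j + 1"
          unfolding j_def k_def by linarith+
        have "1 * (real_of_int j + 1) \<le> r * (real_of_int j + 1)" using r j by (intro mult_right_mono) auto
        then have "log 2 B \<le> (real_of_int j + 1) * r" using j by (simp add: mult.commute)
        then have "B \<le> 2 powr ((real_of_int j + 1) * r)" using that by (simp add: log_le_iff)
        then show ?thesis
          using top by (intro order_trans[OF _ nn_integral_ge_point[of j]]) (auto intro!: ennreal_leI)
      qed
      note ge = this
      have "?S x = top"
      proof (cases "?S x")
        case (real u)
        then show ?thesis using ge[of "u + 1"] by (simp del: ennreal_plus)
      qed
      then show ?thesis by simp
    qed
    have upper: "(\<integral>\<^sup>+ k. ennreal (Q k) * (ennreal (h x) *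
        indicator {x. ?p k < 2 * w * h x} x) \<partial>count_space UNIV) \<le> ennreal D * ennreal (h x powr r)" for x
    proof (cases "h x = 0")
      case False
      then have hx: "h x > 0" using h0 by (simp add: order_less_le)
      define u where "u = 2 * w * h x"
      have u: "u > 0" using w hx by (simp add: u_def)
      \<comment> \<open>The largest k with 2^k < u; reindexing by k0 - j turns the sum over all
        admissible k into a geometric series over the naturals.\<close>
      define k0 where "k0 = \<lceil>log 2 u\<rceil> - 1"
      have kiff: "?p k < u \<longleftrightarrow> k \<le> k0" for k
      proof -
        have "?p k < u \<longleftrightarrow> real_of_int k < log 2 u" using u by (simp add: less_log_iff P_def)
        also have "\<dots> \<longleftrightarrow> k \<le> k0" unfolding k0_def by linarith
        finally show ?thesis .
      qed
      have bij: "bij_betw (\<lambda>j::nat. k0 - int j) UNIV {..k0}"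
        by (rule bij_betwI[where g="\<lambda>k. nat (k0 - k)"]) auto
      let ?f = "\<lambda>k::int. ennreal (Q k)"
      have "(\<integral>\<^sup>+ k. ?f k * (ennreal (h x) * indicator {x. ?p k < 2 * w * h x} x) \<partial>count_space UNIV)
        = (\<integral>\<^sup>+ k. (?f k * indicator {..k0} k) * ennreal (h x) \<partial>count_space UNIV)"
        by (intro nn_integral_cong) (auto simp: kiff u_def[symmetric] split: split_indicator)
      also have "\<dots> = (\<integral>\<^sup>+ k. ?f k \<partial>count_space {..k0}) * ennreal (h x)"
        by (subst nn_integral_multc) (auto simp: nn_integral_count_space_indicator)
      also have "(\<integral>\<^sup>+ k. ?f k \<partial>count_space {..k0}) = (\<integral>\<^sup>+ j. ?f (k0 - int j) \<partial>count_space UNIV)"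
        by (rule nn_integral_bij_count_space[OF bij, symmetric])
      also have "\<dots> = (\<Sum>j. ?f (k0 - int j))" by (rule nn_integral_count_space_nat)
      also have "\<dots> = (\<Sum>j. ennreal (2 powr (real_of_int k0 * (r - 1)) * (2 powr (1 - r)) ^ j))"
      proof (intro suminf_cong arg_cong[of _ _ ennreal])
        fix j :: nat
        have "real_of_int (k0 - int j) * (r - 1) = real_of_int k0 * (r - 1) + (1 - r) * real j"
          by (simp add: algebra_simps)
        moreover have "(2 powr (1 - r)) ^ j = 2 powr ((1 - r) * real j)"
          by (simp add: powr_power mult_ac)
        ultimately show "Q (k0 - int j) = 2 powr (real_of_int k0 * (r - 1)) * (2 powr (1 - r)) ^ j"
          by (simp only: powr_add Q_def)
      qed
      also have "\<dots> = ennreal (2 powr (real_of_int k0 * (r - 1)) * (1 / (1 - 2 powr (1 - r))))"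
        using r2 by (intro suminf_ennreal_eq sums_mult geometric_sums) auto
      also have "\<dots> \<le> ennreal (u powr (r - 1) * (1 / (1 - 2 powr (1 - r))))"
      proof (intro ennreal_leI mult_right_mono)
        have "?p k0 \<le> u" using kiff[of k0] by simp
        then show "2 powr (real_of_int k0 * (r - 1)) \<le> u powr (r - 1)"
          using powr_mono2[of "r - 1" "?p k0" u] r by (simp add: powr_powr P_def)
      qed (use r2 in auto)
      also have "\<dots> * ennreal (h x) = ennreal (D * (h x powr (r - 1) * h x))"
        unfolding u_def D_def using w hx r2 by (subst powr_mult) (auto simp flip: ennreal_mult simp: field_simps)
      also have "h x powr (r - 1) * h x = h x powr r"
        using hx powr_add[of "h x" "r - 1" 1] by simp
      finally show ?thesis using D by (simp add: ennreal_mult mult_right_mono)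
    qed simp
    have "(\<integral>\<^sup>+ x. ennreal_powr (?M x) r \<partial>lebesgue) \<le> (\<integral>\<^sup>+ x. ?S x \<partial>lebesgue)"
      by (intro nn_integral_mono lower)
    also have "\<dots> = (\<integral>\<^sup>+ k. \<integral>\<^sup>+ x. ennreal (2 powr ((real_of_int k + 1) * r)) *
          indicator {x. ennreal (?p k) < ?M x} x \<partial>lebesgue \<partial>count_space UNIV)"
      by (intro nn_integral_count_space_nn_integral) auto
    also have "\<dots> \<le> (\<integral>\<^sup>+ k. \<integral>\<^sup>+ x. ennreal (2 powr r * V) * (ennreal (Q k) * (ennreal (h x) *
        indicator {x. ?p k < 2 * w * h x} x)) \<partial>lebesgue \<partial>count_space UNIV)"
    proof (rule nn_integral_mono)
      fix k :: int
      let ?E = "emeasure lebesgue {x. ennreal (?p k) < ?M x}"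
      let ?J = "\<integral>\<^sup>+ x. ennreal (h x) * indicator {x. ?p k < 2 * w * h x} x \<partial>lebesgue"
      \<comment> \<open>One factor 2^k is split off the weight: it is the level that the weak type
        estimate consumes. The factor 2^(k(r-1)) stays and is summed by
        \<open>upper\<close>.\<close>
      have "(real_of_int k + 1) * r = r + real_of_int k * (r - 1) + real_of_int k"
        by (simp add: algebra_simps)
      then have e: "2 powr ((real_of_int k + 1) * r) = 2 powr r * Q k * P k"
        by (simp only: powr_add P_def Q_def)
      have "(\<integral>\<^sup>+ x. ennreal (2 powr ((real_of_int k + 1) * r)) * indicator {x. ennreal (?p k) < ?M x} x \<partial>lebesgue)
         = ennreal (2 powr r * Q k * P k) * ?E"
        unfolding e by (rule nn_integral_cmult_indicator[OF sets_hl_max])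
      also have "ennreal (2 powr r * Q k * P k) * ?E = ennreal (2 powr r * Q k) * (?E * ennreal (P k))"
        using P0[of k] Q0[of k] by (simp add: ennreal_mult mult_ac)
      also have "\<dots> \<le> ennreal (2 powr r * Q k) * (ennreal V * ?J)"
        unfolding V_def w_def using P0 by (intro mult_left_mono hl_max_weak_type_truncated) auto
      also have "\<dots> = ennreal (2 powr r * V) * (ennreal (Q k) * ?J)"
        using V Q0[of k] by (simp add: ennreal_mult mult_ac)
      also have "\<dots> = (\<integral>\<^sup>+ x. ennreal (2 powr r * V) * (ennreal (Q k) * (ennreal (h x) *
        indicator {x. ?p k < 2 * w * h x} x)) \<partial>lebesgue)"
        by (simp add: nn_integral_cmult)
      finally show "(\<integral>\<^sup>+ x. ennreal (2 powr ((real_of_int k + 1) * r)) * indicator {x. ennreal (?p k) < ?M x} x \<partial>lebesgue)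
        \<le> \<dots>" .
    qed
    also have "\<dots> = (\<integral>\<^sup>+ x. \<integral>\<^sup>+ k. ennreal (2 powr r * V) * (ennreal (Q k) * (ennreal (h x) *
        indicator {x. ?p k < 2 * w * h x} x)) \<partial>count_space UNIV \<partial>lebesgue)"
      by (intro nn_integral_count_space_nn_integral[symmetric]) auto
    also have "\<dots> \<le> (\<integral>\<^sup>+ x. ennreal (2 powr r * V) * (ennreal D * ennreal (h x powr r)) \<partial>lebesgue)"
      using upper by (intro nn_integral_mono) (simp add: nn_integral_cmult mult_left_mono)
    also have "\<dots> = ennreal C * (\<integral>\<^sup>+ x. ennreal (h x powr r) \<partial>lebesgue)"
      using V D by (subst nn_integral_cmult[symmetric]) (auto simp: C_def ennreal_mult mult_ac)
    finally show "(\<integral>\<^sup>+ x. ennreal_powr (?M x) r \<partial>lebesgue) \<le> \<dots>" .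
  qed
qed

lemma hl_max_const: "hl_max (\<lambda>_::'a::euclidean_space. ennreal c) x \<le> ennreal (unit_ball_vol DIM('a)) * ennreal c"
proof (rule hl_max_le)
  fix a r assume "x \<in> ball a r"
  then have r: "r > 0" by (metis ball_eq_empty empty_iff not_le)
  have "(\<integral>\<^sup>+ y. ennreal c * indicator (ball a r) y \<partial>lebesgue) = ennreal c * emeasure lebesgue (ball a r)"
    by (simp add: nn_integral_cmult_indicator)
  then show "(\<integral>\<^sup>+ y. ennreal c * indicator (ball a r) y \<partial>lebesgue)
      \<le> ennreal (unit_ball_vol DIM('a)) * ennreal c * ennreal (r ^ DIM('a))"
    using r by (simp add: emeasure_ball ennreal_mult mult_ac)
qed

text \<open>The kernel is at most a geometrically decaying sum of normalised indicators of dyadic balls.\<close>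

lemma hl_max_kernel:
  assumes a: "real DIM('a) < a"
  shows "\<exists>C>0. \<forall>(h::'a::euclidean_space \<Rightarrow> ennreal) x t. h \<in> borel_measurable lebesgue \<longrightarrow> 0 < t \<longrightarrow>
    (\<integral>\<^sup>+ y. ennreal ((1 + norm (x - y) / t) powr - a / t ^ DIM('a)) * h y \<partial>lebesgue)
      \<le> ennreal C * hl_max h x"
proof -
  let ?n = "DIM('a)"
  \<comment> \<open>The ball of radius 2^j t has volume growing like 2^(jn), while the kernel has
    decayed by 2^(-ja) on the j-th shell. The ratio of the resulting series is below 1 exactly
    because n < a.\<close>
  define b where "b = 2 powr (real ?n - a)"
  have b: "0 < b" "b < 1" using a by (auto simp: b_def powr_less_one)
  define C where "C = 2 powr a / (1 - b)"
  show ?thesis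
  proof (intro exI[of _ C] conjI allI impI)
    show "C > 0" using b by (simp add: C_def)
    fix h :: "'a \<Rightarrow> ennreal" and x :: 'a and t :: real
    assume [measurable]: "h \<in> borel_measurable lebesgue" and t: "t > 0"
    let ?B = "\<lambda>j::nat. ball x (2 ^ j * t)"
    let ?w = "\<lambda>j::nat. (2 powr a) * (2 powr - a) ^ j / t ^ ?n"
    have pt: "ennreal ((1 + norm (x - y) / t) powr - a / t ^ ?n) \<le> (\<Sum>j. ennreal (?w j) * indicator (?B j) y)" for y
    proof -
      define u where "u = 1 + norm (x - y) / t"
      have u: "u \<ge> 1" using t by (simp add: u_def)
      \<comment> \<open>The shell 2^(j-1) \<le> u \<le> 2^j. The summand 1 in \<open>u\<close> makes
        the distance strictly smaller than 2^j t, as an open ball requires; the lower end costs the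
        factor 2^a.\<close>
      define j where "j = nat \<lceil>log 2 u\<rceil>"
      have j: "log 2 u \<le> real j" "real j < log 2 u + 1"
        using u by (simp_all add: j_def) linarith+
      have "u \<le> 2 ^ j" using j(1) u by (simp add: log_le_iff powr_realpow)
      then have "norm (x - y) < 2 ^ j * t" using t by (simp add: u_def field_simps)
      then have y: "y \<in> ?B j" by (simp add: dist_norm)
      have "2 powr (real j - 1) \<le> u" using j(2) u by (simp add: le_log_iff[symmetric])
      then have "u powr - a \<le> (2 powr (real j - 1)) powr - a" using a u by (intro powr_mono2') auto
      also have "\<dots> = 2 powr a * 2 powr (- a * real j)"
        by (simp add: powr_powr powr_add[symmetric] algebra_simps)
      also have "2 powr (- a * real j) = (2 powr - a) ^ j"
        by (simp add: powr_power mult_ac)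
      finally have "u powr - a / t ^ ?n \<le> ?w j" using t by (intro divide_right_mono) auto
      then have "ennreal (u powr - a / t ^ ?n) \<le> (\<Sum>j\<in>{j}. ennreal (?w j) * indicator (?B j) y)"
        using y by (simp add: ennreal_leI)
      also have "\<dots> \<le> (\<Sum>j. ennreal (?w j) * indicator (?B j) y)"
        by (intro sum_le_suminf) auto
      finally show ?thesis by (simp add: u_def)
    qed
    have "(\<integral>\<^sup>+ y. ennreal ((1 + norm (x - y) / t) powr - a / t ^ ?n) * h y \<partial>lebesgue)
       \<le> (\<integral>\<^sup>+ y. (\<Sum>j. ennreal (?w j) * (h y * indicator (?B j) y)) \<partial>lebesgue)"
    proof (intro nn_integral_mono)
      fix y
      have "ennreal ((1 + norm (x - y) / t) powr - a / t ^ ?n) * h y \<le> (\<Sum>j. ennreal (?w j) * indicator (?B j) y) * h y"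
        by (intro mult_right_mono pt) auto
      also have "\<dots> = (\<Sum>j. ennreal (?w j) * (h y * indicator (?B j) y))"
        by (simp add: mult_ac flip: ennreal_suminf_multc)
      finally show "ennreal ((1 + norm (x - y) / t) powr - a / t ^ ?n) * h y \<le> \<dots>" .
    qed
    also have "\<dots> = (\<Sum>j. ennreal (?w j) * (\<integral>\<^sup>+ y. h y * indicator (?B j) y \<partial>lebesgue))"
      by (subst nn_integral_suminf) (auto simp: nn_integral_cmult)
    also have "\<dots> \<le> (\<Sum>j. ennreal (2 powr a * b ^ j) * hl_max h x)"
    proof (intro suminf_le)
      fix j
      have "ennreal (?w j) * (\<integral>\<^sup>+ y. h y * indicator (?B j) y \<partial>lebesgue)
          \<le> ennreal (?w j) * (hl_max h x * ennreal ((2 ^ j * t) ^ ?n))"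
        using t by (intro mult_left_mono hl_max_ball) auto
      also have "\<dots> = ennreal (?w j * (2 ^ j * t) ^ ?n) * hl_max h x"
        using t by (simp add: mult_ac flip: ennreal_mult)
      also have "?w j * (2 ^ j * t) ^ ?n = 2 powr a * b ^ j"
      proof -
        have "b = 2 powr - a * 2 ^ ?n" by (simp add: b_def powr_diff powr_minus powr_realpow field_simps)
        then have "b ^ j = (2 powr - a) ^ j * (2 ^ j) ^ ?n"
          by (simp add: power_mult_distrib mult.commute flip: power_mult)
        then show ?thesis using t by (simp add: power_mult_distrib)
      qed
      finally show "ennreal (?w j) * (\<integral>\<^sup>+ y. h y * indicator (?B j) y \<partial>lebesgue)
          \<le> ennreal (2 powr a * b ^ j) * hl_max h x" .
    qed auto
    also have "\<dots> = (\<Sum>j. ennreal (2 powr a * b ^ j)) * hl_max h x" by simp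
    also have "(\<Sum>j. ennreal (2 powr a * b ^ j)) = ennreal (2 powr a * (1 / (1 - b)))"
      using b by (intro suminf_ennreal_eq sums_mult geometric_sums) auto
    finally show "(\<integral>\<^sup>+ y. ennreal ((1 + norm (x - y) / t) powr - a / t ^ ?n) * h y \<partial>lebesgue)
      \<le> ennreal C * hl_max h x" by (simp add: C_def)
  qed
qed

section \<open>Partial derivatives\<close>

lemma partials_Nil [simp]: "partials [] f = f"
  by (simp add: partials_def)

lemma partials_Cons: "partials (i # is) f = partial i (partials is f)"
  by (simp add: partials_def)

lemma partials_append: "partials (is @ js) f = partials is (partials js f)"
  by (simp add: partials_def)

lemma partial_eqI: "(f has_derivative D) (at x) \<Longrightarrow> partial i f x = D (axis i 1)"
  unfolding partial_def by (simp add: frechet_derivative_at[symmetric])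

lemma has_derivative_partial:
  fixes f :: "real ^ 'n::finite \<Rightarrow> complex"
  assumes "f differentiable (at x)"
  shows "(f has_derivative (\<lambda>h. \<Sum>i\<in>UNIV. h $ i *\<^sub>R partial i f x)) (at x)"
proof -
  obtain D where D: "(f has_derivative D) (at x)" using assms by (auto simp: differentiable_def)
  interpret bounded_linear D using D by (rule has_derivative_bounded_linear)
  have "D h = (\<Sum>i\<in>UNIV. h $ i *\<^sub>R partial i f x)" for h
  proof -
    have "h = (\<Sum>i\<in>UNIV. h $ i *\<^sub>R axis i 1)"
      by (simp add: vec_eq_iff axis_def if_distrib cong: if_cong)
    then have "D h = D (\<Sum>i\<in>UNIV. h $ i *\<^sub>R axis i 1)" by simp
    also have "\<dots> = (\<Sum>i\<in>UNIV. h $ i *\<^sub>R D (axis i 1))" by (simp add: sum scaleR)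
    finally show ?thesis using D by (simp add: partial_eqI)
  qed
  then have "D = (\<lambda>h. \<Sum>i\<in>UNIV. h $ i *\<^sub>R partial i f x)" by blast
  with D show ?thesis by simp
qed

lemma partial_add_cmult:
  assumes "f differentiable (at x)" "g differentiable (at x)"
  shows "partial i (\<lambda>x. a * f x + b * g x) x = a * partial i f x + b * partial i g x"
proof -
  obtain D E where D: "(f has_derivative D) (at x)" "(g has_derivative E) (at x)"
    using assms by (auto simp: differentiable_def)
  have "((\<lambda>x. a * f x + b * g x) has_derivative (\<lambda>h. a * D h + b * E h)) (at x)"
    by (auto intro!: derivative_eq_intros D)
  from partial_eqI[OF this] show ?thesis using D by (simp add: partial_eqI)
qed

lemma partial_affine:
  assumes "f differentiable (at (c *\<^sub>R x + z))"
  shows "partial i (\<lambda>x. f (c *\<^sub>R x + z)) x = of_real c * partial i f (c *\<^sub>R x + z)"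
proof -
  obtain D where D: "(f has_derivative D) (at (c *\<^sub>R x + z))"
    using assms by (auto simp: differentiable_def)
  interpret bounded_linear D using D by (rule has_derivative_bounded_linear)
  have "((\<lambda>x. f (c *\<^sub>R x + z)) has_derivative (\<lambda>h. D (c *\<^sub>R h))) (at x)"
    by (rule has_derivative_compose[where g=f and f="\<lambda>x. c *\<^sub>R x + z", OF _ D])
      (auto intro!: derivative_eq_intros)
  from partial_eqI[OF this] show ?thesis
    using D by (simp add: partial_eqI scaleR) (simp add: scaleR_conv_of_real)
qed

lemma smooth_differentiable: "smooth f \<Longrightarrow> partials is f differentiable (at x)"
  by (simp add: smooth_def)

lemma smooth_partials: "smooth f \<Longrightarrow> smooth (partials is f)"
  by (simp add: smooth_def flip: partials_append)

lemma smooth_imp_differentiable: "smooth f \<Longrightarrow> f differentiable (at x)"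
  using smooth_differentiable[of f "[]"] by simp

lemma smooth_continuous: "smooth f \<Longrightarrow> continuous_on A (partials is f)"
  by (intro continuous_at_imp_continuous_on ballI differentiable_imp_continuous_within smooth_differentiable)

lemma partials_add_cmult:
  assumes "smooth f" "smooth g"
  shows "partials is (\<lambda>x. a * f x + b * g x) = (\<lambda>x. a * partials is f x + b * partials is g x)"
proof (induction "is")
  case (Cons i "is")
  then show ?case
    using assms by (simp only: partials_Cons) (simp add: partial_add_cmult smooth_differentiable)
qed simp

lemma partials_affine:
  assumes "smooth f"
  shows "partials is (\<lambda>x. f (c *\<^sub>R x + z)) = (\<lambda>x. of_real (c ^ length is) * partials is f (c *\<^sub>R x + z))"
proof (induction "is")
  case (Cons i "is")
  let ?g = "\<lambda>x. partials is f (c *\<^sub>R x + z)"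
  have d: "?g differentiable (at x)" for x
    by (rule differentiable_chain_at[of "\<lambda>x. c *\<^sub>R x + z" x "partials is f", unfolded o_def])
      (use assms in \<open>auto intro!: derivative_intros smooth_differentiable\<close>)
  show ?case
  proof
    fix x
    have "partials (i # is) (\<lambda>x. f (c *\<^sub>R x + z)) x = partial i (\<lambda>x. of_real (c ^ length is) * ?g x + 0 * ?g x) x"
      by (simp add: partials_Cons Cons)
    also have "\<dots> = of_real (c ^ length is) * partial i ?g x"
      by (subst partial_add_cmult) (auto intro: d)
    also have "\<dots> = of_real (c ^ length (i # is)) * partials (i # is) f (c *\<^sub>R x + z)"
      using assms by (subst partial_affine) (auto simp: smooth_differentiable partials_Cons)
    finally show "partials (i # is) (\<lambda>x. f (c *\<^sub>R x + z)) x = \<dots>" .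
  qed
qed auto

lemma smooth_add_cmult: "smooth f \<Longrightarrow> smooth g \<Longrightarrow> smooth (\<lambda>x. a * f x + b * g x)"
  unfolding smooth_def
  by (subst partials_add_cmult) (auto simp: smooth_def intro!: derivative_intros)

lemma smooth_affine:
  assumes "smooth f"
  shows "smooth (\<lambda>x. f (c *\<^sub>R x + z))"
  unfolding smooth_def
proof (intro allI)
  fix "is" x
  have "(\<lambda>x. partials is f (c *\<^sub>R x + z)) differentiable (at x)"
    by (rule differentiable_chain_at[of "\<lambda>x. c *\<^sub>R x + z" x "partials is f", unfolded o_def])
      (use assms in \<open>auto intro!: derivative_intros smooth_differentiable\<close>)
  then show "partials is (\<lambda>x. f (c *\<^sub>R x + z)) differentiable (at x)"
    using assms by (subst partials_affine) (auto intro!: derivative_intros)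
qed

text \<open>Both mixed derivatives are values of the second difference of \<open>u\<close> near the origin.\<close>

lemma mixed_derivatives_eq:
  fixes u :: "real \<Rightarrow> real \<Rightarrow> real"
  assumes u1: "\<And>s t. ((\<lambda>s. u s t) has_real_derivative u1 s t) (at s)"
    and u2: "\<And>s t. ((\<lambda>t. u s t) has_real_derivative u2 s t) (at t)"
    and u12: "\<And>s t. ((\<lambda>t. u1 s t) has_real_derivative u12 s t) (at t)"
    and u21: "\<And>s t. ((\<lambda>s. u2 s t) has_real_derivative u21 s t) (at s)"
    and c12: "isCont (\<lambda>z. u12 (fst z) (snd z)) (0, 0)"
    and c21: "isCont (\<lambda>z. u21 (fst z) (snd z)) (0, 0)"
  shows "u12 0 0 = u21 0 0"
proof (rule ccontr)
  assume ne: "u12 0 0 \<noteq> u21 0 0"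
  define e where "e = \<bar>u12 0 0 - u21 0 0\<bar> / 2"
  have e: "e > 0" using ne by (simp add: e_def)
  obtain d1 where d1: "d1 > 0" "\<And>z. dist z (0, 0) < d1 \<Longrightarrow> dist (u12 (fst z) (snd z)) (u12 0 0) < e"
    using c12 e unfolding continuous_at_eps_delta by fastforce
  obtain d2 where d2: "d2 > 0" "\<And>z. dist z (0, 0) < d2 \<Longrightarrow> dist (u21 (fst z) (snd z)) (u21 0 0) < e"
    using c21 e unfolding continuous_at_eps_delta by fastforce
  define h where "h = min d1 d2 / 2"
  have h: "h > 0" using d1 d2 by (simp add: h_def)
  have near: "dist (a, b) (0, 0) < min d1 d2" if "0 < a" "a < h" "0 < b" "b < h" for a b :: real
  proof -
    have "dist (a, b) (0, 0) \<le> \<bar>a\<bar> + \<bar>b\<bar>" by (simp add: dist_norm norm_Pair_le[THEN order_trans])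
    also have "\<dots> < min d1 d2" using that by (simp add: h_def)
    finally show ?thesis .
  qed
  define D where "D = u h h - u h 0 - u 0 h + u 0 0"
  obtain a where a: "0 < a" "a < h" "(u h h - u h 0) - (u 0 h - u 0 0) = (h - 0) * (u1 a h - u1 a 0)"
    using MVT2[OF h DERIV_diff[OF u1[of h] u1[of 0]]] by blast
  obtain b where b: "0 < b" "b < h" "u1 a h - u1 a 0 = (h - 0) * u12 a b"
    using MVT2[of 0 h "\<lambda>t. u1 a t" "\<lambda>t. u12 a t"] h u12 by auto
  obtain a' where a': "0 < a'" "a' < h" "(u h h - u 0 h) - (u h 0 - u 0 0) = (h - 0) * (u2 h a' - u2 0 a')"
    using MVT2[OF h DERIV_diff[OF u2[of h] u2[of 0]]] by blast
  obtain b' where b': "0 < b'" "b' < h" "u2 h a' - u2 0 a' = (h - 0) * u21 b' a'"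
    using MVT2[of 0 h "\<lambda>s. u2 s a'" "\<lambda>s. u21 s a'"] h u21 by auto
  have "h * (h * u12 a b) = h * (h * u21 b' a')" using a(3) b(3) a'(3) b'(3) by (simp add: algebra_simps)
  then have "u12 a b = u21 b' a'" using h by simp
  moreover have "dist (u12 a b) (u12 0 0) < e" using d1(2)[of "(a, b)"] near[of a b] a b by simp
  moreover have "dist (u21 b' a') (u21 0 0) < e" using d2(2)[of "(b', a')"] near[of b' a'] a' b' by simp
  ultimately show False
    using dist_triangle[of "u12 0 0" "u21 0 0" "u12 a b"] unfolding e_def dist_real_def[symmetric]
    by (simp add: dist_commute)
qed

lemma has_vector_derivative_partial:
  assumes "f differentiable (at (x + s *\<^sub>R axis i 1))"
  shows "((\<lambda>s. f (x + s *\<^sub>R axis i 1)) has_vector_derivative partial i f (x + s *\<^sub>R axis i 1)) (at s)"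
proof -
  obtain D where D: "(f has_derivative D) (at (x + s *\<^sub>R axis i 1))"
    using assms by (auto simp: differentiable_def)
  interpret bounded_linear D using D by (rule has_derivative_bounded_linear)
  have "((\<lambda>s. f (x + s *\<^sub>R axis i 1)) has_derivative (\<lambda>h. D (h *\<^sub>R axis i 1))) (at s)"
    by (rule has_derivative_compose[where g=f and f="\<lambda>s. x + s *\<^sub>R axis i 1", OF _ D])
      (auto intro!: derivative_eq_intros)
  then show ?thesis using D by (simp add: has_vector_derivative_def partial_eqI scaleR)
qed

text \<open>The second-difference argument uses the mean value theorem and hence real values. It is
  therefore applied to the real and imaginary part of \<open>f\<close>, restricted to the parameters
  s, t along the two axes; the directions may coincide.\<close>

lemma partial_commute:
  assumes f: "smooth f"
  shows "partial i (partial j f) = partial j (partial i f)"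
proof
  fix x
  have *: "L (partial j (partial i f) x) = L (partial i (partial j f) x)" if L: "bounded_linear L" for L :: "complex \<Rightarrow> real"
  proof -
    interpret L: bounded_linear L by fact
    let ?z = "\<lambda>s t. x + s *\<^sub>R axis i 1 + t *\<^sub>R axis j 1"
    have z: "?z s t = (x + t *\<^sub>R axis j 1) + s *\<^sub>R axis i 1" for s t by simp
    have d: "f differentiable (at y)" "partial k f differentiable (at y)" for y k
      using smooth_differentiable[OF f, of "[]"] smooth_differentiable[OF f, of "[k]"] by (auto simp: partials_Cons)
    have "continuous_on UNIV (partial k (partial k' f))" for k k'
      using smooth_continuous[OF f, of UNIV "[k, k']"] by (simp add: partials_Cons)
    then have "continuous_on UNIV (\<lambda>p. partial k (partial k' f) (?z (fst p) (snd p)))" for k k'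
      by (rule continuous_on_compose2) (auto intro!: continuous_intros)
    then have c: "isCont (\<lambda>p. L (partial k (partial k' f) (?z (fst p) (snd p)))) (0, 0)" for k k'
      by (intro L.isCont) (simp add: continuous_on_eq_continuous_at)
    have i: "((\<lambda>s. L (g (?z s t))) has_real_derivative L (partial i g (?z s t))) (at s)"
      if "\<And>y. g differentiable (at y)" for g s t
      unfolding z has_real_derivative_iff_has_vector_derivative
      by (intro L.has_vector_derivative has_vector_derivative_partial) (rule that)
    have j: "((\<lambda>t. L (g (?z s t))) has_real_derivative L (partial j g (?z s t))) (at t)"
      if "\<And>y. g differentiable (at y)" for g s t
      unfolding has_real_derivative_iff_has_vector_derivative
      by (intro L.has_vector_derivative has_vector_derivative_partial) (rule that)
    have "L (partial j (partial i f) (?z 0 0)) = L (partial i (partial j f) (?z 0 0))"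
      by (rule mixed_derivatives_eq[OF i[OF d(1)] j[OF d(1)] j[OF d(2)] i[OF d(2)] c c])
    then show ?thesis by simp
  qed
  show "partial i (partial j f) x = partial j (partial i f) x"
    using *[OF bounded_linear_Re] *[OF bounded_linear_Im] by (simp add: complex_eq_iff)
qed

lemma partials_middle:
  assumes "smooth f"
  shows "partials (js @ i # ks) f = partials (i # js @ ks) f"
proof (induction js)
  case (Cons j js)
  have "partials ((j # js) @ i # ks) f = partial j (partial i (partials (js @ ks) f))"
    using Cons by (simp add: partials_Cons)
  also have "\<dots> = partial i (partial j (partials (js @ ks) f))"
    by (rule partial_commute) (rule smooth_partials[OF assms])
  finally show ?case by (simp add: partials_Cons)
qed simp

lemma partials_perm:
  assumes "smooth f"
  shows "mset is = mset js \<Longrightarrow> partials is f = partials js f"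
proof (induction "is" arbitrary: js)
  case (Cons i "is")
  then have "i \<in> set js" by (metis list.set_intros(1) set_mset_mset)
  then obtain js1 js2 where js: "js = js1 @ i # js2" by (meson split_list)
  with Cons.prems have "mset is = mset (js1 @ js2)" by simp
  then have "partials is f = partials (js1 @ js2) f" by (rule Cons.IH)
  then show ?case unfolding js partials_middle[OF assms] by (simp add: partials_Cons)
qed simp

text \<open>The list chosen by \<open>SOME\<close> has the same multiplicities as the given one, so
  symmetry of the derivatives identifies the two. From here on multi-indices are replaced by lists
  of directions, on which induction is available.\<close>

lemma mi_deriv_count_list:
  assumes "smooth f"
  shows "mi_deriv (count_list is) f = partials is f"
proof -
  have "\<exists>js. \<forall>i. count_list js i = count_list is i" by auto
  then have "\<forall>i. count_list (SOME js. \<forall>i. count_list js i = count_list is i) i = count_list is i"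
    by (rule someI_ex)
  then have "mset (SOME js. \<forall>i. count_list js i = count_list is i) = mset is"
    by (simp add: multiset_eq_iff count_mset)
  then show ?thesis unfolding mi_deriv_def by (rule partials_perm[OF assms])
qed

lemma mi_order_count_list: "mi_order (count_list is) = length (is :: 'n::finite list)"
  unfolding mi_order_def by (rule sum_count_set) auto

text \<open>On a finite type every function has finite support and hence is the count function of a
  multiset.\<close>

lemma ex_count_list: "\<exists>is. count_list is = (\<alpha> :: 'n::finite \<Rightarrow> nat)"
proof -
  obtain "is" where "mset is = Abs_multiset \<alpha>" using ex_mset by blast
  then have "count (mset is) = \<alpha>" by simp
  then show ?thesis by (auto simp: fun_eq_iff count_mset)
qed

section \<open>Schwartz functions\<close>

definition schwartz_bound :: "nat \<Rightarrow> real \<Rightarrow> (real ^ 'n::finite \<Rightarrow> complex) \<Rightarrow> real \<Rightarrow> bool" where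
  "schwartz_bound k m \<phi> C \<longleftrightarrow>
     (\<forall>is x. length is \<le> k \<longrightarrow> cmod (partials is \<phi> x) \<le> C * (1 + norm x) powr - m)"

lemma schwartz_boundD: "schwartz_bound k m \<phi> C \<Longrightarrow> cmod (\<phi> x) \<le> C * (1 + norm x) powr - m"
  unfolding schwartz_bound_def by (drule spec[of _ "[]"]) simp

lemma schwartz_bound_nonneg: "schwartz_bound k m \<phi> C \<Longrightarrow> 0 \<le> C"
  using order_trans[OF norm_ge_zero schwartz_boundD, of k m \<phi> C 0] by simp

lemma schwartz_bound_mono:
  assumes "schwartz_bound k m \<phi> C" "k' \<le> k" "m' \<le> m" "C \<le> C'"
  shows "schwartz_bound k' m' \<phi> C'"
  unfolding schwartz_bound_def
proof (intro allI impI)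
  fix "is" :: "'a list" and x assume "length is \<le> k'"
  then have "cmod (partials is \<phi> x) \<le> C * (1 + norm x) powr - m"
    using assms(1,2) unfolding schwartz_bound_def by simp
  also have "\<dots> \<le> C' * (1 + norm x) powr - m'"
    using assms schwartz_bound_nonneg[OF assms(1)] by (intro mult_mono powr_mono) auto
  finally show "cmod (partials is \<phi> x) \<le> \<dots>" .
qed

lemma powr_bound_iff:
  assumes "0 < (u::real)"
  shows "u powr m * a \<le> C \<longleftrightarrow> a \<le> C * u powr - m"
  using assms by (simp add: powr_minus field_simps)

lemma schwartz_norm_le_iff:
  assumes "smooth \<phi>" "0 \<le> C"
  shows "schwartz_norm k m \<phi> \<le> ennreal C \<longleftrightarrow> schwartz_bound k m \<phi> C"
proof -
  have "schwartz_norm k m \<phi> \<le> ennreal C \<longleftrightarrow>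
      (\<forall>\<alpha> x. mi_order \<alpha> \<le> k \<longrightarrow> (1 + norm x) powr m * cmod (mi_deriv \<alpha> \<phi> x) \<le> C)"
    using assms(2) by (auto simp: schwartz_norm_def SUP_le_iff)
  also have "\<dots> \<longleftrightarrow> (\<forall>is x. length is \<le> k \<longrightarrow> (1 + norm x) powr m * cmod (partials is \<phi> x) \<le> C)"
    by (metis ex_count_list mi_deriv_count_list[OF assms(1)] mi_order_count_list)
  also have "\<dots> \<longleftrightarrow> schwartz_bound k m \<phi> C"
    unfolding schwartz_bound_def by (subst powr_bound_iff) (auto simp: add_pos_nonneg)
  finally show ?thesis .
qed

lemma schwartz_iff:
  "\<phi> \<in> schwartz \<longleftrightarrow> smooth \<phi> \<and> (\<forall>k m. \<exists>C. schwartz_bound k m \<phi> C)"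
proof
  assume *: "\<phi> \<in> schwartz"
  then have s: "smooth \<phi>" by (simp add: schwartz_def)
  have "\<exists>C. schwartz_bound k m \<phi> C" for k m
  proof -
    \<comment> \<open>Finiteness is known for positive weights only; a bound with a larger weight
      implies the one with the smaller weight.\<close>
    have "schwartz_norm k (max m 1) \<phi> < \<infinity>" using * by (simp add: schwartz_def)
    then obtain C where "schwartz_norm k (max m 1) \<phi> = ennreal C" "0 \<le> C"
      by (metis ennreal_cases infinity_ennreal_def less_irrefl)
    then have "schwartz_bound k (max m 1) \<phi> C" using schwartz_norm_le_iff[OF s] by (metis order_refl)
    then show ?thesis by (intro exI[of _ C]) (erule schwartz_bound_mono, auto)
  qed
  with s show "smooth \<phi> \<and> (\<forall>k m. \<exists>C. schwartz_bound k m \<phi> C)" by blast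
next
  assume *: "smooth \<phi> \<and> (\<forall>k m. \<exists>C. schwartz_bound k m \<phi> C)"
  have "schwartz_norm k m \<phi> < \<infinity>" for k m
  proof -
    obtain C where C: "schwartz_bound k m \<phi> C" using * by blast
    then have "schwartz_norm k m \<phi> \<le> ennreal C"
      using * schwartz_norm_le_iff schwartz_bound_nonneg by blast
    then show ?thesis by (simp add: le_less_trans)
  qed
  with * show "\<phi> \<in> schwartz" by (simp add: schwartz_def)
qed

lemma schwartz_smooth: "\<phi> \<in> schwartz \<Longrightarrow> smooth \<phi>"
  by (simp add: schwartz_def)

lemma schwartz_boundE:
  assumes "\<phi> \<in> schwartz"
  obtains C where "0 < C" "schwartz_bound k m \<phi> C"
proof -
  obtain C where C: "schwartz_bound k m \<phi> C" using assms by (auto simp: schwartz_iff)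
  show ?thesis
    by (rule that[of "C + 1"])
      (use schwartz_bound_nonneg[OF C] schwartz_bound_mono[OF C] in auto)
qed

lemma schwartz_bound_add_cmult:
  assumes "smooth \<phi>" "smooth \<psi>" "schwartz_bound k m \<phi> C" "schwartz_bound k m \<psi> D"
  shows "schwartz_bound k m (\<lambda>x. a * \<phi> x + b * \<psi> x) (cmod a * C + cmod b * D)"
  unfolding schwartz_bound_def
proof (intro allI impI)
  fix "is" :: "'a list" and x assume l: "length is \<le> k"
  have "cmod (partials is (\<lambda>x. a * \<phi> x + b * \<psi> x) x) \<le> cmod a * cmod (partials is \<phi> x) + cmod b * cmod (partials is \<psi> x)"
    using assms by (simp add: partials_add_cmult norm_mult norm_triangle_le)
  also have "\<dots> \<le> cmod a * (C * (1 + norm x) powr - m) + cmod b * (D * (1 + norm x) powr - m)"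
    using assms(3,4) l by (intro add_mono mult_left_mono) (auto simp: schwartz_bound_def)
  finally show "cmod (partials is (\<lambda>x. a * \<phi> x + b * \<psi> x) x) \<le> (cmod a * C + cmod b * D) * (1 + norm x) powr - m"
    by (simp add: algebra_simps)
qed

lemma schwartz_add_cmult:
  assumes "\<phi> \<in> schwartz" "\<psi> \<in> schwartz"
  shows "(\<lambda>x. a * \<phi> x + b * \<psi> x) \<in> schwartz"
  unfolding schwartz_iff
proof (intro conjI allI)
  show "smooth (\<lambda>x. a * \<phi> x + b * \<psi> x)" using assms by (simp add: smooth_add_cmult schwartz_smooth)
  fix k m
  obtain C D where "schwartz_bound k m \<phi> C" "schwartz_bound k m \<psi> D"
    using assms by (meson schwartz_boundE)
  then show "\<exists>C. schwartz_bound k m (\<lambda>x. a * \<phi> x + b * \<psi> x) C"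
    using schwartz_bound_add_cmult assms schwartz_smooth by blast
qed

lemma schwartz_cmult: "\<phi> \<in> schwartz \<Longrightarrow> (\<lambda>x. a * \<phi> x) \<in> schwartz"
  using schwartz_add_cmult[of \<phi> \<phi> a 0] by simp

lemma schwartz_diff: "\<phi> \<in> schwartz \<Longrightarrow> \<psi> \<in> schwartz \<Longrightarrow> (\<lambda>x. \<phi> x - \<psi> x) \<in> schwartz"
  using schwartz_add_cmult[of \<phi> \<psi> 1 "-1"] by simp

lemma schwartz_zero: "(\<lambda>x::real^'n::finite. 0) \<in> schwartz"
proof -
  have "partials is (\<lambda>x::real^'n. 0::complex) = (\<lambda>x. 0)" for "is"
    by (induction "is") (auto simp: partials_Cons fun_eq_iff intro!: partial_eqI)
  then show ?thesis
    unfolding schwartz_iff smooth_def schwartz_bound_def by (auto intro!: exI[of _ 0])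
qed

lemma schwartz_bound_cmult:
  "smooth \<phi> \<Longrightarrow> schwartz_bound k m \<phi> C \<Longrightarrow> schwartz_bound k m (\<lambda>x. a * \<phi> x) (cmod a * C)"
  using schwartz_bound_add_cmult[of \<phi> \<phi> k m C C a 0] by simp

lemma schwartz_bound_diff:
  "smooth \<phi> \<Longrightarrow> smooth \<psi> \<Longrightarrow> schwartz_bound k m \<phi> C \<Longrightarrow> schwartz_bound k m \<psi> D
    \<Longrightarrow> schwartz_bound k m (\<lambda>x. \<phi> x - \<psi> x) (C + D)"
  using schwartz_bound_add_cmult[of \<phi> \<psi> k m C D 1 "-1"] by simp

section \<open>Weights under translations and affine maps\<close>

lemma one_plus_norm_mult: "1 + norm (x + y) \<le> (1 + norm x) * (1 + norm (y::'a::real_normed_vector))"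
proof -
  have "0 \<le> norm x * norm y" by simp
  then show ?thesis using norm_triangle_ineq[of x y] unfolding ring_distribs by linarith
qed

text \<open>With \<open>one_plus_norm_mult\<close> this becomes Peetre's inequality: moving the
  centre of a weight of order m by y costs the factor (1 + |y|)^m.\<close>

lemma powr_mult_bound:
  assumes "0 < u" "0 < v" "0 < w" "v \<le> w * u" "0 \<le> (m::real)"
  shows "u powr - m \<le> w powr m * v powr - m"
proof -
  have "v powr m \<le> (w * u) powr m" using assms by (intro powr_mono2) auto
  then show ?thesis using assms by (simp add: powr_mult powr_minus field_simps)
qed

text \<open>\<open>M\<close> bounds both |c| and 1/|c|. The power M^k pays for the chain rule in up
  to k derivatives, the other power for comparing the weight at x with the weight at c x +
  a.\<close>

lemma schwartz_bound_affine:
  assumes sm: "smooth \<phi>" and b: "schwartz_bound k m \<phi> C" and m: "0 \<le> m"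
    and M: "1 \<le> M" "\<bar>c\<bar> \<le> M" "1 \<le> M * \<bar>c\<bar>"
  shows "schwartz_bound k m (\<lambda>x. \<phi> (c *\<^sub>R x + a)) (M ^ k * (M * (1 + norm a)) powr m * C)"
  unfolding schwartz_bound_def
proof (intro allI impI)
  fix "is" :: "'a list" and x assume l: "length is \<le> k"
  have C: "C \<ge> 0" using b by (rule schwartz_bound_nonneg)
  let ?y = "c *\<^sub>R x + a"
  have "1 + norm x \<le> M + (M * \<bar>c\<bar>) * norm x" using M(1) mult_right_mono[OF M(3) norm_ge_zero[of x]] by simp
  also have "\<dots> = M * (1 + norm (?y - a))" by (simp add: algebra_simps)
  also have "\<dots> \<le> M * ((1 + norm ?y) * (1 + norm a))"
    using one_plus_norm_mult[of ?y "-a"] M by (intro mult_left_mono) auto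
  finally have le: "1 + norm x \<le> (M * (1 + norm a)) * (1 + norm ?y)" by (simp add: mult_ac)
  have "cmod (partials is (\<lambda>x. \<phi> (c *\<^sub>R x + a)) x) = \<bar>c\<bar> ^ length is * cmod (partials is \<phi> ?y)"
    using sm by (simp add: partials_affine norm_mult norm_power)
  also have "\<dots> \<le> M ^ k * (C * (1 + norm ?y) powr - m)"
  proof (intro mult_mono)
    have "\<bar>c\<bar> ^ length is \<le> M ^ length is" using M by (intro power_mono) auto
    also have "\<dots> \<le> M ^ k" using M l by (intro power_increasing) auto
    finally show "\<bar>c\<bar> ^ length is \<le> M ^ k" .
  qed (use b l M in \<open>auto simp: schwartz_bound_def\<close>)
  also have "\<dots> \<le> M ^ k * (C * ((M * (1 + norm a)) powr m * (1 + norm x) powr - m))"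
  proof -
    have "0 < M * (1 + norm a)" using M by (simp add: add_pos_nonneg)
    then show ?thesis using le m M C
      by (intro mult_left_mono powr_mult_bound) (auto simp: add_pos_nonneg)
  qed
  finally show "cmod (partials is (\<lambda>x. \<phi> (c *\<^sub>R x + a)) x)
      \<le> M ^ k * (M * (1 + norm a)) powr m * C * (1 + norm x) powr - m" by (simp add: mult_ac)
qed

lemma schwartz_affine:
  assumes "\<phi> \<in> schwartz" "c \<noteq> 0"
  shows "(\<lambda>x. \<phi> (c *\<^sub>R x + a)) \<in> schwartz"
  unfolding schwartz_iff
proof (intro conjI allI)
  show "smooth (\<lambda>x. \<phi> (c *\<^sub>R x + a))" using assms by (simp add: smooth_affine schwartz_smooth)
  fix k m
  obtain C where C: "schwartz_bound k (max m 0) \<phi> C" using assms by (meson schwartz_boundE)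
  define M where "M = max 1 (max \<bar>c\<bar> (1 / \<bar>c\<bar>))"
  have "1 / \<bar>c\<bar> \<le> M" by (simp add: M_def)
  then have "1 \<le> M * \<bar>c\<bar>" using assms(2) by (simp add: field_simps)
  then have "schwartz_bound k (max m 0) (\<lambda>x. \<phi> (c *\<^sub>R x + a)) (M ^ k * (M * (1 + norm a)) powr (max m 0) * C)"
    using assms by (intro schwartz_bound_affine C schwartz_smooth) (auto simp: M_def)
  then show "\<exists>C. schwartz_bound k m (\<lambda>x. \<phi> (c *\<^sub>R x + a)) C"
    by (intro exI) (erule schwartz_bound_mono, auto)
qed

lemma norm_diff_le_partial:
  fixes f :: "real ^ 'n::finite \<Rightarrow> complex"
  assumes d: "\<And>x. f differentiable (at x)"
    and B: "\<And>i x. x \<in> closed_segment a b \<Longrightarrow> cmod (partial i f x) \<le> B"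
  shows "cmod (f a - f b) \<le> real CARD('n) * B * norm (a - b)"
proof (rule differentiable_bound[of "closed_segment a b" f "\<lambda>x h. \<Sum>i\<in>UNIV. h $ i *\<^sub>R partial i f x"])
  fix x assume x: "x \<in> closed_segment a b"
  show "onorm (\<lambda>h. \<Sum>i\<in>UNIV. h $ i *\<^sub>R partial i f x) \<le> real CARD('n) * B"
  proof (rule onorm_le)
    fix h :: "real ^ 'n"
    have "cmod (\<Sum>i\<in>UNIV. h $ i *\<^sub>R partial i f x) \<le> (\<Sum>i\<in>(UNIV::'n set). norm h * B)"
      by (intro sum_norm_le) (auto intro!: mult_mono component_le_norm_cart B x)
    then show "cmod (\<Sum>i\<in>UNIV. h $ i *\<^sub>R partial i f x) \<le> real CARD('n) * B * norm h"
      by (simp add: mult_ac)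
  qed
qed (use d in \<open>auto intro: has_derivative_partial has_derivative_at_withinI\<close>)

text \<open>The mean value theorem on the segment joining the two arguments. Each of its points is c
  x + y with |y| \<le> |a| + |a'|, so the weight there is comparable to the weight at x. One
  derivative more than \<open>k\<close> is spent on the gradient.\<close>

lemma partials_translate_diff_le:
  fixes \<phi> :: "real ^ 'n::finite \<Rightarrow> complex"
  assumes sm: "smooth \<phi>" and b: "schwartz_bound (Suc k) m \<phi> C" and m: "0 \<le> m" and c: "\<bar>c\<bar> = 1"
    and l: "length is \<le> k"
  shows "cmod (partials is \<phi> (c *\<^sub>R x + a) - partials is \<phi> (c *\<^sub>R x + a'))
    \<le> real CARD('n) * C * (1 + norm a + norm a') powr m * norm (a - a') * (1 + norm x) powr - m"
proof -
  have C: "C \<ge> 0" using b by (rule schwartz_bound_nonneg)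
  let ?w = "1 + norm a + norm a'"
  have "cmod (partials is \<phi> (c *\<^sub>R x + a) - partials is \<phi> (c *\<^sub>R x + a')) \<le> real CARD('n) * (C * (?w powr m * (1 + norm x) powr - m)) * norm ((c *\<^sub>R x + a) - (c *\<^sub>R x + a'))"
  proof (rule norm_diff_le_partial)
    fix i z assume z: "z \<in> closed_segment (c *\<^sub>R x + a) (c *\<^sub>R x + a')"
    then obtain u where u: "0 \<le> u" "u \<le> 1" "z = (1 - u) *\<^sub>R (c *\<^sub>R x + a) + u *\<^sub>R (c *\<^sub>R x + a')"
      by (auto simp: closed_segment_def)
    define y where "y = (1 - u) *\<^sub>R a + u *\<^sub>R a'"
    have z': "z = c *\<^sub>R x + y" by (simp add: u(3) y_def algebra_simps)
    have "norm y \<le> norm a + norm a'"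
      unfolding y_def using u by (intro norm_triangle_le add_mono) (simp_all add: mult_left_le_one_le)
    then have y: "1 + norm y \<le> ?w" by simp
    have "cmod (partial i (partials is \<phi>) z) \<le> C * (1 + norm z) powr - m"
      using b l unfolding schwartz_bound_def by (metis Suc_le_mono length_Cons partials_Cons)
    also have "\<dots> \<le> C * (?w powr m * (1 + norm x) powr - m)"
    proof (intro mult_left_mono powr_mult_bound C m)
      have "norm x = norm (z - y)" using c by (simp add: z')
      then have "1 + norm x \<le> (1 + norm z) * (1 + norm y)" using one_plus_norm_mult[of z "-y"] by simp
      also have "\<dots> \<le> (1 + norm z) * ?w" using y by (intro mult_left_mono) auto
      finally show "1 + norm x \<le> ?w * (1 + norm z)" by (simp add: mult.commute)
    qed (auto simp: add_pos_nonneg)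
    finally show "cmod (partial i (partials is \<phi>) z) \<le> \<dots>" .
  qed (use sm in \<open>simp add: smooth_differentiable\<close>)
  then show ?thesis by (simp add: mult_ac)
qed

text \<open>For \<open>c = -1\<close> the functions are \<open>x \<mapsto> \<phi>(a - x)\<close>, as they occur in convolutions.\<close>

lemma schwartz_bound_translate_diff:
  fixes \<phi> :: "real ^ 'n::finite \<Rightarrow> complex"
  assumes sm: "smooth \<phi>" and b: "schwartz_bound (Suc k) m \<phi> C" and m: "0 \<le> m" and c: "\<bar>c\<bar> = 1"
  shows "schwartz_bound k m (\<lambda>x. \<phi> (c *\<^sub>R x + a) - \<phi> (c *\<^sub>R x + a'))
    (real CARD('n) * C * (1 + norm a + norm a') powr m * norm (a - a'))"
  unfolding schwartz_bound_def
proof (intro allI impI)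
  fix "is" :: "'n list" and x assume l: "length is \<le> k"
  have "partials is (\<lambda>x. \<phi> (c *\<^sub>R x + a) - \<phi> (c *\<^sub>R x + a')) x
     = of_real (c ^ length is) * (partials is \<phi> (c *\<^sub>R x + a) - partials is \<phi> (c *\<^sub>R x + a'))"
    using partials_add_cmult[OF smooth_affine[OF sm, of c a] smooth_affine[OF sm, of c a'], of "is" 1 "-1"]
    by (simp add: partials_affine[OF sm] right_diff_distrib)
  then have "cmod (partials is (\<lambda>x. \<phi> (c *\<^sub>R x + a) - \<phi> (c *\<^sub>R x + a')) x)
     = cmod (partials is \<phi> (c *\<^sub>R x + a) - partials is \<phi> (c *\<^sub>R x + a'))"
    using c by (simp add: norm_mult norm_power)
  also have "\<dots> \<le> real CARD('n) * C * (1 + norm a + norm a') powr m * norm (a - a') * (1 + norm x) powr - m"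
    by (rule partials_translate_diff_le[OF sm b m c l])
  finally show "cmod (partials is (\<lambda>x. \<phi> (c *\<^sub>R x + a) - \<phi> (c *\<^sub>R x + a')) x)
    \<le> real CARD('n) * C * (1 + norm a + norm a') powr m * norm (a - a') * (1 + norm x) powr - m"
    .
qed

section \<open>Measurability and integrability\<close>

lemma schwartz_measurable [measurable_dest]: "\<phi> \<in> schwartz \<Longrightarrow> \<phi> \<in> borel_measurable lebesgue"
proof -
  assume "\<phi> \<in> schwartz"
  then have "continuous_on UNIV \<phi>" using smooth_continuous[of \<phi> UNIV "[]"] by (simp add: schwartz_smooth)
  then have "\<phi> \<in> borel_measurable lborel" by (simp add: borel_measurable_continuous_onI)
  then show ?thesis by (rule measurable_completion)
qed

lemma borel_measurable_lebesgue_continuous: "continuous_on UNIV f \<Longrightarrow> f \<in> borel_measurable lebesgue"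
  by (rule measurable_completion) (simp add: borel_measurable_continuous_onI)

text \<open>No polar coordinates are needed: the integral is the left side of the kernel estimate
  for the constant function 1 at the origin with t = 1, and the maximal function of a constant is
  finite.\<close>

lemma integrable_one_plus_norm:
  assumes "real DIM('a) < a"
  shows "integrable lebesgue (\<lambda>x::'a::euclidean_space. (1 + norm x) powr - a)"
proof (rule integrableI_nonneg)
  show "(\<lambda>x::'a. (1 + norm x) powr - a) \<in> borel_measurable lebesgue"
    by (intro borel_measurable_lebesgue_continuous continuous_intros) (auto simp: add_nonneg_eq_0_iff)
  obtain C where "\<forall>(h::'a \<Rightarrow> ennreal) x t. h \<in> borel_measurable lebesgue \<longrightarrow> 0 < t \<longrightarrow>
    (\<integral>\<^sup>+ y. ennreal ((1 + norm (x - y) / t) powr - a / t ^ DIM('a)) * h y \<partial>lebesgue) \<le> ennreal C * hl_max h x"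
    using hl_max_kernel[OF assms] by blast
  from this[rule_format, of "\<lambda>_. ennreal 1" 1 0]
  have "(\<integral>\<^sup>+ x. ennreal ((1 + norm (x::'a)) powr - a) \<partial>lebesgue) \<le> ennreal C * hl_max (\<lambda>_::'a. ennreal 1) 0" by simp
  also have "\<dots> \<le> ennreal C * (ennreal (unit_ball_vol DIM('a)) * ennreal 1)"
    by (intro mult_left_mono hl_max_const) auto
  also have "\<dots> < \<infinity>" by (simp add: ennreal_mult_less_top)
  finally show "(\<integral>\<^sup>+ x. ennreal ((1 + norm (x::'a)) powr - a) \<partial>lebesgue) < \<infinity>" .
qed auto

lemma schwartz_integrable_weight:
  fixes \<phi> :: "real ^ 'n::finite \<Rightarrow> complex"
  assumes "\<phi> \<in> schwartz" and [measurable]: "f \<in> borel_measurable lebesgue"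
    and f: "\<And>x. cmod (f x) \<le> B * (1 + norm x) powr a"
  shows "integrable lebesgue (\<lambda>x. f x * \<phi> x)"
proof -
  let ?b = "real CARD('n) + 1"
  obtain C where C: "0 < C" "schwartz_bound 0 (a + ?b) \<phi> C" using assms(1) by (rule schwartz_boundE)
  have "integrable lebesgue (\<lambda>x. B * C * (1 + norm (x::real^'n)) powr - ?b)"
    by (intro integrable_mult_right integrable_one_plus_norm) simp
  then show ?thesis
  proof (rule Bochner_Integration.integrable_bound)
    show "(\<lambda>x. f x * \<phi> x) \<in> borel_measurable lebesgue" using assms(1) by measurable
    have "cmod (f x * \<phi> x) \<le> B * C * (1 + norm x) powr - ?b" for x
    proof -
      have "cmod (f x * \<phi> x) \<le> (B * (1 + norm x) powr a) * (C * (1 + norm x) powr - (a + ?b))"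
        unfolding norm_mult by (intro mult_mono f schwartz_boundD[OF C(2)]) (auto intro: order_trans[OF _ f])
      also have "\<dots> = B * C * ((1 + norm x) powr a * (1 + norm x) powr - (a + ?b))" by (simp add: mult_ac)
      also have "(1 + norm x) powr a * (1 + norm x) powr - (a + ?b) = (1 + norm x) powr - ?b"
        by (subst powr_add[symmetric]) (auto intro: arg_cong2[of _ _ _ _ "(powr)"])
      finally show ?thesis .
    qed
    then show "AE x in lebesgue. cmod (f x * \<phi> x) \<le> norm (B * C * (1 + norm x) powr - ?b)"
      by (intro AE_I2) (metis abs_ge_self order_trans real_norm_def)
  qed
qed

lemma schwartz_integrable:
  fixes \<phi> :: "real ^ 'n::finite \<Rightarrow> complex"
  assumes "\<phi> \<in> schwartz"
  shows "integrable lebesgue \<phi>"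
proof -
  have "1 + norm (x::real^'n) \<noteq> 0" for x using norm_ge_zero[of x] by linarith
  then show ?thesis using schwartz_integrable_weight[OF assms, of "\<lambda>_. 1" 1 0] by simp
qed

lemma schwartz_partials:
  assumes "\<phi> \<in> schwartz"
  shows "partials is \<phi> \<in> schwartz"
  unfolding schwartz_iff
proof (intro conjI allI)
  show "smooth (partials is \<phi>)" using assms by (simp add: schwartz_smooth smooth_partials)
  fix k m
  obtain C where "schwartz_bound (k + length is) m \<phi> C" using assms by (rule schwartz_boundE)
  then show "\<exists>C. schwartz_bound k m (partials is \<phi>) C"
    by (intro exI[of _ C]) (simp add: schwartz_bound_def flip: partials_append)
qed

lemma schwartz_reflect: "\<phi> \<in> schwartz \<Longrightarrow> (\<lambda>y. \<phi> (x - y)) \<in> schwartz"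
  using schwartz_affine[of \<phi> "-1" x] by simp

lemma schwartz_continuous: "\<phi> \<in> schwartz \<Longrightarrow> continuous_on A \<phi>"
  using smooth_continuous[of \<phi> A "[]"] by (simp add: schwartz_smooth)

section \<open>Tempered distributions\<close>

lemma tempered_boundE:
  assumes "T \<in> tempered"
  obtains k m C where "0 < m" "0 \<le> C"
    "\<And>\<phi> B. \<phi> \<in> schwartz \<Longrightarrow> schwartz_bound k m \<phi> B \<Longrightarrow> cmod (T \<phi>) \<le> C * B"
proof -
  obtain k m C where *: "m > 0" "\<forall>\<phi>\<in>schwartz. ennreal (cmod (T \<phi>)) \<le> ennreal C * schwartz_norm k m \<phi>"
    using assms by (auto simp: tempered_def)
  show ?thesis
  \<comment> \<open>The constant in the definition may be negative, in which case
    \<open>ennreal\<close> maps it to 0.\<close>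
  proof (rule that[of m "max C 0" k])
    fix \<phi> :: "real^'a \<Rightarrow> complex" and B assume \<phi>: "\<phi> \<in> schwartz" "schwartz_bound k m \<phi> B"
    then have B: "B \<ge> 0" and "schwartz_norm k m \<phi> \<le> ennreal B"
      using schwartz_norm_le_iff[OF schwartz_smooth] schwartz_bound_nonneg by blast+
    then have "ennreal (cmod (T \<phi>)) \<le> ennreal (max C 0) * ennreal B"
      using *(2) \<phi> by (intro order_trans[OF bspec[OF *(2)]] mult_mono) auto
    then show "cmod (T \<phi>) \<le> max C 0 * B"
      using B by (simp flip: ennreal_mult)
  qed (use * in auto)
qed

lemma tempered_linear:
  assumes "T \<in> tempered" "\<phi> \<in> schwartz" "\<psi> \<in> schwartz"
  shows "T (\<lambda>x. a * \<phi> x + b * \<psi> x) = a * T \<phi> + b * T \<psi>"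
  using assms schwartz_cmult[of \<phi> a] schwartz_cmult[of \<psi> b] by (simp add: tempered_def)

lemma tempered_diff:
  assumes "T \<in> tempered" "\<phi> \<in> schwartz" "\<psi> \<in> schwartz"
  shows "T (\<lambda>x. \<phi> x - \<psi> x) = T \<phi> - T \<psi>"
  using tempered_linear[OF assms, of 1 "-1"] by simp

lemma tempered_sum:
  assumes T: "T \<in> tempered" and "finite S" and "\<And>z. z \<in> S \<Longrightarrow> \<phi> z \<in> schwartz"
  shows "(\<lambda>x. \<Sum>z\<in>S. c z * \<phi> z x) \<in> schwartz \<and> T (\<lambda>x. \<Sum>z\<in>S. c z * \<phi> z x) = (\<Sum>z\<in>S. c z * T (\<phi> z))"
  using assms(2,3)
proof (induction S)
  case empty
  show ?case using tempered_linear[OF T schwartz_zero schwartz_zero, of 0 0] by (simp add: schwartz_zero)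
next
  case (insert z S)
  then have "\<phi> z \<in> schwartz" "(\<lambda>x. \<Sum>z\<in>S. c z * \<phi> z x) \<in> schwartz" by auto
  then show ?case
    using insert schwartz_add_cmult[of "\<phi> z" _ "c z" 1] tempered_linear[OF T, of "\<phi> z" _ "c z" 1] by auto
qed

lemma conv_diff:
  assumes "T \<in> tempered" "\<phi> \<in> schwartz" "\<psi> \<in> schwartz"
  shows "conv (\<lambda>x. \<phi> x - \<psi> x) T x = conv \<phi> T x - conv \<psi> T x"
  unfolding conv_def using tempered_diff[OF assms(1) schwartz_reflect schwartz_reflect] assms by blast

lemma conv_cmult:
  assumes "T \<in> tempered" "\<phi> \<in> schwartz"
  shows "conv (\<lambda>x. c * \<phi> x) T x = c * conv \<phi> T x"
  unfolding conv_def
  using tempered_linear[OF assms(1) schwartz_reflect[OF assms(2)] schwartz_reflect[OF assms(2)], of c x 0 x] by simp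

text \<open>The reflected translate y \<mapsto> \<phi>(x - y) has Schwartz norms at most (1 + |x|)^m
  times those of \<phi>, and one of these norms controls \<open>T\<close>.\<close>

lemma conv_growth:
  assumes T: "T \<in> tempered" and \<phi>: "\<phi> \<in> schwartz"
  obtains m B where "0 < m" "0 \<le> B" "\<And>x. cmod (conv \<phi> T x) \<le> B * (1 + norm x) powr m"
proof -
  obtain k m C where T': "0 < m" "0 \<le> C"
    "\<And>\<phi> B. \<phi> \<in> schwartz \<Longrightarrow> schwartz_bound k m \<phi> B \<Longrightarrow> cmod (T \<phi>) \<le> C * B"
    using T by (rule tempered_boundE) blast
  obtain D where D: "0 < D" "schwartz_bound k m \<phi> D" using \<phi> by (rule schwartz_boundE)
  show ?thesis
  proof (rule that[of m "C * D"])
    fix x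
    have "schwartz_bound k m (\<lambda>y. \<phi> ((-1) *\<^sub>R y + x)) (1 ^ k * (1 * (1 + norm x)) powr m * D)"
      by (rule schwartz_bound_affine) (use \<phi> D T' in \<open>auto simp: schwartz_smooth\<close>)
    then have "schwartz_bound k m (\<lambda>y. \<phi> (x - y)) ((1 + norm x) powr m * D)" by simp
    from T'(3)[OF schwartz_reflect[OF \<phi>] this] show "cmod (conv \<phi> T x) \<le> C * D * (1 + norm x) powr m"
      by (simp add: conv_def mult_ac)
  qed (use T' D in auto)
qed

lemma conv_continuous:
  assumes T: "T \<in> tempered" and \<phi>: "\<phi> \<in> schwartz"
  shows "continuous_on A (conv \<phi> T)"
proof -
  obtain k m C where T': "0 < m" "0 \<le> C"
    "\<And>\<phi> B. \<phi> \<in> schwartz \<Longrightarrow> schwartz_bound k m \<phi> B \<Longrightarrow> cmod (T \<phi>) \<le> C * B"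
    using T by (rule tempered_boundE) blast
  obtain D where D: "0 < D" "schwartz_bound (Suc k) m \<phi> D" using \<phi> by (rule schwartz_boundE)
  have "(conv \<phi> T \<longlongrightarrow> conv \<phi> T x) (at x)" for x
  proof (rule LIM_zero_cancel, rule Lim_null_comparison)
    let ?B = "\<lambda>y. C * (real CARD('a) * D * (1 + norm y + norm x) powr m * norm (y - x))"
    have "cmod (conv \<phi> T y - conv \<phi> T x) \<le> ?B y" for y
    proof -
      have "schwartz_bound k m (\<lambda>w. \<phi> ((-1) *\<^sub>R w + y) - \<phi> ((-1) *\<^sub>R w + x))
          (real CARD('a) * D * (1 + norm y + norm x) powr m * norm (y - x))"
        by (rule schwartz_bound_translate_diff) (use \<phi> D T' in \<open>auto simp: schwartz_smooth\<close>)
      then have "schwartz_bound k m (\<lambda>w. \<phi> (y - w) - \<phi> (x - w))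
          (real CARD('a) * D * (1 + norm y + norm x) powr m * norm (y - x))" by simp
      from T'(3)[OF schwartz_diff[OF schwartz_reflect[OF \<phi>] schwartz_reflect[OF \<phi>]] this]
      show ?thesis by (simp add: conv_def tempered_diff[OF T] schwartz_reflect[OF \<phi>])
    qed
    then show "\<forall>\<^sub>F y in at x. cmod (conv \<phi> T y - conv \<phi> T x) \<le> ?B y" by simp
    have "1 + norm x + norm x \<noteq> 0" using norm_ge_zero[of x] by linarith
    then have "(?B \<longlongrightarrow> ?B x) (at x)" by (intro tendsto_intros) auto
    then show "(?B \<longlongrightarrow> 0) (at x)" by simp
  qed
  then have "continuous_on UNIV (conv \<phi> T)" by (simp add: continuous_on_def)
  then show ?thesis by (rule continuous_on_subset) auto
qed

lemma conv_measurable [measurable]: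
  "T \<in> tempered \<Longrightarrow> \<phi> \<in> schwartz \<Longrightarrow> conv \<phi> T \<in> borel_measurable lebesgue"
  by (intro borel_measurable_lebesgue_continuous conv_continuous)

section \<open>Convolution of a tempered distribution with Schwartz functions\<close>

text \<open>The substitution rule is available for \<open>lborel\<close>. Borel measurability allows
  the passage from the completed measure to \<open>lborel\<close> and back.\<close>

lemma lebesgue_integral_affine:
  fixes f :: "'a::euclidean_space \<Rightarrow> complex"
  assumes [measurable]: "f \<in> borel_measurable borel" and c: "c \<noteq> 0"
  shows "(LINT x|lebesgue. f x) = (LINT x|lebesgue. f (t + c *\<^sub>R x)) * of_real (\<bar>c\<bar> ^ DIM('a))"
proof -
  have "(LINT x|lebesgue. f x) = (LINT x|lborel. f x)" by (rule integral_completion) simp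
  also have "\<dots> = (LINT x|density (distr lborel borel (\<lambda>x. t + c *\<^sub>R x)) (\<lambda>_. ennreal (\<bar>c\<bar> ^ DIM('a))). f x)"
    using lborel_affine[OF c, of t] by simp
  also have "\<dots> = (LINT x|distr lborel borel (\<lambda>x. t + c *\<^sub>R x). \<bar>c\<bar> ^ DIM('a) *\<^sub>R f x)"
    by (rule integral_density) auto
  also have "\<dots> = (LINT x|lborel. \<bar>c\<bar> ^ DIM('a) *\<^sub>R f (t + c *\<^sub>R x))"
    by (rule integral_distr) auto
  also have "\<dots> = (LINT x|lborel. f (t + c *\<^sub>R x)) * of_real (\<bar>c\<bar> ^ DIM('a))"
    by (simp add: scaleR_conv_of_real mult_ac)
  also have "(LINT x|lborel. f (t + c *\<^sub>R x)) = (LINT x|lebesgue. f (t + c *\<^sub>R x))"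
    by (rule integral_completion[symmetric]) simp
  finally show ?thesis .
qed

text \<open>The remainder is uniform in the base point \<open>y\<close>. Integrated against any
  integrable kernel it therefore stays quadratic in \<open>h\<close>, which is all that
  differentiation under the integral sign needs.\<close>

lemma schwartz_taylor:
  fixes \<phi> :: "real ^ 'n::finite \<Rightarrow> complex"
  assumes \<phi>: "\<phi> \<in> schwartz"
  obtains A where "0 \<le> A"
    "\<And>y h. cmod (\<phi> (y + h) - \<phi> y - (\<Sum>i\<in>UNIV. h $ i *\<^sub>R partial i \<phi> y)) \<le> A * (norm h)\<^sup>2"
proof -
  let ?n = "real CARD('n)"
  have sm: "smooth \<phi>" using \<phi> by (rule schwartz_smooth)
  obtain C where C: "0 < C" "schwartz_bound 2 0 \<phi> C" using \<phi> by (rule schwartz_boundE)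
  have C2: "cmod (partial j (partial i \<phi>) x) \<le> C" for i j x
  proof -
    have "cmod (partials [j, i] \<phi> x) \<le> C * (1 + norm x) powr - 0"
      using C(2) unfolding schwartz_bound_def by (auto simp del: minus_zero)
    also have "\<dots> \<le> C" using C by (simp add: powr_zero_eq_one)
    finally show ?thesis by (simp add: partials_Cons)
  qed
  show ?thesis
  proof (rule that[of "?n * ?n * C"])
    fix y h :: "real ^ 'n"
    let ?S = "closed_segment y (y + h)"
    have "norm (\<phi> (y + h) - \<phi> y - (\<Sum>i\<in>UNIV. (y + h - y) $ i *\<^sub>R partial i \<phi> y)) \<le> norm (y + h - y) * (?n * ?n * C * norm h)"
    proof (rule differentiable_bound_linearization[where S="?S" and f'="\<lambda>x h. \<Sum>i\<in>UNIV. h $ i *\<^sub>R partial i \<phi> x"])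
      fix t :: real assume "t \<in> {0..1}"
      then show "y + t *\<^sub>R (y + h - y) \<in> ?S"
        unfolding closed_segment_def by (auto intro!: exI[of _ t] simp: algebra_simps)
    next
      fix x assume "x \<in> ?S"
      show "(\<phi> has_derivative (\<lambda>h. \<Sum>i\<in>UNIV. h $ i *\<^sub>R partial i \<phi> x)) (at x within ?S)"
        by (rule has_derivative_at_withinI[OF has_derivative_partial[OF smooth_imp_differentiable[OF sm]]])
    next
      fix x assume x: "x \<in> ?S"
      show "onorm ((\<lambda>h. \<Sum>i\<in>UNIV. h $ i *\<^sub>R partial i \<phi> x) - (\<lambda>h. \<Sum>i\<in>UNIV. h $ i *\<^sub>R partial i \<phi> y)) \<le> ?n * ?n * C * norm h"
      proof (rule onorm_le)
        fix v :: "real ^ 'n"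
        have "norm (x - y) \<le> norm h" using segment_bound(1)[OF x] by (simp add: norm_minus_commute)
        have le: "cmod (partial i \<phi> x - partial i \<phi> y) \<le> ?n * C * norm h" for i
        proof -
          have "cmod (partial i \<phi> x - partial i \<phi> y) \<le> ?n * C * norm (x - y)"
            using smooth_differentiable[OF sm, of "[i]"]
            by (intro norm_diff_le_partial C2) (simp add: partials_Cons)
          also have "\<dots> \<le> ?n * C * norm h" using C \<open>norm (x - y) \<le> norm h\<close> by (intro mult_left_mono) auto
          finally show ?thesis .
        qed
        have "((\<lambda>h. \<Sum>i\<in>UNIV. h $ i *\<^sub>R partial i \<phi> x) - (\<lambda>h. \<Sum>i\<in>UNIV. h $ i *\<^sub>R partial i \<phi> y)) v
          = (\<Sum>i\<in>UNIV. v $ i *\<^sub>R (partial i \<phi> x - partial i \<phi> y))"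
          by (simp add: sum_subtractf scaleR_diff_right)
        also have "cmod \<dots> \<le> (\<Sum>i\<in>(UNIV::'n set). norm v * (?n * C * norm h))"
          by (intro sum_norm_le) (auto intro!: mult_mono component_le_norm_cart le)
        finally show "cmod (((\<lambda>h. \<Sum>i\<in>UNIV. h $ i *\<^sub>R partial i \<phi> x) - (\<lambda>h. \<Sum>i\<in>UNIV. h $ i *\<^sub>R partial i \<phi> y)) v)
          \<le> ?n * ?n * C * norm h * norm v" by (simp add: mult_ac)
      qed
    qed auto
    then show "cmod (\<phi> (y + h) - \<phi> y - (\<Sum>i\<in>UNIV. h $ i *\<^sub>R partial i \<phi> y)) \<le> ?n * ?n * C * (norm h)\<^sup>2"
      by (simp add: power2_eq_square mult_ac)
  qed (use C in auto)
qed

section \<open>Convolutions of functions and their derivatives\<close>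

lemma integrable_mult_schwartz:
  fixes K :: "real ^ 'n::finite \<Rightarrow> complex"
  assumes K: "integrable lebesgue K" and \<phi>: "\<phi> \<in> schwartz"
  shows "integrable lebesgue (\<lambda>x. K x * \<phi> (y - x))"
proof -
  obtain C where C: "0 < C" "schwartz_bound 0 0 \<phi> C" using \<phi> by (rule schwartz_boundE)
  have bd: "cmod (\<phi> z) \<le> C" for z
    using schwartz_boundD[OF C(2), of z] C(1) norm_ge_zero[of z] by (auto simp: powr_zero_eq_one split: if_splits)
  have "integrable lebesgue (\<lambda>x. C * norm (K x))" using K by auto
  then show ?thesis
  proof (rule Bochner_Integration.integrable_bound)
    show "(\<lambda>x. K x * \<phi> (y - x)) \<in> borel_measurable lebesgue"
      using K schwartz_measurable[OF schwartz_reflect[OF \<phi>]] by measurable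
    show "AE x in lebesgue. cmod (K x * \<phi> (y - x)) \<le> norm (C * norm (K x))"
      using bd C by (auto simp: norm_mult mult.commute[of C] intro!: mult_left_mono)
  qed
qed

lemma conv_fun_has_derivative:
  fixes K :: "real ^ 'n::finite \<Rightarrow> complex"
  assumes K: "integrable lebesgue K" and \<phi>: "\<phi> \<in> schwartz"
  shows "((\<lambda>y. LINT x|lebesgue. K x * \<phi> (y - x)) has_derivative
    (\<lambda>h. \<Sum>i\<in>UNIV. h $ i *\<^sub>R (LINT x|lebesgue. K x * partial i \<phi> (y - x)))) (at y)"
proof -
  let ?P = "\<lambda>\<phi> y. LINT x|lebesgue. K x * \<phi> (y - x)"
  obtain A where A: "0 \<le> A"
    "\<And>y h. cmod (\<phi> (y + h) - \<phi> y - (\<Sum>i\<in>UNIV. h $ i *\<^sub>R partial i \<phi> y)) \<le> A * (norm h)\<^sup>2"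
    using \<phi> by (rule schwartz_taylor) blast
  have p: "partial i \<phi> \<in> schwartz" for i using schwartz_partials[OF \<phi>, of "[i]"] by (simp add: partials_Cons)
  define L where "L = (\<lambda>h. \<Sum>i\<in>UNIV. h $ i *\<^sub>R ?P (partial i \<phi>) y)"
  define B where "B = (LINT x|lebesgue. norm (K x)) * A"
  have bd: "cmod (?P \<phi> z - ?P \<phi> y - L (z - y)) \<le> B * (norm (z - y))\<^sup>2" for z
  proof -
    let ?h = "z - y"
    let ?R = "\<lambda>x. \<phi> (z - x) - \<phi> (y - x) - (\<Sum>i\<in>UNIV. ?h $ i *\<^sub>R partial i \<phi> (y - x))"
    have int: "integrable lebesgue (\<lambda>x. K x * \<psi> (w - x))" if "\<psi> \<in> schwartz" for \<psi> w
      using K that by (rule integrable_mult_schwartz)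
    have "?P \<phi> z - ?P \<phi> y - L ?h = (LINT x|lebesgue. K x * \<phi> (z - x) - K x * \<phi> (y - x)
        - (\<Sum>i\<in>UNIV. ?h $ i *\<^sub>R (K x * partial i \<phi> (y - x))))"
      unfolding L_def using int[OF \<phi>] int[OF p]
      by (subst Bochner_Integration.integral_diff Bochner_Integration.integral_sum, auto)+
    also have "\<dots> = (LINT x|lebesgue. K x * ?R x)"
      by (intro Bochner_Integration.integral_cong refl) (simp add: right_diff_distrib sum_distrib_left)
    finally have eq: "?P \<phi> z - ?P \<phi> y - L ?h = (LINT x|lebesgue. K x * ?R x)" .
    have "cmod (LINT x|lebesgue. K x * ?R x) \<le> (LINT x|lebesgue. norm (K x) * (A * (norm ?h)\<^sup>2))"
    proof (rule Bochner_Integration.integral_norm_bound_integral)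
      show "integrable lebesgue (\<lambda>x. K x * ?R x)"
        using int[OF \<phi>] int[OF p]
        by (simp add: right_diff_distrib sum_distrib_left mult_scaleR_right)
      fix x
      have "cmod (?R x) \<le> A * (norm ?h)\<^sup>2" using A(2)[of "y - x" ?h] by simp
      then show "cmod (K x * ?R x) \<le> norm (K x) * (A * (norm ?h)\<^sup>2)"
        by (simp add: norm_mult mult_left_mono)
    qed (use K in auto)
    also have "\<dots> = B * (norm ?h)\<^sup>2" by (simp add: B_def mult_ac)
    finally show ?thesis unfolding eq .
  qed
  have "(?P \<phi> has_derivative L) (at y)"
    unfolding has_derivative_iff_norm
  proof
    show "bounded_linear L" unfolding L_def
      by (intro bounded_linear_sum bounded_linear_scaleR_const bounded_linear_vec_nth)
    show "((\<lambda>z. norm (?P \<phi> z - ?P \<phi> y - L (z - y)) / norm (z - y)) \<longlongrightarrow> 0) (at y)"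
    proof (rule Lim_null_comparison)
      have "norm (?P \<phi> z - ?P \<phi> y - L (z - y)) / norm (z - y) \<le> B * norm (z - y)" for z
        using bd[of z] by (cases "z = y") (auto simp: field_simps power2_eq_square)
      then show "\<forall>\<^sub>F z in at y. norm (norm (?P \<phi> z - ?P \<phi> y - L (z - y)) / norm (z - y)) \<le> B * norm (z - y)"
        by simp
      have "((\<lambda>z. B * norm (z - y)) \<longlongrightarrow> B * norm (y - y)) (at y)" by (intro tendsto_intros)
      then show "((\<lambda>z. B * norm (z - y)) \<longlongrightarrow> 0) (at y)" by simp
    qed
  qed
  then show ?thesis by (simp add: L_def)
qed

lemma partials_conv_fun:
  fixes K :: "real ^ 'n::finite \<Rightarrow> complex"
  assumes K: "integrable lebesgue K" and \<phi>: "\<phi> \<in> schwartz"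
  shows "partials is (\<lambda>y. LINT x|lebesgue. K x * \<phi> (y - x)) = (\<lambda>y. LINT x|lebesgue. K x * partials is \<phi> (y - x))"
proof (induction "is")
  case (Cons i "is")
  show ?case
  proof
    fix y
    show "partials (i # is) (\<lambda>y. LINT x|lebesgue. K x * \<phi> (y - x)) y = (LINT x|lebesgue. K x * partials (i # is) \<phi> (y - x))"
      unfolding partials_Cons Cons
      by (subst partial_eqI[OF conv_fun_has_derivative[OF K schwartz_partials[OF \<phi>]]])
        (simp add: axis_def if_distrib[of "\<lambda>c. c *\<^sub>R _"] cong: if_cong)
  qed
qed simp

lemma smooth_conv_fun:
  fixes K :: "real ^ 'n::finite \<Rightarrow> complex"
  assumes K: "integrable lebesgue K" and \<phi>: "\<phi> \<in> schwartz"
  shows "smooth (\<lambda>y. LINT x|lebesgue. K x * \<phi> (y - x))"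
  unfolding smooth_def partials_conv_fun[OF assms]
  using conv_fun_has_derivative[OF K schwartz_partials[OF \<phi>]] by (auto simp: differentiable_def)

lemma schwartz_norm_integrable:
  fixes \<phi> :: "real ^ 'n::finite \<Rightarrow> complex"
  assumes "\<phi> \<in> schwartz" and [measurable]: "f \<in> borel_measurable lebesgue"
    and "\<And>x. \<bar>f x\<bar> \<le> B * (1 + norm x) powr a"
  shows "integrable lebesgue (\<lambda>x. f x * norm (\<phi> x))"
proof -
  have "integrable lebesgue (\<lambda>x. complex_of_real (f x) * \<phi> x)"
    by (rule schwartz_integrable_weight[OF assms(1) _, of _ B a]) (use assms(3) in auto)
  from integrable_norm[OF this] have "integrable lebesgue (\<lambda>x. norm (f x) * norm (\<phi> x))" by (simp add: norm_mult)
  then show ?thesis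
  proof (rule Bochner_Integration.integrable_bound)
    show "(\<lambda>x. f x * norm (\<phi> x)) \<in> borel_measurable lebesgue"
      using schwartz_measurable[OF assms(1)] by measurable
  qed (auto simp: abs_mult)
qed

lemma borel_measurable_one_plus_norm_powr:
  "(\<lambda>x::'a::euclidean_space. (1 + norm x) powr a) \<in> borel_measurable lebesgue"
  by (intro borel_measurable_lebesgue_continuous continuous_intros) (auto simp: add_nonneg_eq_0_iff)

lemma schwartz_powr_integrable:
  fixes \<phi> :: "real ^ 'n::finite \<Rightarrow> complex"
  assumes "\<phi> \<in> schwartz"
  shows "integrable lebesgue (\<lambda>x. c * (1 + norm x) powr a * norm (\<phi> x))"
proof -
  have "integrable lebesgue (\<lambda>x. (1 + norm x) powr a * norm (\<phi> x))"
    by (rule schwartz_norm_integrable[OF assms borel_measurable_one_plus_norm_powr, of _ 1 a]) simp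
  then have "integrable lebesgue (\<lambda>x. c * ((1 + norm x) powr a * norm (\<phi> x)))"
    by (rule integrable_mult_right)
  then show ?thesis by (simp only: mult.assoc)
qed

text \<open>All derivatives fall on \<psi>. Its decay in y - x is converted to decay in y at the
  price of (1 + |x|)^m, which \<phi> absorbs.\<close>

lemma schwartz_conv_fun:
  fixes \<phi> \<psi> :: "real ^ 'n::finite \<Rightarrow> complex"
  assumes \<phi>: "\<phi> \<in> schwartz" and \<psi>: "\<psi> \<in> schwartz"
  shows "(\<lambda>y. LINT x|lebesgue. \<phi> x * \<psi> (y - x)) \<in> schwartz"
  unfolding schwartz_iff
proof (intro conjI allI)
  have K: "integrable lebesgue \<phi>" by (rule schwartz_integrable[OF \<phi>])
  show "smooth (\<lambda>y. LINT x|lebesgue. \<phi> x * \<psi> (y - x))" by (rule smooth_conv_fun[OF K \<psi>])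
  fix k m'
  define m where "m = max m' (0::real)"
  have m: "m \<ge> 0" by (simp add: m_def)
  obtain C where C: "0 < C" "schwartz_bound k m \<psi> C" using \<psi> by (rule schwartz_boundE)
  have int: "integrable lebesgue (\<lambda>x. (1 + norm x) powr m * norm (\<phi> x))"
    using schwartz_powr_integrable[OF \<phi>, of 1 m] by simp
  define D where "D = C * (LINT x|lebesgue. (1 + norm x) powr m * norm (\<phi> x))"
  have "schwartz_bound k m (\<lambda>y. LINT x|lebesgue. \<phi> x * \<psi> (y - x)) D"
    unfolding schwartz_bound_def partials_conv_fun[OF K \<psi>]
  proof (intro allI impI)
    fix "is" :: "'n list" and y :: "real^'n" assume l: "length is \<le> k"
    have "cmod (LINT x|lebesgue. \<phi> x * partials is \<psi> (y - x))
      \<le> (LINT x|lebesgue. C * (1 + norm y) powr - m * ((1 + norm x) powr m * norm (\<phi> x)))"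
    proof (rule Bochner_Integration.integral_norm_bound_integral)
      show "integrable lebesgue (\<lambda>x. \<phi> x * partials is \<psi> (y - x))"
        by (rule integrable_mult_schwartz[OF K schwartz_partials[OF \<psi>]])
      fix x
      have "cmod (partials is \<psi> (y - x)) \<le> C * (1 + norm (y - x)) powr - m"
        using C(2) l by (simp add: schwartz_bound_def)
      also have "\<dots> \<le> C * ((1 + norm x) powr m * (1 + norm y) powr - m)"
        using one_plus_norm_mult[of "y - x" x] C m
        by (intro mult_left_mono powr_mult_bound) (auto simp: add_pos_nonneg mult.commute)
      finally have "cmod (\<phi> x) * cmod (partials is \<psi> (y - x)) \<le> cmod (\<phi> x) * (C * ((1 + norm x) powr m * (1 + norm y) powr - m))"
        by (rule mult_left_mono) simp
      then show "cmod (\<phi> x * partials is \<psi> (y - x)) \<le> C * (1 + norm y) powr - m * ((1 + norm x) powr m * norm (\<phi> x))"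
        by (simp add: norm_mult mult_ac)
    qed (use int in auto)
    also have "\<dots> = D * (1 + norm y) powr - m"
      by (subst integral_mult_right_zero) (simp add: D_def mult_ac)
    finally show "cmod (LINT x|lebesgue. \<phi> x * partials is \<psi> (y - x)) \<le> D * (1 + norm y) powr - m" .
  qed
  then show "\<exists>C. schwartz_bound k m' (\<lambda>y. LINT x|lebesgue. \<phi> x * \<psi> (y - x)) C"
    by (intro exI) (erule schwartz_bound_mono, auto simp: m_def)
qed

text \<open>The integral is approximated by finite sums along simple functions converging to the identity;
  the sums converge in every Schwartz norm.\<close>

lemma tempered_conv_fun:
  fixes \<phi> \<psi> :: "real ^ 'n::finite \<Rightarrow> complex"
  assumes T: "T \<in> tempered" and \<phi>: "\<phi> \<in> schwartz" and \<psi>: "\<psi> \<in> schwartz"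
  shows "T (\<lambda>y. LINT x|lebesgue. \<phi> x * \<psi> (x - y)) = (LINT x|lebesgue. \<phi> x * conv \<psi> T x)"
proof -
  obtain k m C where T': "0 < m" "0 \<le> C"
    "\<And>\<phi> B. \<phi> \<in> schwartz \<Longrightarrow> schwartz_bound k m \<phi> B \<Longrightarrow> cmod (T \<phi>) \<le> C * B"
    using T by (rule tempered_boundE) blast
  obtain D where D: "0 < D" "schwartz_bound (Suc k) m \<psi> D" using \<psi> by (rule schwartz_boundE)
  obtain M B where B: "0 < M" "0 \<le> B" "\<And>x. cmod (conv \<psi> T x) \<le> B * (1 + norm x) powr M"
    by (rule conv_growth[OF T \<psi>]) blast
  have [measurable]: "\<phi> \<in> borel_measurable lebesgue" "conv \<psi> T \<in> borel_measurable lebesgue"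
    by (rule schwartz_measurable[OF \<phi>], rule conv_measurable[OF T \<psi>])
  have [measurable]: "\<psi> \<in> borel_measurable borel" "conv \<psi> T \<in> borel_measurable borel"
    by (rule borel_measurable_continuous_onI, rule schwartz_continuous[OF \<psi>] conv_continuous[OF T \<psi>])+
  have id_meas: "(\<lambda>x. x) \<in> borel_measurable (lebesgue :: (real^'n) measure)"
    by (rule measurable_completion) simp
  \<comment> \<open>Simple functions converging pointwise to the identity with |s i x| \<le> 2 |x|.
    This bound provides the dominating functions in both limits at the end.\<close>
  obtain s where s: "\<And>i. simple_function lebesgue (s i)" "\<And>x. (\<lambda>i. s i x) \<longlonglongrightarrow> x" "\<And>i x. dist (s i x) 0 \<le> 2 * dist x (0::real^'n)"
    using borel_measurable_implies_sequence_metric[OF id_meas, of 0] by auto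
  have ns: "norm (s i x) \<le> 2 * norm x" for i x using s(3)[of i x] by (simp add: dist_norm)
  have [measurable]: "s i \<in> borel_measurable lebesgue" for i
    using s(1) by (rule borel_measurable_simple_function)
  have fin: "finite (range (s i))" for i using simple_functionD(1)[OF s(1)[of i]] by simp
  define c where "c i z = (LINT x|lebesgue. \<phi> x * of_real (indicator (s i -` {z}) x))" for i z
  have smeas: "s i -` {z} \<in> sets lebesgue" for i z using simple_functionD(2)[OF s(1)[of i], of "{z}"] by simp
  have int\<phi>: "integrable lebesgue \<phi>" by (rule schwartz_integrable[OF \<phi>])
  have ci: "integrable lebesgue (\<lambda>x. \<phi> x * of_real (indicator (s i -` {z}) x))" for i z
    by (rule Bochner_Integration.integrable_bound[OF int\<phi>])
      (use smeas[of i z] in \<open>auto simp: norm_mult split: split_indicator\<close>)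
  \<comment> \<open>After replacing x by \<open>s i x\<close> inside \<open>g\<close>, the integral
    is a finite combination of values of \<open>g\<close> with coefficients independent of
    \<open>g\<close>. The same coefficients thus serve for \<psi> and its derivatives and for the
    convolution with \<open>T\<close>.\<close>
  have simple: "(LINT x|lebesgue. \<phi> x * g (s i x)) = (\<Sum>z\<in>range (s i). c i z * g z)" for g i
  proof -
    have "\<phi> x * g (s i x) = (\<Sum>z\<in>range (s i). \<phi> x * of_real (indicator (s i -` {z}) x) * g z)" for x
    proof -
      have "(\<Sum>z\<in>range (s i). \<phi> x * of_real (indicator (s i -` {z}) x) * g z)
        = (\<Sum>z\<in>range (s i). if z = s i x then \<phi> x * g z else 0)"
        by (intro sum.cong) (auto split: split_indicator)
      then show ?thesis using fin by simp
    qed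
    then have "(LINT x|lebesgue. \<phi> x * g (s i x))
      = (\<Sum>z\<in>range (s i). LINT x|lebesgue. \<phi> x * of_real (indicator (s i -` {z}) x) * g z)"
      using ci by simp
    then show ?thesis by (simp add: c_def)
  qed
  \<comment> \<open>The reflection brings the integral of \<phi>(x) \<psi>(x - y) into the form of a
    convolution; its derivatives carry the sign (-1)^(order).\<close>
  let ?\<chi> = "\<lambda>w. \<psi> (0 - w)"
  have \<chi>: "?\<chi> \<in> schwartz" by (rule schwartz_reflect[OF \<psi>])
  define V where "V = (\<lambda>y. LINT x|lebesgue. \<phi> x * \<psi> (x - y))"
  have V_alt: "V = (\<lambda>y. LINT x|lebesgue. \<phi> x * ?\<chi> (y - x))" by (simp add: V_def)
  have V: "V \<in> schwartz" unfolding V_alt by (rule schwartz_conv_fun[OF \<phi> \<chi>])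
  have refl_partials: "partials is (\<lambda>w. \<psi> (a - w)) = (\<lambda>y. (-1) ^ length is * partials is \<psi> (a - y))" for a "is"
    using partials_affine[OF schwartz_smooth[OF \<psi>], of "is" "-1" a] by simp
  have pV: "partials is V y = (-1) ^ length is * (LINT x|lebesgue. \<phi> x * partials is \<psi> (x - y))" for "is" y
    unfolding V_alt partials_conv_fun[OF int\<phi> \<chi>] refl_partials
    by (simp add: mult.left_commute[of _ "(- 1) ^ length is"])
  define Vi where "Vi i = (\<lambda>y. LINT x|lebesgue. \<phi> x * \<psi> (s i x - y))" for i
  have Vi_alt: "Vi i = (\<lambda>y. \<Sum>z\<in>range (s i). c i z * \<psi> (z - y))" for i
    unfolding Vi_def
  proof
    fix y
    show "(LINT x|lebesgue. \<phi> x * \<psi> (s i x - y)) = (\<Sum>z\<in>range (s i). c i z * \<psi> (z - y))"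
      by (rule simple[of "\<lambda>z. \<psi> (z - y)"])
  qed
  have Vi: "Vi i \<in> schwartz" "T (Vi i) = (LINT x|lebesgue. \<phi> x * conv \<psi> T (s i x))" for i
    using tempered_sum[OF T fin, of i "\<lambda>z y. \<psi> (z - y)" "c i"] schwartz_reflect[OF \<psi>] simple[of "conv \<psi> T" i]
    unfolding Vi_alt conv_def by auto
  have pVi: "partials is (Vi i) y = (-1) ^ length is * (LINT x|lebesgue. \<phi> x * partials is \<psi> (s i x - y))" for "is" i y
  proof -
    have "partials is (\<lambda>y. \<Sum>z\<in>S. c i z * \<psi> (z - y)) = (\<lambda>y. \<Sum>z\<in>S. c i z * partials is (\<lambda>y. \<psi> (z - y)) y)"
      if "finite S" for S
      using that
    proof (induction S)
      case empty
      show ?case using partials_add_cmult[OF schwartz_smooth[OF schwartz_zero] schwartz_smooth[OF schwartz_zero], of "is" 0 0] by simp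
    next
      case (insert z S)
      have "(\<lambda>y. \<Sum>z\<in>S. c i z * \<psi> (z - y)) \<in> schwartz"
        using tempered_sum[OF T insert(1), of "\<lambda>z y. \<psi> (z - y)" "c i"] schwartz_reflect[OF \<psi>] by blast
      with insert show ?case
        using partials_add_cmult[OF schwartz_smooth[OF schwartz_reflect[OF \<psi>]] schwartz_smooth, of "\<lambda>y. \<Sum>z\<in>S. c i z * \<psi> (z - y)" "is" "c i z" z 1]
        by simp
    qed
    from this[OF fin] show ?thesis
      unfolding Vi_alt by (subst simple[of "\<lambda>z. partials is \<psi> (z - y)"])
        (simp add: refl_partials sum_distrib_left mult.left_commute)
  qed
  let ?n = "real CARD('n)"
  \<comment> \<open>The integrand of the error in the Schwartz norm controlling \<open>T\<close>:
    the translation estimate between x and \<open>s i x\<close>, weighted by |\<phi> x|. It tends to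
    0 pointwise because of the factor |x - s i x|.\<close>
  define e where "e i x = ?n * D * (1 + norm x + norm (s i x)) powr m * norm (x - s i x) * norm (\<phi> x)" for i x
  have ebd: "\<bar>?n * D * (1 + norm x + norm (s i x)) powr m * norm (x - s i x)\<bar> \<le> (?n * D * 3 powr (m + 1)) * (1 + norm x) powr (m + 1)" for i x
  proof -
    have p: "3 * (1 + norm x) \<ge> 0" by simp
    have "norm (x - s i x) \<le> 3 * (1 + norm x)" using norm_triangle_ineq4[of x "s i x"] ns[of i x] by simp
    moreover have "(1 + norm x + norm (s i x)) powr m \<le> (3 * (1 + norm x)) powr m"
      using ns[of i x] T'(1) by (intro powr_mono2) (auto simp: add_nonneg_nonneg)
    ultimately have "(1 + norm x + norm (s i x)) powr m * norm (x - s i x) \<le> (3 * (1 + norm x)) powr m * (3 * (1 + norm x))"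
      by (intro mult_mono) auto
    also have "\<dots> = (3 * (1 + norm x)) powr (m + 1)"
      using norm_ge_zero[of x] by (subst powr_add) (auto simp: powr_one)
    also have "\<dots> = 3 powr (m + 1) * (1 + norm x) powr (m + 1)" by (rule powr_mult)
    finally have "?n * D * ((1 + norm x + norm (s i x)) powr m * norm (x - s i x)) \<le> ?n * D * (3 powr (m + 1) * (1 + norm x) powr (m + 1))"
      using D by (intro mult_left_mono) auto
    then show ?thesis using D by (simp add: abs_mult mult_ac)
  qed
  have emeas: "(\<lambda>x. ?n * D * (1 + norm x + norm (s i x)) powr m * norm (x - s i x)) \<in> borel_measurable lebesgue" for i
    using id_meas by measurable
  have eint: "integrable lebesgue (e i)" for i
    unfolding e_def by (rule schwartz_norm_integrable[OF \<phi> emeas ebd])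
  have sb: "schwartz_bound k m (\<lambda>y. V y - Vi i y) (LINT x|lebesgue. e i x)" for i
    unfolding schwartz_bound_def
  proof (intro allI impI)
    fix "is" :: "'n list" and y :: "real^'n" assume l: "length is \<le> k"
    have i1: "integrable lebesgue (\<lambda>x. \<phi> x * partials is \<psi> (x - y))"
      using integrable_mult_schwartz[OF int\<phi> schwartz_reflect[OF schwartz_partials[OF \<psi>]], of "is" 0 y] by simp
    obtain E where E: "0 < E" "schwartz_bound 0 0 (partials is \<psi>) E" by (rule schwartz_boundE[OF schwartz_partials[OF \<psi>]])
    have Ebd: "cmod (partials is \<psi> z) \<le> E" for z
      using schwartz_boundD[OF E(2), of z] E(1) by (auto simp: powr_zero_eq_one split: if_splits)
    have [measurable]: "partials is \<psi> \<in> borel_measurable borel"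
      by (intro borel_measurable_continuous_onI schwartz_continuous schwartz_partials \<psi>)
    have i2: "integrable lebesgue (\<lambda>x. \<phi> x * partials is \<psi> (s i x - y))"
    proof (rule Bochner_Integration.integrable_bound)
      show "integrable lebesgue (\<lambda>x. E * norm (\<phi> x))" using int\<phi> by auto
      show "AE x in lebesgue. norm (\<phi> x * partials is \<psi> (s i x - y)) \<le> norm (E * norm (\<phi> x))"
        using Ebd E by (auto simp: norm_mult mult.commute[of E] intro!: mult_left_mono)
    qed measurable
    have "partials is (\<lambda>y. V y - Vi i y) y = partials is V y - partials is (Vi i) y"
      using partials_add_cmult[OF schwartz_smooth[OF V] schwartz_smooth[OF Vi(1)[of i]], of "is" 1 "-1"] by simp
    also have "\<dots> = (-1) ^ length is * (LINT x|lebesgue. \<phi> x * (partials is \<psi> (x - y) - partials is \<psi> (s i x - y)))"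
      using i1 i2 by (simp add: pV pVi right_diff_distrib)
    finally have "cmod (partials is (\<lambda>y. V y - Vi i y) y)
      = cmod (LINT x|lebesgue. \<phi> x * (partials is \<psi> (x - y) - partials is \<psi> (s i x - y)))"
      by (simp add: norm_mult norm_power)
    also have "\<dots> \<le> (LINT x|lebesgue. e i x * (1 + norm y) powr - m)"
    proof (rule Bochner_Integration.integral_norm_bound_integral)
      show "integrable lebesgue (\<lambda>x. \<phi> x * (partials is \<psi> (x - y) - partials is \<psi> (s i x - y)))"
        using i1 i2 by (simp add: right_diff_distrib)
      fix x
      have "cmod (partials is \<psi> (x - y) - partials is \<psi> (s i x - y))
         \<le> ?n * D * (1 + norm x + norm (s i x)) powr m * norm (x - s i x) * (1 + norm y) powr - m"
        using partials_translate_diff_le[OF schwartz_smooth[OF \<psi>] D(2) _ _ l, of "-1" y x "s i x"] T'(1) by simp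
      then have "cmod (\<phi> x) * cmod (partials is \<psi> (x - y) - partials is \<psi> (s i x - y))
         \<le> cmod (\<phi> x) * (?n * D * (1 + norm x + norm (s i x)) powr m * norm (x - s i x) * (1 + norm y) powr - m)"
        by (rule mult_left_mono) simp
      then show "cmod (\<phi> x * (partials is \<psi> (x - y) - partials is \<psi> (s i x - y))) \<le> e i x * (1 + norm y) powr - m"
        by (simp add: norm_mult e_def mult_ac)
    qed (use eint in auto)
    finally show "cmod (partials is (\<lambda>y. V y - Vi i y) y) \<le> (LINT x|lebesgue. e i x) * (1 + norm y) powr - m"
      by simp
  qed
  have "(\<lambda>i. LINT x|lebesgue. e i x) \<longlonglongrightarrow> (LINT x|(lebesgue :: (real^'n) measure). 0)"
  proof (rule integral_dominated_convergence)
    show "integrable lebesgue (\<lambda>x. (?n * D * 3 powr (m + 1)) * (1 + norm x) powr (m + 1) * norm (\<phi> x))"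
      by (rule schwartz_powr_integrable[OF \<phi>])
    show "AE x in lebesgue. (\<lambda>i. e i x) \<longlonglongrightarrow> 0"
    proof (intro AE_I2)
      fix x :: "real^'n"
      have "1 + norm x + norm x \<noteq> 0" using norm_ge_zero[of x] by linarith
      then have "(\<lambda>i. e i x) \<longlonglongrightarrow> ?n * D * (1 + norm x + norm x) powr m * norm (x - x) * norm (\<phi> x)"
        unfolding e_def by (intro tendsto_intros s(2)) auto
      then show "(\<lambda>i. e i x) \<longlonglongrightarrow> 0" by simp
    qed
    show "AE x in lebesgue. norm (e i x) \<le> (?n * D * 3 powr (m + 1)) * (1 + norm x) powr (m + 1) * norm (\<phi> x)" for i :: nat
    proof (intro AE_I2)
      fix x :: "real^'n"
      have "\<bar>e i x\<bar> = \<bar>?n * D * (1 + norm x + norm (s i x)) powr m * norm (x - s i x)\<bar> * norm (\<phi> x)"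
        by (simp add: e_def abs_mult)
      also have "\<dots> \<le> (?n * D * 3 powr (m + 1)) * (1 + norm x) powr (m + 1) * norm (\<phi> x)"
        by (intro mult_right_mono ebd) simp
      finally show "norm (e i x) \<le> \<dots>" by simp
    qed
  qed (use eint in auto)
  then have "(\<lambda>i. C * (LINT x|lebesgue. e i x)) \<longlonglongrightarrow> 0" by (auto intro: tendsto_mult_right_zero)
  moreover have "cmod (T V - T (Vi i)) \<le> C * (LINT x|lebesgue. e i x)" for i
    using T'(3)[OF schwartz_diff[OF V Vi(1)] sb] tempered_diff[OF T V Vi(1)] by simp
  ultimately have "(\<lambda>i. T V - T (Vi i)) \<longlonglongrightarrow> 0"
    by (intro Lim_null_comparison[of "\<lambda>i. T V - T (Vi i)" "\<lambda>i. C * (LINT x|lebesgue. e i x)"]) auto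
  then have "(\<lambda>i. T V - (T V - T (Vi i))) \<longlonglongrightarrow> T V - 0" by (intro tendsto_intros)
  then have l1: "(\<lambda>i. LINT x|lebesgue. \<phi> x * conv \<psi> T (s i x)) \<longlonglongrightarrow> T V" by (simp add: Vi)
  have l2: "(\<lambda>i. LINT x|lebesgue. \<phi> x * conv \<psi> T (s i x)) \<longlonglongrightarrow> (LINT x|lebesgue. \<phi> x * conv \<psi> T x)"
  proof (rule integral_dominated_convergence)
    show "integrable lebesgue (\<lambda>x. (B * 2 powr M) * (1 + norm x) powr M * norm (\<phi> x))"
      by (rule schwartz_powr_integrable[OF \<phi>])
    show "AE x in lebesgue. (\<lambda>i. \<phi> x * conv \<psi> T (s i x)) \<longlonglongrightarrow> \<phi> x * conv \<psi> T x"
    proof (intro AE_I2 tendsto_intros)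
      fix x
      have "isCont (conv \<psi> T) x" using conv_continuous[OF T \<psi>, of UNIV] by (simp add: continuous_on_eq_continuous_at)
      then show "(\<lambda>i. conv \<psi> T (s i x)) \<longlonglongrightarrow> conv \<psi> T x" using s(2)[of x] by (rule isCont_tendsto_compose)
    qed
    show "AE x in lebesgue. norm (\<phi> x * conv \<psi> T (s i x)) \<le> (B * 2 powr M) * (1 + norm x) powr M * norm (\<phi> x)" for i
    proof (intro AE_I2)
      fix x
      have "cmod (conv \<psi> T (s i x)) \<le> B * (1 + norm (s i x)) powr M" by (rule B)
      also have "\<dots> \<le> B * (2 * (1 + norm x)) powr M"
        using ns[of i x] B by (intro mult_left_mono powr_mono2) auto
      also have "\<dots> = (B * 2 powr M) * (1 + norm x) powr M" by (simp only: powr_mult mult.assoc)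
      finally show "norm (\<phi> x * conv \<psi> T (s i x)) \<le> (B * 2 powr M) * (1 + norm x) powr M * norm (\<phi> x)"
        by (simp add: norm_mult mult.commute[of "norm (\<phi> x)"] mult_right_mono)
    qed
  qed measurable
  show ?thesis using LIMSEQ_unique[OF l1 l2] by (simp add: V_def)
qed

section \<open>Dilations and approximate identities\<close>

lemma dilate_schwartz:
  fixes \<phi> :: "real ^ 'n::finite \<Rightarrow> complex"
  assumes "\<phi> \<in> schwartz" "0 < t"
  shows "dilate t \<phi> \<in> schwartz"
proof -
  have "dilate t \<phi> = (\<lambda>x. of_real (inverse (t ^ CARD('n))) * \<phi> (inverse t *\<^sub>R x + 0))"
    by (simp add: fun_eq_iff dilate_def scaleR_conv_of_real)
  then show ?thesis using assms by (simp only:) (intro schwartz_cmult schwartz_affine, auto)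
qed

lemma schwartz_borel [measurable_dest]: "\<phi> \<in> schwartz \<Longrightarrow> \<phi> \<in> borel_measurable borel"
  by (intro borel_measurable_continuous_onI schwartz_continuous)

lemma integral_dilate:
  fixes \<phi> :: "real ^ 'n::finite \<Rightarrow> complex"
  assumes "\<phi> \<in> schwartz" "0 < t"
  shows "(LINT x|lebesgue. dilate t \<phi> x) = (LINT x|lebesgue. \<phi> x)"
proof -
  have "(LINT x|lebesgue. dilate t \<phi> x) = (LINT x|lebesgue. dilate t \<phi> (0 + t *\<^sub>R x)) * of_real (\<bar>t\<bar> ^ CARD('n))"
    using lebesgue_integral_affine[OF schwartz_borel[OF dilate_schwartz[OF assms]], of t 0] assms by simp
  also have "\<dots> = (LINT x|lebesgue. dilate t \<phi> (0 + t *\<^sub>R x) * of_real (\<bar>t\<bar> ^ CARD('n)))"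
    by (rule integral_mult_left_zero[symmetric])
  also have "\<dots> = (LINT x|lebesgue. \<phi> x)"
    using assms(2) by (intro Bochner_Integration.integral_cong refl) (simp add: dilate_def, simp add: scaleR_conv_of_real)
  finally show ?thesis .
qed

text \<open>The integral equals \<open>T (V j)\<close>, where \<open>V j\<close> is \<phi> convolved
  with the reflected dilate of \<psi>. Since \<psi> has integral 1, \<open>V j\<close> - \<phi> is
  an average of translation differences of \<phi> over distances of order \<open>t j\<close>, hence
  small of order \<open>t j\<close> in the Schwartz norm that controls \<open>T\<close>.\<close>

lemma tempered_mollify:
  fixes \<phi> \<psi> :: "real ^ 'n::finite \<Rightarrow> complex"
  assumes T: "T \<in> tempered" and \<phi>: "\<phi> \<in> schwartz" and \<psi>: "\<psi> \<in> schwartz"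
    and one: "(LINT x|lebesgue. \<psi> x) = 1"
    and t: "\<And>j. 0 < t j" "\<And>j. t j \<le> 1" "t \<longlonglongrightarrow> 0"
  shows "(\<lambda>j::nat. LINT x|lebesgue. \<phi> x * conv (dilate (t j) \<psi>) T x) \<longlonglongrightarrow> T \<phi>"
proof -
  obtain k m C where T': "0 < m" "0 \<le> C"
    "\<And>\<phi> B. \<phi> \<in> schwartz \<Longrightarrow> schwartz_bound k m \<phi> B \<Longrightarrow> cmod (T \<phi>) \<le> C * B"
    using T by (rule tempered_boundE) blast
  obtain D where D: "0 < D" "schwartz_bound (Suc k) m \<phi> D" using \<phi> by (rule schwartz_boundE)
  let ?n = "real CARD('n)"
  define V where "V j = (\<lambda>y. LINT x|lebesgue. \<phi> x * dilate (t j) \<psi> (x - y))" for j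
  have dil: "dilate (t j) \<psi> \<in> schwartz" for j by (rule dilate_schwartz[OF \<psi> t(1)])
  have TV: "T (V j) = (LINT x|lebesgue. \<phi> x * conv (dilate (t j) \<psi>) T x)" for j
    unfolding V_def by (rule tempered_conv_fun[OF T \<phi> dil])
  have [measurable]: "\<phi> \<in> borel_measurable borel" "\<psi> \<in> borel_measurable borel" "dilate (t j) \<psi> \<in> borel_measurable borel" for j
    by (rule schwartz_borel, rule \<phi> \<psi> dil)+
  have V_alt: "V j = (\<lambda>y. LINT x|lebesgue. dilate (t j) \<psi> (0 - x) * \<phi> (y - x))" for j
  proof
    fix y
    show "V j y = (LINT x|lebesgue. dilate (t j) \<psi> (0 - x) * \<phi> (y - x))"
      unfolding V_def by (subst lebesgue_integral_affine[where c="-1" and t=y]) (auto simp: mult.commute)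
  qed
  have K: "integrable lebesgue (\<lambda>x. dilate (t j) \<psi> (0 - x))" for j
    by (intro schwartz_integrable schwartz_reflect dil)
  have VS: "V j \<in> schwartz" for j
    unfolding V_alt by (intro schwartz_conv_fun schwartz_reflect dil \<phi>)
  have refl: "(\<lambda>x. \<psi> (0 - x)) \<in> schwartz" by (rule schwartz_reflect[OF \<psi>])
  have wint: "integrable lebesgue (\<lambda>w. ((1 + norm w) powr m * norm w) * norm (\<psi> (0 - w)))"
  proof (rule schwartz_norm_integrable[OF refl, of _ 1 "m + 1"])
    show "(\<lambda>w::real^'n. (1 + norm w) powr m * norm w) \<in> borel_measurable lebesgue"
      by (intro borel_measurable_lebesgue_continuous continuous_intros) (auto simp: add_nonneg_eq_0_iff)
    fix w :: "real^'n"
    have "(1 + norm w) powr m * norm w \<le> (1 + norm w) powr m * (1 + norm w) powr 1"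
      by (intro mult_left_mono) (auto simp: powr_one)
    then show "\<bar>(1 + norm w) powr m * norm w\<bar> \<le> 1 * (1 + norm w) powr (m + 1)"
      by (simp add: powr_add abs_mult)
  qed
  \<comment> \<open>The weighted first moment of the reflected \<psi>: |w| is the length of a
    translation before scaling, and (1 + |w|)^m the cost of moving the weight by it.\<close>
  define A where "A = ?n * D * (LINT w|lebesgue. ((1 + norm w) powr m * norm w) * norm (\<psi> (0 - w)))"
  have one': "(LINT w|lebesgue. \<psi> (0 - w)) = 1"
    using lebesgue_integral_affine[of \<psi> "-1" 0] one by simp
  have "schwartz_bound k m (\<lambda>y. V j y - \<phi> y) (A * t j)" for j
    unfolding schwartz_bound_def
  proof (intro allI impI)
    fix "is" :: "'n list" and y :: "real^'n" assume l: "length is \<le> k"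
    let ?p = "partials is \<phi>"
    have p: "?p \<in> schwartz" by (rule schwartz_partials[OF \<phi>])
    have [measurable]: "?p \<in> borel_measurable borel" by (rule schwartz_borel[OF p])
    have "partials is (V j) y = (LINT x|lebesgue. dilate (t j) \<psi> (0 - x) * ?p (y - x))"
      unfolding V_alt by (subst partials_conv_fun[OF K \<phi>]) rule
    \<comment> \<open>The substitution x = \<open>t j\<close> w removes the dilation from \<psi> and
      leaves a translation of \<phi> by \<open>t j\<close> w.\<close>
    also have "\<dots> = (LINT w|lebesgue. dilate (t j) \<psi> (0 - (0 + t j *\<^sub>R w)) * ?p (y - (0 + t j *\<^sub>R w)))
        * of_real (\<bar>t j\<bar> ^ DIM(real^'n))"
      using t(1)[of j] by (intro lebesgue_integral_affine) auto
    also have "\<dots> = (LINT w|lebesgue. dilate (t j) \<psi> (0 - (0 + t j *\<^sub>R w)) * ?p (y - (0 + t j *\<^sub>R w))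
        * of_real (\<bar>t j\<bar> ^ DIM(real^'n)))"
      by (rule integral_mult_left_zero[symmetric])
    also have "\<dots> = (LINT w|lebesgue. \<psi> (0 - w) * ?p (y - t j *\<^sub>R w))"
    proof (intro Bochner_Integration.integral_cong refl)
      fix w
      have d: "dilate (t j) \<psi> (0 - (0 + t j *\<^sub>R w)) * of_real (\<bar>t j\<bar> ^ DIM(real^'n)) = \<psi> (0 - w)"
        using t(1)[of j] by (simp add: dilate_def) (simp add: scaleR_conv_of_real)
      have "a * b * c = (a * c) * b" for a b c :: complex by (simp only: mult_ac)
      then show "dilate (t j) \<psi> (0 - (0 + t j *\<^sub>R w)) * ?p (y - (0 + t j *\<^sub>R w)) * of_real (\<bar>t j\<bar> ^ DIM(real^'n))
        = \<psi> (0 - w) * ?p (y - t j *\<^sub>R w)"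
        using d by simp
    qed simp
    finally have pV: "partials is (V j) y = (LINT w|lebesgue. \<psi> (0 - w) * ?p (y - t j *\<^sub>R w))" .
    have i1: "integrable lebesgue (\<lambda>w. \<psi> (0 - w) * ?p (y - t j *\<^sub>R w))"
    proof -
      obtain E where E: "0 < E" "schwartz_bound 0 0 ?p E" by (rule schwartz_boundE[OF p])
      have "cmod (?p z) \<le> E * (1 + norm w) powr 0" for z and w :: "real^'n"
      proof -
        have "1 + norm w \<noteq> 0" using norm_ge_zero[of w] by linarith
        then show ?thesis
          using schwartz_boundD[OF E(2), of z] E(1) by (auto simp: powr_zero_eq_one split: if_splits)
      qed
      moreover have "(\<lambda>w. ?p (y - t j *\<^sub>R w)) \<in> borel_measurable lebesgue"
        by (rule measurable_completion) simp
      ultimately have "integrable lebesgue (\<lambda>w. ?p (y - t j *\<^sub>R w) * \<psi> (0 - w))"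
        using schwartz_integrable_weight[OF refl, of "\<lambda>w. ?p (y - t j *\<^sub>R w)" E 0] by blast
      then show ?thesis by (simp add: mult.commute)
    qed
    have i2: "integrable lebesgue (\<lambda>w. \<psi> (0 - w) * ?p y)" using schwartz_integrable[OF refl] by auto
    have "partials is (\<lambda>y. V j y - \<phi> y) y = partials is (V j) y - 1 * ?p y"
      using partials_add_cmult[OF schwartz_smooth[OF VS[of j]] schwartz_smooth[OF \<phi>], of "is" 1 "-1"] by simp
    also have "\<dots> = (LINT w|lebesgue. \<psi> (0 - w) * ?p (y - t j *\<^sub>R w)) - (LINT w|lebesgue. \<psi> (0 - w) * ?p y)"
      unfolding pV one'[symmetric] by simp
    also have "\<dots> = (LINT w|lebesgue. \<psi> (0 - w) * ?p (y - t j *\<^sub>R w) - \<psi> (0 - w) * ?p y)"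
      using i1 i2 by (rule Bochner_Integration.integral_diff[symmetric])
    finally have eq: "partials is (\<lambda>y. V j y - \<phi> y) y = (LINT w|lebesgue. \<psi> (0 - w) * ?p (y - t j *\<^sub>R w) - \<psi> (0 - w) * ?p y)" .
    have "cmod \<dots> \<le> (LINT w|lebesgue. (?n * D * t j * (1 + norm y) powr - m) * (((1 + norm w) powr m * norm w) * norm (\<psi> (0 - w))))"
    proof (rule Bochner_Integration.integral_norm_bound_integral)
      show "integrable lebesgue (\<lambda>w. \<psi> (0 - w) * ?p (y - t j *\<^sub>R w) - \<psi> (0 - w) * ?p y)"
        using i1 i2 by simp
      fix w :: "real^'n"
      \<comment> \<open>\<open>t j\<close> \<le> 1 makes the weight factor independent of j; the
        other factor |\<open>t j\<close> w| keeps the power of \<open>t j\<close> that gives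
        convergence.\<close>
      have tw: "norm (t j *\<^sub>R w) \<le> norm w" using t(1,2)[of j] by (simp add: mult_left_le_one_le)
      have "cmod (?p (y - t j *\<^sub>R w) - ?p y) \<le> ?n * D * (1 + norm (t j *\<^sub>R w)) powr m * norm (t j *\<^sub>R w) * (1 + norm y) powr - m"
        using partials_translate_diff_le[OF schwartz_smooth[OF \<phi>] D(2) _ _ l, of 1 y "- (t j *\<^sub>R w)" 0] T'(1) by simp
      also have "\<dots> \<le> ?n * D * (1 + norm w) powr m * norm (t j *\<^sub>R w) * (1 + norm y) powr - m"
        using D tw T'(1) by (intro mult_right_mono mult_left_mono powr_mono2) auto
      also have "\<dots> = (?n * D * t j * (1 + norm y) powr - m) * ((1 + norm w) powr m * norm w)"
        using t(1)[of j] by (simp add: mult_ac)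
      finally have "cmod (?p (y - t j *\<^sub>R w) - ?p y) * cmod (\<psi> (0 - w)) \<le> \<dots> * cmod (\<psi> (0 - w))"
        by (rule mult_right_mono) simp
      then show "cmod (\<psi> (0 - w) * ?p (y - t j *\<^sub>R w) - \<psi> (0 - w) * ?p y)
        \<le> (?n * D * t j * (1 + norm y) powr - m) * (((1 + norm w) powr m * norm w) * norm (\<psi> (0 - w)))"
        by (simp add: norm_mult mult_ac flip: right_diff_distrib)
    qed (use wint in auto)
    also have "\<dots> = A * t j * (1 + norm y) powr - m"
      by (subst integral_mult_right_zero) (simp add: A_def mult_ac)
    finally show "cmod (partials is (\<lambda>y. V j y - \<phi> y) y) \<le> A * t j * (1 + norm y) powr - m" unfolding eq .
  qed
  then have "cmod (T (V j) - T \<phi>) \<le> C * (A * t j)" for j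
    using T'(3)[OF schwartz_diff[OF VS \<phi>]] tempered_diff[OF T VS \<phi>] by metis
  moreover have "(\<lambda>j. C * (A * t j)) \<longlonglongrightarrow> C * (A * 0)" by (intro tendsto_intros t)
  ultimately have "(\<lambda>j. T (V j) - T \<phi>) \<longlonglongrightarrow> 0"
    by (intro Lim_null_comparison[of "\<lambda>j. T (V j) - T \<phi>" "\<lambda>j. C * (A * t j)"]) auto
  then show ?thesis unfolding TV by (rule LIM_zero_cancel)
qed

section \<open>Hajlasz gradients\<close>

text \<open>The exceptional set is a parameter, so that one null set can serve a whole sequence of
  functions and its limit. Integrability of \<open>g\<close> is kept apart.\<close>

definition hajlasz_gradient ::
    "real \<Rightarrow> ('a::euclidean_space \<Rightarrow> complex) \<Rightarrow> ('a \<Rightarrow> real) \<Rightarrow> 'a set \<Rightarrow> bool" where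
  "hajlasz_gradient s u g N \<longleftrightarrow> N \<in> null_sets lebesgue \<and> g \<in> borel_measurable lebesgue \<and> (\<forall>x. 0 \<le> g x) \<and>
     (\<forall>x\<in>- N. \<forall>y\<in>- N. cmod (u x - u y) \<le> norm (x - y) powr s * (g x + g y))"

text \<open>The homothety with centre \<open>y\<close> and ratio \<theta> maps
  \<open>ball c r\<close> to a ball of radius \<theta> r that stays inside it and within 2 r
  \<theta> of \<open>y\<close>, even if \<open>y\<close> is close to the boundary. If g > l held
  there off \<open>N\<close>, the integral of g^q would be too large.\<close>

lemma ex_small_gradient_near:
  fixes c y :: "'a::euclidean_space"
  assumes [measurable]: "g \<in> borel_measurable lebesgue" and N: "N \<in> null_sets lebesgue"
    and r: "0 < r" and \<theta>: "0 < \<theta>" "\<theta> \<le> 1" and q: "0 < q" and l: "0 < l" and y: "y \<in> ball c r"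
    and small: "(\<integral>\<^sup>+ z. ennreal (g z powr q) * indicator (ball c r) z \<partial>lebesgue)
      < ennreal (l powr q * \<theta> ^ DIM('a) * unit_ball_vol DIM('a) * r ^ DIM('a))"
  shows "\<exists>z\<in>ball c r - N. g z \<le> l \<and> norm (y - z) \<le> 2 * r * \<theta>"
proof (rule ccontr)
  assume no: "\<not> ?thesis"
  let ?S = "ball (\<theta> *\<^sub>R c + (1 - \<theta>) *\<^sub>R y) (\<theta> * r)"
  have yc: "norm (y - c) < r" using y by (simp add: dist_norm norm_minus_commute)
  have sub: "z \<in> ball c r" "norm (y - z) \<le> 2 * r * \<theta>" if "z \<in> ?S" for z
  proof -
    define v where "v = z - (\<theta> *\<^sub>R c + (1 - \<theta>) *\<^sub>R y)"
    have v: "norm v < \<theta> * r" using that by (simp add: v_def dist_norm norm_minus_commute)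
    have "z - c = v + (1 - \<theta>) *\<^sub>R (y - c)" by (simp add: v_def algebra_simps)
    then have "norm (z - c) \<le> norm v + norm ((1 - \<theta>) *\<^sub>R (y - c))" by (metis norm_triangle_ineq)
    also have "norm ((1 - \<theta>) *\<^sub>R (y - c)) = (1 - \<theta>) * norm (y - c)" using \<theta> by simp
    also have "\<dots> \<le> (1 - \<theta>) * r" using yc \<theta> by (intro mult_left_mono) auto
    finally have "norm (z - c) < r" using v by (simp add: algebra_simps)
    then show "z \<in> ball c r" by (simp add: dist_norm norm_minus_commute)
    have "y - z = \<theta> *\<^sub>R (y - c) - v" by (simp add: v_def algebra_simps)
    then have "norm (y - z) \<le> norm (\<theta> *\<^sub>R (y - c)) + norm v" by (metis norm_triangle_ineq4)
    also have "norm (\<theta> *\<^sub>R (y - c)) \<le> \<theta> * r" using \<theta> yc by simp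
    finally show "norm (y - z) \<le> 2 * r * \<theta>" using v by (simp add: mult_ac)
  qed
  have "ennreal (l powr q * \<theta> ^ DIM('a) * unit_ball_vol DIM('a) * r ^ DIM('a))
    = ennreal (l powr q) * emeasure lebesgue ?S"
    using \<theta> r l by (simp add: emeasure_ball power_mult_distrib mult_ac flip: ennreal_mult)
  also have "\<dots> = (\<integral>\<^sup>+ z. ennreal (l powr q) * indicator ?S z \<partial>lebesgue)"
    by (rule nn_integral_cmult_indicator[symmetric]) simp
  also have "\<dots> \<le> (\<integral>\<^sup>+ z. ennreal (g z powr q) * indicator (ball c r) z \<partial>lebesgue)"
  proof (rule nn_integral_mono_AE)
    have "ennreal (l powr q) * indicator ?S z \<le> ennreal (g z powr q) * indicator (ball c r) z" if "z \<notin> N" for z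
    proof (cases "z \<in> ?S")
      case True
      then have "l < g z" using no that sub[OF True] by force
      then have "l powr q \<le> g z powr q" using l q by (intro powr_mono2) auto
      then show ?thesis using True sub[OF True] by (simp add: ennreal_leI)
    qed simp
    then show "AE z in lebesgue. ennreal (l powr q) * indicator ?S z \<le> ennreal (g z powr q) * indicator (ball c r) z"
      by (intro AE_I'[OF N]) auto
  qed
  finally show False using small by simp
qed

text \<open>Points with large gradient are joined to points where the gradient is at most \<open>L\<close> through points
  where it is at most \<open>2\<^sup>j L, 2\<^sup>j\<^sup>-\<^sup>1 L, \<dots>\<close>.  The choice of the exponent \<open>q\<close> makes the
  \<open>j\<close>-th step cost a multiple of \<open>2\<^sup>j\<^sup>q\<close>.\<close>

lemma hajlasz_oscillation_ball:
  assumes s: "0 < s"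
  defines "q \<equiv> real DIM('a) / (real DIM('a) + s)"
  shows "\<exists>C>0. \<forall>(u::'a::euclidean_space \<Rightarrow> complex) g N c r L y z. hajlasz_gradient s u g N \<longrightarrow> 0 < r \<longrightarrow> 0 < L \<longrightarrow>
    (\<integral>\<^sup>+ z. ennreal (g z powr q) * indicator (ball c r) z \<partial>lebesgue)
      \<le> ennreal (L powr q * unit_ball_vol DIM('a) * r ^ DIM('a) / 2) \<longrightarrow>
    y \<in> ball c r - N \<longrightarrow> z \<in> ball c r - N \<longrightarrow>
    cmod (u y - u z) \<le> C * r powr s * L powr (1 - q) * (L powr q + g y powr q + g z powr q)"
proof -
  let ?n = "DIM('a)"
  have n: "real ?n > 0" by simp
  have q: "0 < q" "q < 1" using s n by (auto simp: q_def field_simps)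
  have q_eq: "1 - q * s / real ?n = q"
  proof -
    have "q * s / real ?n = s / (real ?n + s)" using n by (simp add: q_def)
    moreover have "1 - s / (real ?n + s) = q" using s n by (simp add: q_def field_simps)
    ultimately show ?thesis by simp
  qed
  \<comment> \<open>The solution of K 2^q = K + 3, which closes the induction below: a step from
    level j + 1 costs 3 units and the rest of the chain K units of size 2^(jq).\<close>
  define K where "K = 3 / (2 powr q - 1)"
  have two: "1 < (2::real) powr q" using q by simp
  have "2 powr q - 1 \<noteq> 0" using two by linarith
  then have "K * (2 powr q - 1) = 3" unfolding K_def by (rule nonzero_eq_divide_eq[THEN iffD1, OF _ refl])
  then have K: "K > 0" "K * 2 powr q = K + 3" using two by (auto simp: K_def right_diff_distrib)
  \<comment> \<open>2^s replaces (2 r)^s by r^s. The bracket collects the two chains, 2 K each, and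
    the final jump between two points of gradient at most L, which costs 2.\<close>
  define C where "C = 2 powr s * (4 * K + 2)"
  show ?thesis
  proof (intro exI[of _ C] conjI allI impI)
    show "C > 0" using K by (simp add: C_def)
    fix u :: "'a \<Rightarrow> complex" and g N and c y0 z0 :: 'a and r L :: real
    assume H: "hajlasz_gradient s u g N" and r: "0 < r" and L: "0 < L"
      and I: "(\<integral>\<^sup>+ z. ennreal (g z powr q) * indicator (ball c r) z \<partial>lebesgue)
        \<le> ennreal (L powr q * unit_ball_vol ?n * r ^ ?n / 2)"
      and y0: "y0 \<in> ball c r - N" and z0: "z0 \<in> ball c r - N"
    have [measurable]: "g \<in> borel_measurable lebesgue" and N: "N \<in> null_sets lebesgue" and g0: "\<And>x. 0 \<le> g x"
      and Hd: "\<And>x y. x \<notin> N \<Longrightarrow> y \<notin> N \<Longrightarrow> cmod (u x - u y) \<le> norm (x - y) powr s * (g x + g y)"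
      using H by (auto simp: hajlasz_gradient_def)
    define R where "R = (2 * r) powr s"
    have R: "R > 0" using r by (simp add: R_def)
    have chain: "\<exists>y'\<in>ball c r - N. g y' \<le> L \<and> cmod (u y - u y') \<le> K * R * L * 2 powr (real j * q)"
      if "y \<in> ball c r - N" "g y \<le> 2 ^ j * L" for j y
      using that
    proof (induction j arbitrary: y)
      case 0
      then show ?case using K R L by (intro bexI[of _ y]) auto
    next
      case (Suc j)
      \<comment> \<open>Chosen so that (2^j L)^q \<theta>^n = L^q: the smallness condition at level
        2^j L then reduces to the one at level L. The factor 1/2 in the hypothesis makes it
        strict.\<close>
      define \<theta> where "\<theta> = 2 powr (- real j * q / real ?n)"
      have "- real j * q / real ?n \<le> 0" using q n by (simp add: divide_nonpos_pos mult_nonpos_nonneg)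
      then have "(2::real) powr (- real j * q / real ?n) \<le> 2 powr 0" by (intro powr_mono) auto
      then have \<theta>: "0 < \<theta>" "\<theta> \<le> 1" by (simp_all add: \<theta>_def)
      have "\<theta> ^ ?n = 2 powr (- real j * q)" using n by (simp add: \<theta>_def powr_power)
      then have "(2 ^ j * L) powr q * \<theta> ^ ?n = L powr q"
        using L by (simp add: powr_mult powr_powr powr_minus flip: powr_realpow)
      moreover have "L powr q * unit_ball_vol ?n * r ^ ?n / 2 < L powr q * unit_ball_vol ?n * r ^ ?n"
        using L r by simp
      ultimately have "(\<integral>\<^sup>+ z. ennreal (g z powr q) * indicator (ball c r) z \<partial>lebesgue)
         < ennreal ((2 ^ j * L) powr q * \<theta> ^ ?n * unit_ball_vol ?n * r ^ ?n)"
        using L r by (intro le_less_trans[OF I] ennreal_lessI) auto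
      with Suc.prems \<theta> q L r N obtain z where z: "z \<in> ball c r - N" "g z \<le> 2 ^ j * L" "norm (y - z) \<le> 2 * r * \<theta>"
        using ex_small_gradient_near[of g N r \<theta> q "2 ^ j * L" y c] by auto
      obtain y' where y': "y' \<in> ball c r - N" "g y' \<le> L" "cmod (u z - u y') \<le> K * R * L * 2 powr (real j * q)"
        using Suc.IH[OF z(1,2)] by blast
      have "cmod (u y - u z) \<le> norm (y - z) powr s * (g y + g z)" using Suc.prems z by (intro Hd) auto
      \<comment> \<open>g(y) \<le> 2^(j+1) L and g(z) \<le> 2^j L add up to 3 * 2^j L.\<close>
      also have "\<dots> \<le> (2 * r * \<theta>) powr s * (3 * (2 ^ j * L))"
        using z Suc.prems s g0[of y] g0[of z] by (intro mult_mono powr_mono2) auto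
      also have "(2 * r * \<theta>) powr s = R * 2 powr (- real j * q * s / real ?n)"
        by (simp add: R_def powr_mult \<theta>_def powr_powr)
      also have "R * 2 powr (- real j * q * s / real ?n) * (3 * (2 ^ j * L))
        = 3 * R * L * (2 powr (- real j * q * s / real ?n) * 2 powr real j)"
        by (simp add: powr_realpow)
      also have "2 powr (- real j * q * s / real ?n) * 2 powr real j = (2::real) powr (real j * (1 - q * s / real ?n))"
        by (subst powr_add[symmetric]) (simp add: algebra_simps)
      finally have "cmod (u y - u z) \<le> 3 * R * L * 2 powr (real j * q)" unfolding q_eq .
      with y'(3) have "cmod (u y - u y') \<le> 3 * R * L * 2 powr (real j * q) + K * R * L * 2 powr (real j * q)"
        using norm_diff_triangle_le by blast
      also have "\<dots> = (K * 2 powr q) * (R * L * 2 powr (real j * q))" unfolding K(2) by (simp add: algebra_simps)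
      also have "\<dots> = K * R * L * 2 powr (real (Suc j) * q)" by (simp add: distrib_right powr_add)
      finally show ?case using y' by blast
    qed
    have reach: "\<exists>y'\<in>ball c r - N. g y' \<le> L \<and> cmod (u y - u y') \<le> 2 * K * R * L powr (1 - q) * (L powr q + g y powr q)"
      if y: "y \<in> ball c r - N" for y
    proof -
      \<comment> \<open>The least level with g(y) \<le> 2^j L; rounding up costs at most a factor 2
        in 2^(jq). The maximum with 1 assigns level 0 to points that are already below L.\<close>
      define j where "j = nat \<lceil>log 2 (max 1 (g y / L))\<rceil>"
      have "0 \<le> log 2 (max 1 (g y / L))" by simp
      then have j: "log 2 (max 1 (g y / L)) \<le> real j" "real j < log 2 (max 1 (g y / L)) + 1"
        unfolding j_def by linarith+
      from j(1) have "max 1 (g y / L) \<le> 2 ^ j" by (simp add: log_le_iff powr_realpow)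
      then have "g y \<le> 2 ^ j * L" using L by (simp add: field_simps)
      then obtain y' where y': "y' \<in> ball c r - N" "g y' \<le> L" "cmod (u y - u y') \<le> K * R * L * 2 powr (real j * q)"
        using chain[OF y] by blast
      have "2 powr (real j * q) \<le> 2 powr ((log 2 (max 1 (g y / L)) + 1) * q)" using j q by simp
      also have "\<dots> = (2 powr (log 2 (max 1 (g y / L)) + 1)) powr q" by (simp add: powr_powr)
      also have "2 powr (log 2 (max 1 (g y / L)) + 1) = 2 * max 1 (g y / L)" by (simp add: powr_add)
      also have "(2 * max 1 (g y / L)) powr q \<le> 2 powr 1 * (max 1 (g y / L)) powr q"
        using q by (simp only: powr_mult) (intro mult_right_mono powr_mono, auto)
      also have "(max 1 (g y / L)) powr q \<le> 1 + (g y / L) powr q" by (auto simp: max_def)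
      finally have "2 powr (real j * q) \<le> 2 * (1 + (g y / L) powr q)" by simp
      then have "K * R * L * 2 powr (real j * q) \<le> K * R * L * (2 * (1 + (g y / L) powr q))"
        using K R L by (intro mult_left_mono) auto
      also have "\<dots> = 2 * K * R * (L powr (1 - q) * L powr q * (1 + g y powr q / L powr q))"
        using L g0[of y] by (simp add: powr_add[symmetric] powr_divide)
      also have "L powr (1 - q) * L powr q * (1 + g y powr q / L powr q) = L powr (1 - q) * (L powr q + g y powr q)"
        using L by (simp add: field_simps)
      also have "2 * K * R * (L powr (1 - q) * (L powr q + g y powr q)) = 2 * K * R * L powr (1 - q) * (L powr q + g y powr q)"
        by (simp only: mult.assoc)
      finally have "cmod (u y - u y') \<le> 2 * K * R * L powr (1 - q) * (L powr q + g y powr q)"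
        using y'(3) by (rule order_trans[rotated])
      then show ?thesis using y' by blast
    qed
    obtain y where y: "y \<in> ball c r - N" "g y \<le> L" "cmod (u y0 - u y) \<le> 2 * K * R * L powr (1 - q) * (L powr q + g y0 powr q)"
      using reach[OF y0] by blast
    obtain z where z: "z \<in> ball c r - N" "g z \<le> L" "cmod (u z0 - u z) \<le> 2 * K * R * L powr (1 - q) * (L powr q + g z0 powr q)"
      using reach[OF z0] by blast
    have "cmod (u y - u z) \<le> norm (y - z) powr s * (g y + g z)" using y z by (intro Hd) auto
    also have "\<dots> \<le> R * (2 * L)"
    proof (intro mult_mono)
      have "dist y z \<le> dist c y + dist c z" by (metis dist_commute dist_triangle)
      then have "norm (y - z) \<le> 2 * r" using y z by (simp add: dist_norm)
      then show "norm (y - z) powr s \<le> R" unfolding R_def using s by (intro powr_mono2) auto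
    qed (use y z R g0[of y] g0[of z] in auto)
    also have "\<dots> = 2 * R * L powr (1 - q) * L powr q" using L by (simp flip: powr_add)
    finally have yz: "cmod (u y - u z) \<le> 2 * R * L powr (1 - q) * L powr q" .
    have "cmod (u y0 - u z0) \<le> cmod (u y0 - u y) + cmod (u y - u z) + cmod (u z0 - u z)"
    proof -
      have "u y0 - u z0 = (u y0 - u y) + (u y - u z) - (u z0 - u z)" by simp
      then show ?thesis by (metis norm_triangle_ineq norm_triangle_ineq4 add_right_mono order_trans)
    qed
    also have "\<dots> \<le> 2 * K * R * L powr (1 - q) * (L powr q + g y0 powr q) + 2 * R * L powr (1 - q) * L powr q
       + 2 * K * R * L powr (1 - q) * (L powr q + g z0 powr q)"
      using y z yz by (intro add_mono) auto
    also have "\<dots> = R * L powr (1 - q) * ((4 * K + 2) * L powr q + 2 * K * g y0 powr q + 2 * K * g z0 powr q)"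
      by (simp add: algebra_simps)
    also have "\<dots> \<le> R * L powr (1 - q) * ((4 * K + 2) * L powr q + (4 * K + 2) * g y0 powr q + (4 * K + 2) * g z0 powr q)"
      using R K by (intro mult_left_mono add_mono mult_right_mono) auto
    also have "\<dots> = C * r powr s * L powr (1 - q) * (L powr q + g y0 powr q + g z0 powr q)"
      unfolding C_def R_def powr_mult by (simp add: distrib_left mult_ac)
    finally show "cmod (u y0 - u z0) \<le> C * r powr s * L powr (1 - q) * (L powr q + g y0 powr q + g z0 powr q)" .
  qed
qed

text \<open>Every \<open>A\<close> dominating the maximal function at \<open>x\<close> is admitted in order to avoid the value \<open>0\<close>.\<close>

lemma hajlasz_oscillation:
  assumes s: "0 < s"
  defines "q \<equiv> real DIM('a) / (real DIM('a) + s)"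
  shows "\<exists>C>0. \<forall>(u::'a::euclidean_space \<Rightarrow> complex) g N x t A. hajlasz_gradient s u g N \<longrightarrow> 0 < t \<longrightarrow> 0 < A \<longrightarrow>
    hl_max (\<lambda>y. ennreal (g y powr q)) x \<le> ennreal A \<longrightarrow>
    (\<exists>z\<in>ball x t - N. g z powr q \<le> C * A) \<and>
    (\<forall>y\<in>- N. \<forall>z\<in>ball x t - N. cmod (u y - u z)
      \<le> C * (t + norm (x - y)) powr s * A powr (s / DIM('a)) * (A + g y powr q + g z powr q))"
proof -
  let ?n = "DIM('a)"
  have n: "real ?n > 0" by simp
  have q: "0 < q" using s n by (auto simp: q_def field_simps)
  have q_eq: "(1 - q) / q = s / real ?n"
  proof -
    have "1 - q = s / (real ?n + s)" using s n by (simp add: q_def field_simps)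
    then show ?thesis using s n by (simp add: q_def)
  qed
  define w where "w = unit_ball_vol (real ?n)"
  have w: "w > 0" by (simp add: w_def)
  obtain B where B: "B > 0" "\<And>(u::'a \<Rightarrow> complex) g N c r L y z. hajlasz_gradient s u g N \<Longrightarrow> 0 < r \<Longrightarrow> 0 < L \<Longrightarrow>
    (\<integral>\<^sup>+ z. ennreal (g z powr q) * indicator (ball c r) z \<partial>lebesgue)
      \<le> ennreal (L powr q * unit_ball_vol ?n * r ^ ?n / 2) \<Longrightarrow>
    y \<in> ball c r - N \<Longrightarrow> z \<in> ball c r - N \<Longrightarrow>
    cmod (u y - u z) \<le> B * r powr s * L powr (1 - q) * (L powr q + g y powr q + g z powr q)"
    using hajlasz_oscillation_ball[OF s, where 'a='a] unfolding q_def by blast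
  define D where "D = max 1 (2 / w)"
  define C where "C = max (2 / w) (B * (2 / w) powr (s / real ?n) * D)"
  show ?thesis
  proof (intro exI[of _ C] conjI allI impI)
    show "C > 0" using w by (auto simp: C_def less_max_iff_disj)
    fix u :: "'a \<Rightarrow> complex" and g N x and t A :: real
    assume H: "hajlasz_gradient s u g N" and t: "0 < t" and A: "0 < A"
      and M: "hl_max (\<lambda>y. ennreal (g y powr q)) x \<le> ennreal A"
    have [measurable]: "g \<in> borel_measurable lebesgue" and N: "N \<in> null_sets lebesgue" and g0: "\<And>x. 0 \<le> g x"
      using H by (auto simp: hajlasz_gradient_def)
    \<comment> \<open>With this L the bound A r^n for the integral over a ball of radius r is
      exactly half of L^q times the volume, for every r. Also L^(1-q) is a multiple of A^(s/n),
      because (1 - q)/q = s/n.\<close>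
    define L where "L = (2 * A / w) powr (1 / q)"
    have L: "L > 0" using A w by (simp add: L_def)
    have Lq: "L powr q = 2 / w * A" using A w q by (simp add: L_def powr_powr)
    have "L powr (1 - q) = (2 / w * A) powr ((1 - q) / q)" by (simp add: L_def powr_powr)
    then have Lq': "L powr (1 - q) = (2 / w) powr (s / real ?n) * A powr (s / real ?n)" by (simp only: q_eq powr_mult)
    have I: "(\<integral>\<^sup>+ z. ennreal (g z powr q) * indicator (ball x r) z \<partial>lebesgue)
      \<le> ennreal (L powr q * unit_ball_vol ?n * r ^ ?n / 2)" if "0 < r" for r
    proof -
      have "(\<integral>\<^sup>+ z. ennreal (g z powr q) * indicator (ball x r) z \<partial>lebesgue)
        \<le> hl_max (\<lambda>y. ennreal (g y powr q)) x * ennreal (r ^ ?n)"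
        using that by (intro hl_max_ball) simp
      also have "\<dots> \<le> ennreal A * ennreal (r ^ ?n)" by (intro mult_right_mono M) simp
      also have "\<dots> = ennreal (L powr q * unit_ball_vol ?n * r ^ ?n / 2)"
        unfolding Lq w_def[symmetric] using A w that by (simp flip: ennreal_mult)
      finally show ?thesis .
    qed
    show "\<exists>z\<in>ball x t - N. g z powr q \<le> C * A"
    proof -
      have "(\<integral>\<^sup>+ z. ennreal (g z powr q) * indicator (ball x t) z \<partial>lebesgue)
        < ennreal (L powr q * 1 ^ ?n * unit_ball_vol ?n * t ^ ?n)"
        using L t by (intro le_less_trans[OF I] ennreal_lessI) auto
      \<comment> \<open>The ratio 1 and the point y = c = x: only the existence of a point of small
        gradient in the ball is wanted.\<close>
      then obtain z where z: "z \<in> ball x t - N" "g z \<le> L"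
        using ex_small_gradient_near[of g N t 1 q L x x] N t q L by auto
      have "g z powr q \<le> L powr q" using z g0 q by (intro powr_mono2) auto
      also have "\<dots> \<le> C * A" unfolding Lq using A by (intro mult_right_mono) (auto simp: C_def)
      finally show ?thesis using z by blast
    qed
    show "\<forall>y\<in>- N. \<forall>z\<in>ball x t - N. cmod (u y - u z)
      \<le> C * (t + norm (x - y)) powr s * A powr (s / DIM('a)) * (A + g y powr q + g z powr q)"
    proof (intro ballI)
      fix y z assume y: "y \<in> - N" and z: "z \<in> ball x t - N"
      \<comment> \<open>A ball about x that contains both y and z. Being centred at x, it is
        controlled by the maximal function at x however far away y is.\<close>
      define r where "r = t + norm (x - y)"
      have r: "r > 0" using t by (simp add: r_def add_pos_nonneg)
      have "y \<in> ball x r" "z \<in> ball x r" using t z norm_ge_zero[of "x - y"] by (auto simp: r_def dist_norm simp del: norm_ge_zero)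
      then have "cmod (u y - u z) \<le> B * r powr s * L powr (1 - q) * (L powr q + g y powr q + g z powr q)"
        using y z by (intro B(2)[OF H r L I[OF r]]) auto
      also have "\<dots> \<le> B * r powr s * L powr (1 - q) * (D * A + D * g y powr q + D * g z powr q)"
      proof -
        have "1 \<le> D" "2 / w \<le> D" by (auto simp: D_def)
        then have "L powr q + g y powr q + g z powr q \<le> D * A + D * g y powr q + D * g z powr q"
          unfolding Lq using A mult_right_mono[of 1 D "g y powr q"] mult_right_mono[of 1 D "g z powr q"]
          by (intro add_mono mult_right_mono) auto
        then show ?thesis using B(1) by (intro mult_left_mono) auto
      qed
      also have "\<dots> = (B * (2 / w) powr (s / real ?n) * D) * (r powr s * A powr (s / real ?n) * (A + g y powr q + g z powr q))"
        unfolding Lq' by (simp add: algebra_simps)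
      also have "\<dots> \<le> C * (r powr s * A powr (s / real ?n) * (A + g y powr q + g z powr q))"
        using A by (intro mult_right_mono) (auto simp: C_def)
      finally show "cmod (u y - u z) \<le> C * (t + norm (x - y)) powr s * A powr (s / DIM('a)) * (A + g y powr q + g z powr q)"
        by (simp add: r_def mult_ac)
    qed
  qed
qed

text \<open>The factor (t + |x-y|)^s lowers the decay of the kernel from m to m - s > n, and the
  remaining kernel is tested against a constant and against g^q. The first conclusion, for all
  \<open>z\<close>, is meant for z = x and gives pointwise convergence. In the second, a point with
  g(z)^q \<le> B A removes the dependence on \<open>z\<close> and leaves A^(s/n + 1) =
  A^(1/q).\<close>

lemma hajlasz_kernel:
  assumes s: "0 < s" and m: "real DIM('a) + s < m"
  defines "q \<equiv> real DIM('a) / (real DIM('a) + s)"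
  shows "\<exists>C>0. \<forall>(u::'a::euclidean_space \<Rightarrow> complex) g N x t A. hajlasz_gradient s u g N \<longrightarrow> 0 < t \<longrightarrow> 0 < A \<longrightarrow>
    hl_max (\<lambda>y. ennreal (g y powr q)) x \<le> ennreal A \<longrightarrow>
    (\<forall>z\<in>ball x t - N.
      (\<integral>\<^sup>+ y. ennreal ((1 + norm (x - y) / t) powr - m / t ^ DIM('a) * cmod (u y - u z)) \<partial>lebesgue)
      \<le> ennreal (C * t powr s * A powr (s / DIM('a)) * (A + g z powr q))) \<and>
    (\<exists>z\<in>ball x t - N.
      (\<integral>\<^sup>+ y. ennreal ((1 + norm (x - y) / t) powr - m / t ^ DIM('a) * cmod (u y - u z)) \<partial>lebesgue)
      \<le> ennreal (C * t powr s * A powr (1 / q)))"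
proof -
  let ?n = "DIM('a)"
  have n: "real ?n > 0" by simp
  have q_eq: "1 / q = s / real ?n + 1" using s n by (simp add: q_def field_simps)
  define w where "w = unit_ball_vol (real ?n)"
  have w: "w > 0" by (simp add: w_def)
  obtain B where B: "B > 0" "\<And>(u::'a \<Rightarrow> complex) g N x t A. hajlasz_gradient s u g N \<Longrightarrow> 0 < t \<Longrightarrow> 0 < A \<Longrightarrow>
    hl_max (\<lambda>y. ennreal (g y powr q)) x \<le> ennreal A \<Longrightarrow>
    (\<exists>z\<in>ball x t - N. g z powr q \<le> B * A) \<and>
    (\<forall>y\<in>- N. \<forall>z\<in>ball x t - N. cmod (u y - u z)
      \<le> B * (t + norm (x - y)) powr s * A powr (s / ?n) * (A + g y powr q + g z powr q))"
    using hajlasz_oscillation[OF s, where 'a='a] unfolding q_def by blast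
  have "real ?n < m - s" using m by simp
  from hl_max_kernel[OF this] obtain D where D: "D > 0" "\<And>(h::'a \<Rightarrow> ennreal) x t. h \<in> borel_measurable lebesgue \<Longrightarrow> 0 < t \<Longrightarrow>
    (\<integral>\<^sup>+ y. ennreal ((1 + norm (x - y) / t) powr - (m - s) / t ^ ?n) * h y \<partial>lebesgue) \<le> ennreal D * hl_max h x"
    by blast
  define C where "C = B * D * (w + 1) * (1 + B)"
  show ?thesis
  proof (intro exI[of _ C] allI impI conjI)
    show "C > 0" using B D w by (simp add: C_def)
    fix u :: "'a \<Rightarrow> complex" and g N x and t A :: real
    assume H: "hajlasz_gradient s u g N" and t: "0 < t" and A: "0 < A"
      and M: "hl_max (\<lambda>y. ennreal (g y powr q)) x \<le> ennreal A"
    have [measurable]: "g \<in> borel_measurable lebesgue" and N: "N \<in> null_sets lebesgue" and g0: "\<And>x. 0 \<le> g x"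
      using H by (auto simp: hajlasz_gradient_def)
    let ?F = "\<lambda>z. \<integral>\<^sup>+ y. ennreal ((1 + norm (x - y) / t) powr - m / t ^ ?n * cmod (u y - u z)) \<partial>lebesgue"
    have main: "?F z \<le> ennreal (B * D * (w + 1) * t powr s * A powr (s / ?n) * (A + g z powr q))" if z: "z \<in> ball x t - N" for z
    proof -
      let ?k = "\<lambda>y. (1 + norm (x - y) / t) powr - (m - s) / t ^ ?n"
      define G where "G = A + g z powr q"
      have G: "G > 0" using A by (simp add: G_def add_pos_nonneg)
      define E where "E = B * t powr s * A powr (s / ?n)"
      have E: "E \<ge> 0" using B by (simp add: E_def)
      have pt: "ennreal ((1 + norm (x - y) / t) powr - m / t ^ ?n * cmod (u y - u z))
        \<le> ennreal E * (ennreal (?k y) * ennreal G + ennreal (?k y) * ennreal (g y powr q))" if y: "y \<notin> N" for y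
      proof -
        define v where "v = 1 + norm (x - y) / t"
        have v: "v > 0" using t by (simp add: v_def add_pos_nonneg)
        have "t + norm (x - y) = t * v" using t by (simp add: v_def field_simps)
        then have "cmod (u y - u z) \<le> B * (t powr s * v powr s) * A powr (s / ?n) * (A + g y powr q + g z powr q)"
          using B(2)[OF H t A M] y z by (force simp: powr_mult)
        then have "v powr - m / t ^ ?n * cmod (u y - u z)
          \<le> v powr - m / t ^ ?n * (B * (t powr s * v powr s) * A powr (s / ?n) * (A + g y powr q + g z powr q))"
          using t by (intro mult_left_mono) auto
        also have "\<dots> = E * ((v powr - m * v powr s) / t ^ ?n * (G + g y powr q))"
          by (simp add: E_def G_def mult_ac add_ac)
        also have "v powr - m * v powr s = v powr - (m - s)" by (simp flip: powr_add)
        finally have "ennreal (v powr - m / t ^ ?n * cmod (u y - u z)) \<le> ennreal (E * (?k y * (G + g y powr q)))"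
          by (intro ennreal_leI) (simp add: v_def)
        also have "\<dots> = ennreal E * (ennreal (?k y) * ennreal G + ennreal (?k y) * ennreal (g y powr q))"
        proof -
          have "ennreal (E * (a * (G + b))) = ennreal E * (ennreal a * ennreal G + ennreal a * ennreal b)"
            if "0 \<le> a" "0 \<le> b" for a b
            using that E G by (simp add: distrib_left flip: ennreal_mult ennreal_plus)
          from this[of "?k y" "g y powr q"] show ?thesis using t by (simp only: divide_nonneg_pos powr_ge_zero zero_less_power)
        qed
        finally show ?thesis by (simp add: v_def)
      qed
      have kmeas: "?k \<in> borel_measurable lebesgue"
      proof -
        have "1 + norm (x - y) / t \<noteq> 0" for y
        proof -
          have "0 \<le> norm (x - y) / t" using t by simp
          then show ?thesis by linarith
        qed
        then show ?thesis using t by (intro borel_measurable_lebesgue_continuous continuous_intros) auto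
      qed
      have "?F z \<le> (\<integral>\<^sup>+ y. ennreal E * (ennreal (?k y) * ennreal G + ennreal (?k y) * ennreal (g y powr q)) \<partial>lebesgue)"
        by (rule nn_integral_mono_AE, rule AE_I'[OF N]) (use pt in auto)
      also have "\<dots> = ennreal E * ((\<integral>\<^sup>+ y. ennreal (?k y) * ennreal G \<partial>lebesgue) + (\<integral>\<^sup>+ y. ennreal (?k y) * ennreal (g y powr q) \<partial>lebesgue))"
        using kmeas by (subst nn_integral_cmult, measurable, subst nn_integral_add, measurable)
      also have "\<dots> \<le> ennreal E * (ennreal D * hl_max (\<lambda>_. ennreal G) x + ennreal D * hl_max (\<lambda>y. ennreal (g y powr q)) x)"
        using t by (intro mult_left_mono add_mono D(2)) auto
      also have "\<dots> \<le> ennreal E * (ennreal D * (ennreal w * ennreal G) + ennreal D * ennreal A)"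
        unfolding w_def by (intro mult_left_mono add_mono hl_max_const M) auto
      also have "\<dots> = ennreal (E * (D * (w * G) + D * A))"
        using E D w G A by (simp flip: ennreal_mult ennreal_plus)
      also have "\<dots> \<le> ennreal (E * (D * (w * G) + D * G))"
        using E D w by (intro ennreal_leI mult_left_mono add_mono) (auto simp: G_def)
      also have "E * (D * (w * G) + D * G) = B * D * (w + 1) * t powr s * A powr (s / ?n) * (A + g z powr q)"
        by (simp add: E_def G_def algebra_simps)
      finally show ?thesis .
    qed
    have BDw: "0 \<le> B * D * (w + 1)" using B D w by simp
    show "\<forall>z\<in>ball x t - N. ?F z \<le> ennreal (C * t powr s * A powr (s / ?n) * (A + g z powr q))"
    proof
      fix z assume z: "z \<in> ball x t - N"
      have "B * D * (w + 1) * 1 \<le> C" unfolding C_def using BDw B by (intro mult_left_mono) auto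
      then have "B * D * (w + 1) * t powr s * A powr (s / ?n) * (A + g z powr q) \<le> C * t powr s * A powr (s / ?n) * (A + g z powr q)"
        using A by (intro mult_right_mono) auto
      then show "?F z \<le> ennreal (C * t powr s * A powr (s / ?n) * (A + g z powr q))"
        using main[OF z] by (meson ennreal_leI order_trans)
    qed
    obtain z where z: "z \<in> ball x t - N" "g z powr q \<le> B * A" using B(2)[OF H t A M] by blast
    have "B * D * (w + 1) * t powr s * A powr (s / ?n) * (A + g z powr q)
       \<le> B * D * (w + 1) * t powr s * A powr (s / ?n) * (A + B * A)"
      using z(2) BDw by (intro mult_left_mono) auto
    also have "\<dots> = C * t powr s * (A powr (s / ?n) * A powr 1)" using A by (simp add: C_def algebra_simps)
    also have "\<dots> = C * t powr s * A powr (1 / q)" by (simp only: q_eq powr_add)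
    finally have "?F z \<le> ennreal (C * t powr s * A powr (1 / q))"
      using main[OF z(1)] by (meson ennreal_leI order_trans)
    then show "\<exists>z\<in>ball x t - N. ?F z \<le> ennreal (C * t powr s * A powr (1 / q))" using z(1) by blast
  qed
qed

section \<open>Lebesgue quasi-norms\<close>

lemma ennreal_powr_add_le:
  assumes "0 \<le> r"
  shows "ennreal_powr (a + b) r \<le> ennreal (2 powr r) * (ennreal_powr a r + ennreal_powr b r)"
proof -
  have *: "ennreal_powr (a + b) r \<le> ennreal (2 powr r) * (ennreal_powr a r + ennreal_powr b r)" if "a \<le> b" for a b
  proof (cases b)
    case (real y)
    have "a \<noteq> top" using that real by (auto simp: top_unique)
    then obtain x where x: "a = ennreal x" "0 \<le> x" by (cases a) auto
    with real that have "x \<le> y" by (simp add: ennreal_le_iff)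
    then have "(x + y) powr r \<le> (2 * y) powr r" using assms x by (intro powr_mono2) auto
    also have "\<dots> \<le> 2 powr r * (x powr r + y powr r)" by (simp add: powr_mult)
    finally show ?thesis using real x by (simp flip: ennreal_plus ennreal_mult add: ennreal_leI)
  qed (simp add: ennreal_mult_top)
  show ?thesis
    using *[of a b] *[of b a] linear[of a b] by (auto simp: add.commute)
qed

lemma Lp_norm_mono_AE:
  assumes "0 < p" "AE x in lebesgue. f x \<le> g x"
  shows "Lp_norm p f \<le> Lp_norm p g"
proof -
  have "AE x in lebesgue. ennreal_powr (f x) p \<le> ennreal_powr (g x) p"
    using assms(2) by (rule eventually_mono) (use assms(1) in \<open>simp add: ennreal_powr_mono\<close>)
  then show ?thesis
    unfolding Lp_norm_def using assms(1) by (intro ennreal_powr_mono nn_integral_mono_AE) auto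
qed

lemma Lp_norm_mono: "0 < p \<Longrightarrow> (\<And>x. f x \<le> g x) \<Longrightarrow> Lp_norm p f \<le> Lp_norm p g"
  by (rule Lp_norm_mono_AE) auto

lemma Lp_norm_cmult:
  assumes "0 < p" and [measurable]: "h \<in> borel_measurable lebesgue"
  shows "Lp_norm p (\<lambda>x. c * h x) = c * Lp_norm p h"
  using assms(1)
  by (simp add: Lp_norm_def ennreal_powr_mult nn_integral_cmult ennreal_powr_powr)

text \<open>A quasi-triangle inequality valid for all p > 0: (a + b)^r \<le> 2^r (a^r + b^r) is used
  with r = p inside the integral, contributing 2 after the root, and with r = 1/p outside.\<close>

lemma Lp_norm_add:
  assumes p: "0 < p" and [measurable]: "f \<in> borel_measurable lebesgue" "g \<in> borel_measurable lebesgue"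
  shows "Lp_norm p (\<lambda>x. f x + g x) \<le> ennreal (2 * 2 powr (1 / p)) * (Lp_norm p f + Lp_norm p g)"
proof -
  let ?F = "\<integral>\<^sup>+ x. ennreal_powr (f x) p \<partial>lebesgue" and ?G = "\<integral>\<^sup>+ x. ennreal_powr (g x) p \<partial>lebesgue"
  have "(\<integral>\<^sup>+ x. ennreal_powr (f x + g x) p \<partial>lebesgue)
      \<le> (\<integral>\<^sup>+ x. ennreal (2 powr p) * (ennreal_powr (f x) p + ennreal_powr (g x) p) \<partial>lebesgue)"
    using p by (intro nn_integral_mono ennreal_powr_add_le) auto
  also have "\<dots> = ennreal (2 powr p) * (?F + ?G)"
    by (subst nn_integral_cmult, measurable, subst nn_integral_add, measurable)
  finally have "Lp_norm p (\<lambda>x. f x + g x) \<le> ennreal_powr (ennreal (2 powr p) * (?F + ?G)) (1 / p)"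
    unfolding Lp_norm_def using p by (intro ennreal_powr_mono) auto
  also have "\<dots> = ennreal 2 * ennreal_powr (?F + ?G) (1 / p)"
    using p by (simp add: ennreal_powr_mult powr_powr)
  also have "\<dots> \<le> ennreal 2 * (ennreal (2 powr (1 / p)) * (Lp_norm p f + Lp_norm p g))"
    unfolding Lp_norm_def using p by (intro mult_left_mono ennreal_powr_add_le) auto
  finally show ?thesis by (simp add: ennreal_mult mult.assoc)
qed

text \<open>The maximal theorem on L^(p/q) for the function g^q, rescaled by the power 1/q. This is
  where q < p is decisive.\<close>

lemma Lp_norm_hl_max:
  assumes q: "0 < q" "q < p"
  shows "\<exists>C>0. \<forall>g::real^'n::finite \<Rightarrow> real. g \<in> borel_measurable lebesgue \<longrightarrow> (\<forall>x. 0 \<le> g x) \<longrightarrow>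
    Lp_norm p (\<lambda>x. ennreal_powr (hl_max (\<lambda>y. ennreal (g y powr q)) x) (1 / q))
      \<le> ennreal C * Lp_norm p (\<lambda>x. ennreal (g x))"
proof -
  have "1 < p / q" using q by simp
  from hl_max_strong_type[OF this, where 'a="real^'n"]
  obtain C where C: "C > 0" "\<And>h::real^'n \<Rightarrow> real. h \<in> borel_measurable lebesgue \<Longrightarrow> (\<forall>x. 0 \<le> h x) \<Longrightarrow>
    (\<integral>\<^sup>+ x. ennreal_powr (hl_max (\<lambda>x. ennreal (h x)) x) (p / q) \<partial>lebesgue)
      \<le> ennreal C * (\<integral>\<^sup>+ x. ennreal (h x powr (p / q)) \<partial>lebesgue)" by blast
  show ?thesis
  proof (intro exI[of _ "C powr (1 / p)"] conjI allI impI)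
    show "C powr (1 / p) > 0" using C by simp
    fix g :: "real^'n \<Rightarrow> real" assume [measurable]: "g \<in> borel_measurable lebesgue" and g0: "\<forall>x. 0 \<le> g x"
    have "Lp_norm p (\<lambda>x. ennreal_powr (hl_max (\<lambda>y. ennreal (g y powr q)) x) (1 / q))
      = ennreal_powr (\<integral>\<^sup>+ x. ennreal_powr (hl_max (\<lambda>y. ennreal (g y powr q)) x) (p / q) \<partial>lebesgue) (1 / p)"
      by (simp add: Lp_norm_def ennreal_powr_powr)
    also have "\<dots> \<le> ennreal_powr (ennreal C * (\<integral>\<^sup>+ x. ennreal ((g x powr q) powr (p / q)) \<partial>lebesgue)) (1 / p)"
      using q by (intro ennreal_powr_mono C(2)) auto
    also have "\<dots> = ennreal (C powr (1 / p)) * Lp_norm p (\<lambda>x. ennreal (g x))"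
      using q C g0 by (simp add: Lp_norm_def powr_powr ennreal_powr_mult)
    finally show "Lp_norm p (\<lambda>x. ennreal_powr (hl_max (\<lambda>y. ennreal (g y powr q)) x) (1 / q))
      \<le> ennreal (C powr (1 / p)) * Lp_norm p (\<lambda>x. ennreal (g x))" .
  qed
qed

text \<open>The oscillation estimates need a positive finite bound A of the maximal function. If the
  latter is 0, A can be taken so small that the bound becomes X/2; if it is infinite, nothing is
  claimed.\<close>

lemma le_ennreal_powrI:
  assumes K: "0 < K" and r: "0 < r" and *: "\<And>A. 0 < A \<Longrightarrow> M \<le> ennreal A \<Longrightarrow> X \<le> K * A powr r"
  shows "ennreal X \<le> ennreal K * ennreal_powr M r"
proof (cases M)
  case (real a)
  show ?thesis
  proof (cases "a = 0")
    case True
    have "X \<le> 0"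
    proof (rule ccontr)
      assume "\<not> X \<le> 0"
      then have X: "X > 0" by simp
      define A where "A = (X / (2 * K)) powr (1 / r)"
      have "A > 0" using X K by (simp add: A_def)
      then have "X \<le> K * A powr r" using * real True by simp
      also have "A powr r = X / (2 * K)" using X K r by (simp add: A_def powr_powr)
      finally show False using X K by simp
    qed
    then show ?thesis by (simp add: ennreal_neg)
  next
    case False
    then have "X \<le> K * a powr r" using * real by simp
    then show ?thesis using real K by (simp add: ennreal_leI flip: ennreal_mult)
  qed
qed (use K in \<open>simp add: ennreal_mult_top\<close>)

text \<open>The index set is uncountable in the applications, so measurability comes from lower
  semicontinuity: superlevel sets are unions of open sets.\<close>

lemma borel_measurable_SUP_continuous:
  fixes f :: "'i \<Rightarrow> 'a::euclidean_space \<Rightarrow> real"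
  assumes "\<And>i. i \<in> I \<Longrightarrow> continuous_on UNIV (f i)"
  shows "(\<lambda>x. SUP i\<in>I. ennreal (f i x)) \<in> borel_measurable lebesgue"
proof (rule measurable_completion)
  have "open {x. a < (SUP i\<in>I. ennreal (f i x))}" for a
  proof -
    have "{x. a < (SUP i\<in>I. ennreal (f i x))} = (\<Union>i\<in>I. {x. a < ennreal (f i x)})"
      by (auto simp: less_SUP_iff)
    moreover have "open {x. a < ennreal (f i x)}" if "i \<in> I" for i
      by (intro open_Collect_less continuous_on_const continuous_on_ennreal assms that)
    ultimately show ?thesis by (auto intro!: open_UN)
  qed
  then have "(\<lambda>x. SUP i\<in>I. ennreal (f i x)) \<in> borel_measurable borel"
    by (intro borel_measurableI_greater) (auto intro!: borel_open)
  then show "(\<lambda>x. SUP i\<in>I. ennreal (f i x)) \<in> borel_measurable lborel" by simp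
qed

section \<open>Convolutions of functions with a Hajlasz gradient\<close>

lemma hajlasz_gradients_iff:
  "g \<in> hajlasz_gradients s p f \<longleftrightarrow> Lp_norm p (\<lambda>x. ennreal (g x)) < \<infinity> \<and> (\<exists>N. hajlasz_gradient s f g N)"
  by (auto simp: hajlasz_gradients_def hajlasz_gradient_def)

lemma dilate_bound:
  fixes \<phi> :: "real ^ 'n::finite \<Rightarrow> complex"
  assumes "\<And>z. cmod (\<phi> z) \<le> B * (1 + norm z) powr - m" "0 < t"
  shows "cmod (dilate t \<phi> z) \<le> B * ((1 + norm z / t) powr - m / t ^ CARD('n))"
proof -
  have "cmod (dilate t \<phi> z) = cmod (\<phi> (z /\<^sub>R t)) / t ^ CARD('n)"
    using assms(2) by (simp add: dilate_def divide_inverse mult.commute)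
  also have "\<dots> \<le> B * (1 + norm (z /\<^sub>R t)) powr - m / t ^ CARD('n)"
    using assms(2) by (intro divide_right_mono assms(1)) simp
  also have "norm (z /\<^sub>R t) = norm z / t" using assms(2) by (simp add: divide_inverse mult.commute)
  finally show ?thesis by simp
qed

text \<open>Dilation and reflection preserve the integral of \<phi>, so subtracting f(z) times it
  leaves the integral of (f(y) - f(z)) times the dilated kernel at x - y. The version for all
  \<open>z\<close> identifies f as a limit of convolutions; the version for some \<open>z\<close>
  bounds convolutions with mean zero functions, for which f(z) drops out.\<close>

lemma hajlasz_conv_estimate:
  assumes s: "0 < s" and m: "real CARD('n::finite) + s < m"
  defines "q \<equiv> real CARD('n) / (real CARD('n) + s)"
  shows "\<exists>C>0. \<forall>(f::real^'n \<Rightarrow> complex) g N (\<phi>::real^'n \<Rightarrow> complex) x t A B. f \<in> borel_measurable lebesgue \<longrightarrow> hajlasz_gradient s f g N \<longrightarrow> is_tempered_fun f \<longrightarrow>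
    \<phi> \<in> schwartz \<longrightarrow> 0 < B \<longrightarrow> (\<forall>z. cmod (\<phi> z) \<le> B * (1 + norm z) powr - m) \<longrightarrow> 0 < t \<longrightarrow> 0 < A \<longrightarrow>
    hl_max (\<lambda>y. ennreal (g y powr q)) x \<le> ennreal A \<longrightarrow>
    (\<forall>z\<in>ball x t - N. cmod (conv (dilate t \<phi>) (regular_dist f) x - f z * (LINT y|lebesgue. \<phi> y))
      \<le> B * C * t powr s * A powr (s / CARD('n)) * (A + g z powr q)) \<and>
    (\<exists>z\<in>ball x t - N. cmod (conv (dilate t \<phi>) (regular_dist f) x - f z * (LINT y|lebesgue. \<phi> y))
      \<le> B * C * t powr s * A powr (1 / q))"
proof -
  have m': "real DIM(real^'n) + s < m" using m by simp
  obtain C where C: "C > 0" and CC: "\<And>(u::real^'n \<Rightarrow> complex) g N x t A. hajlasz_gradient s u g N \<Longrightarrow> 0 < t \<Longrightarrow> 0 < A \<Longrightarrow>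
    hl_max (\<lambda>y. ennreal (g y powr q)) x \<le> ennreal A \<Longrightarrow>
    (\<forall>z\<in>ball x t - N.
      (\<integral>\<^sup>+ y. ennreal ((1 + norm (x - y) / t) powr - m / t ^ CARD('n) * cmod (u y - u z)) \<partial>lebesgue)
      \<le> ennreal (C * t powr s * A powr (s / CARD('n)) * (A + g z powr q))) \<and>
    (\<exists>z\<in>ball x t - N.
      (\<integral>\<^sup>+ y. ennreal ((1 + norm (x - y) / t) powr - m / t ^ CARD('n) * cmod (u y - u z)) \<partial>lebesgue)
      \<le> ennreal (C * t powr s * A powr (1 / q)))"
    using hajlasz_kernel[OF s m'] unfolding q_def by auto
  show ?thesis
  proof (intro exI[of _ C] conjI allI impI)
    show "C > 0" by (rule C)
    fix f :: "real^'n \<Rightarrow> complex" and g N and \<phi> :: "real^'n \<Rightarrow> complex" and x and t A B :: real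
    assume fm: "f \<in> borel_measurable lebesgue" and H: "hajlasz_gradient s f g N" and f: "is_tempered_fun f" and \<phi>: "\<phi> \<in> schwartz" and B: "B > 0"
      and bd: "\<forall>z. cmod (\<phi> z) \<le> B * (1 + norm z) powr - m" and t: "0 < t" and A: "0 < A"
      and M: "hl_max (\<lambda>y. ennreal (g y powr q)) x \<le> ennreal A"
    let ?d = "\<lambda>y. dilate t \<phi> (x - y)"
    have d: "?d \<in> schwartz" by (intro schwartz_reflect dilate_schwartz \<phi> t)
    have i1: "integrable lebesgue (\<lambda>y. f y * ?d y)" using f d by (simp add: is_tempered_fun_def)
    have i2: "integrable lebesgue (\<lambda>y. c * ?d y)" for c using schwartz_integrable[OF d] by auto
    have conv: "conv (dilate t \<phi>) (regular_dist f) x = (LINT y|lebesgue. f y * ?d y)"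
      using d by (simp add: conv_def regular_dist_def)
    have "(LINT y|lebesgue. ?d y) = (LINT y|lebesgue. dilate t \<phi> y)"
      using lebesgue_integral_affine[OF schwartz_borel[OF dilate_schwartz[OF \<phi> t]], of "-1" x] by simp
    then have mean: "(LINT y|lebesgue. ?d y) = (LINT y|lebesgue. \<phi> y)" by (simp add: integral_dilate \<phi> t)
    have main: "cmod (conv (dilate t \<phi>) (regular_dist f) x - f z * (LINT y|lebesgue. \<phi> y)) \<le> B * X"
      if "(\<integral>\<^sup>+ y. ennreal ((1 + norm (x - y) / t) powr - m / t ^ CARD('n) * cmod (f y - f z)) \<partial>lebesgue) \<le> ennreal X" "0 \<le> X"
      for z X
    proof -
      let ?K = "\<lambda>y. (1 + norm (x - y) / t) powr - m / t ^ CARD('n) * cmod (f y - f z)"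
      have "conv (dilate t \<phi>) (regular_dist f) x - f z * (LINT y|lebesgue. \<phi> y)
        = (LINT y|lebesgue. f y * ?d y - f z * ?d y)"
        unfolding conv mean[symmetric] using i1 i2[of "f z"] by simp
      also have "\<dots> = (LINT y|lebesgue. (f y - f z) * ?d y)" by (simp add: left_diff_distrib)
      finally have eq: "conv (dilate t \<phi>) (regular_dist f) x - f z * (LINT y|lebesgue. \<phi> y) = \<dots>" .
      have int: "integrable lebesgue (\<lambda>y. (f y - f z) * ?d y)" using i1 i2[of "f z"] by (simp add: left_diff_distrib)
      have "ennreal (cmod (LINT y|lebesgue. (f y - f z) * ?d y)) \<le> (\<integral>\<^sup>+ y. ennreal (cmod ((f y - f z) * ?d y)) \<partial>lebesgue)"
        by (rule integral_norm_bound_ennreal[OF int])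
      also have "\<dots> \<le> (\<integral>\<^sup>+ y. ennreal B * ennreal (?K y) \<partial>lebesgue)"
      proof (rule nn_integral_mono)
        fix y
        have "cmod ((f y - f z) * ?d y) \<le> cmod (f y - f z) * (B * ((1 + norm (x - y) / t) powr - m / t ^ CARD('n)))"
          unfolding norm_mult using bd t by (intro mult_left_mono dilate_bound) auto
        also have "\<dots> = B * ?K y" by (simp add: mult_ac)
        finally show "ennreal (cmod ((f y - f z) * ?d y)) \<le> ennreal B * ennreal (?K y)"
          using B t by (simp add: ennreal_leI flip: ennreal_mult)
      qed
      also have "\<dots> = ennreal B * (\<integral>\<^sup>+ y. ennreal (?K y) \<partial>lebesgue)"
      proof (rule nn_integral_cmult)
        have "1 + norm (x - y) / t \<noteq> 0" for y
        proof -
          have "0 \<le> norm (x - y) / t" using t by simp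
          then show ?thesis by linarith
        qed
        then have [measurable]: "(\<lambda>y. (1 + norm (x - y) / t) powr - m) \<in> borel_measurable lebesgue"
          using t by (intro borel_measurable_lebesgue_continuous continuous_intros) auto
        show "(\<lambda>y. ennreal (?K y)) \<in> borel_measurable lebesgue" using fm by measurable
      qed
      also have "\<dots> \<le> ennreal B * ennreal X" by (intro mult_left_mono that) simp
      finally show ?thesis unfolding eq using B that(2) by (simp flip: ennreal_mult)
    qed
    show "\<forall>z\<in>ball x t - N. cmod (conv (dilate t \<phi>) (regular_dist f) x - f z * (LINT y|lebesgue. \<phi> y))
      \<le> B * C * t powr s * A powr (s / CARD('n)) * (A + g z powr q)"
    proof
      fix z assume "z \<in> ball x t - N"
      then have "cmod (conv (dilate t \<phi>) (regular_dist f) x - f z * (LINT y|lebesgue. \<phi> y))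
        \<le> B * (C * t powr s * A powr (s / CARD('n)) * (A + g z powr q))"
        using CC[OF H t A M] C A by (intro main) auto
      then show "cmod (conv (dilate t \<phi>) (regular_dist f) x - f z * (LINT y|lebesgue. \<phi> y))
        \<le> B * C * t powr s * A powr (s / CARD('n)) * (A + g z powr q)" by (simp only: mult.assoc)
    qed
    obtain z where z: "z \<in> ball x t - N"
      "(\<integral>\<^sup>+ y. ennreal ((1 + norm (x - y) / t) powr - m / t ^ CARD('n) * cmod (f y - f z)) \<partial>lebesgue)
      \<le> ennreal (C * t powr s * A powr (1 / q))"
      using CC[OF H t A M] by blast
    have "cmod (conv (dilate t \<phi>) (regular_dist f) x - f z * (LINT y|lebesgue. \<phi> y)) \<le> B * (C * t powr s * A powr (1 / q))"
      using C z by (intro main) auto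
    then show "\<exists>z\<in>ball x t - N. cmod (conv (dilate t \<phi>) (regular_dist f) x - f z * (LINT y|lebesgue. \<phi> y))
      \<le> B * C * t powr s * A powr (1 / q)" using z(1) by (auto simp only: mult.assoc)
  qed
qed

section \<open>From the Hajlasz--Sobolev norm to the grand norm\<close>

lemma le_cmult_add_INF:
  fixes F :: "'i \<Rightarrow> ennreal"
  assumes C: "0 < C" and *: "\<And>g. g \<in> S \<Longrightarrow> X \<le> ennreal C * (h + F g)"
  shows "X \<le> ennreal C * (h + (INF g\<in>S. F g))"
proof (cases "(INF g\<in>S. F g) = \<infinity>")
  case True
  then show ?thesis using C by (simp add: ennreal_mult_top)
next
  case False
  show ?thesis
  proof (rule ennreal_le_epsilon)
    fix e :: real assume e: "0 < e"
    have "\<exists>g\<in>S. F g < (INF g\<in>S. F g) + ennreal (e / C)"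
      using e C False by (intro INF_approx_ennreal) auto
    then obtain g where g: "g \<in> S" "F g < (INF g\<in>S. F g) + ennreal (e / C)" by blast
    have "X \<le> ennreal C * (h + F g)" by (rule *[OF g(1)])
    also have "\<dots> \<le> ennreal C * (h + ((INF g\<in>S. F g) + ennreal (e / C)))"
      using g(2) by (intro mult_left_mono add_left_mono) auto
    also have "\<dots> = ennreal C * (h + (INF g\<in>S. F g)) + ennreal C * ennreal (e / C)"
      by (simp add: distrib_left add.assoc)
    also have "ennreal C * ennreal (e / C) = ennreal e" using C e by (simp flip: ennreal_mult)
    finally show "X \<le> ennreal C * (h + (INF g\<in>S. F g)) + ennreal e" .
  qed
qed

text \<open>At scale 2^-k the estimate for mean zero functions yields the factor 2^(-ks), which
  cancels the weight in the second maximal function. The first one, whose test functions have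
  arbitrary mean, is split into a multiple of a local Hardy mollification and a mean zero remainder
  at scale 1.\<close>

lemma grand_TL_le_hajlasz:
  fixes s p m :: real and \<Phi> :: "real ^ 'n::finite \<Rightarrow> complex"
  assumes s: "0 < s" "s \<le> 1" and p: "real CARD('n) / (real CARD('n) + s) < p"
    and m: "real CARD('n) + 1 < m" and \<Phi>: "\<Phi> \<in> schwartz" and \<Phi>0: "(LINT x|lebesgue. \<Phi> x) \<noteq> 0"
  shows "\<exists>C>0. \<forall>f\<in>hajlasz_sobolev \<Phi> s p.
    grand_TL_norm l m s p (regular_dist f) \<le> ennreal C * hajlasz_sobolev_norm \<Phi> s p f"
proof -
  define q where "q = real CARD('n) / (real CARD('n) + s)"
  have q: "0 < q" "q < p" using s p by (auto simp: q_def)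
  have p0: "0 < p" using q by simp
  have ms: "real CARD('n) + s < m" using s m by simp
  obtain C where C: "C > 0" and CC: "\<And>(f::real^'n \<Rightarrow> complex) g N (\<phi>::real^'n \<Rightarrow> complex) x t A B.
    f \<in> borel_measurable lebesgue \<Longrightarrow> hajlasz_gradient s f g N \<Longrightarrow> is_tempered_fun f \<Longrightarrow>
    \<phi> \<in> schwartz \<Longrightarrow> 0 < B \<Longrightarrow> (\<forall>z. cmod (\<phi> z) \<le> B * (1 + norm z) powr - m) \<Longrightarrow> 0 < t \<Longrightarrow> 0 < A \<Longrightarrow>
    hl_max (\<lambda>y. ennreal (g y powr q)) x \<le> ennreal A \<Longrightarrow>
    (\<exists>z\<in>ball x t - N. cmod (conv (dilate t \<phi>) (regular_dist f) x - f z * (LINT y|lebesgue. \<phi> y))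
      \<le> B * C * t powr s * A powr (1 / q))"
    using hajlasz_conv_estimate[OF s(1) ms] unfolding q_def by blast
  have mean0: "ennreal (cmod (conv (dilate t \<phi>) (regular_dist f) x))
      \<le> ennreal (B * C * t powr s) * ennreal_powr (hl_max (\<lambda>y. ennreal (g y powr q)) x) (1 / q)"
    if "f \<in> borel_measurable lebesgue" "hajlasz_gradient s f g N" "is_tempered_fun f"
      "\<phi> \<in> schwartz" "0 < B" "\<forall>z. cmod (\<phi> z) \<le> B * (1 + norm z) powr - m" "0 < t" "(LINT y|lebesgue. \<phi> y) = 0"
    for f g N x t B and \<phi> :: "real^'n \<Rightarrow> complex"
    using CC[OF that(1-7)] that(5,7,8) C q by (intro le_ennreal_powrI) auto
  obtain D where D: "D > 0" "\<And>g::real^'n \<Rightarrow> real. g \<in> borel_measurable lebesgue \<Longrightarrow> (\<forall>x. 0 \<le> g x) \<Longrightarrow>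
    Lp_norm p (\<lambda>x. ennreal_powr (hl_max (\<lambda>y. ennreal (g y powr q)) x) (1 / q))
      \<le> ennreal D * Lp_norm p (\<lambda>x. ennreal (g x))"
    using Lp_norm_hl_max[OF q] by blast
  have dil: "dilate t \<Phi> \<in> schwartz" if "0 < t" for t by (rule dilate_schwartz[OF \<Phi> that])
  define c0 where "c0 = cmod (LINT x|lebesgue. \<Phi> x)"
  have c0: "c0 > 0" using \<Phi>0 by (simp add: c0_def)
  define W where "W = (LINT x|lebesgue. (1 + norm (x::real^'n)) powr - m)"
  have W0: "W \<ge> 0" unfolding W_def by (rule integral_nonneg_AE) simp
  obtain B0 where B0: "0 < B0" "schwartz_bound 0 m (dilate (1/2) \<Phi>) B0"
    by (rule schwartz_boundE[OF dil, of "1/2"]) simp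
  \<comment> \<open>A uniform bound for the coefficient of the subtracted dilate: the integral of a
    test function is at most W, and c0 is the modulus of the integral of \<Phi>.\<close>
  define W' where "W' = W / c0"
  have W': "W' \<ge> 0" using W0 c0 by (simp add: W'_def)
  define B where "B = 1 + W' * B0"
  have B: "B > 0" using W' B0 by (simp add: B_def add_pos_nonneg)
  define K where "K = 2 * 2 powr (1 / p)"
  have K: "K > 0" by (simp add: K_def)
  define E where "E = max (K * W') (K * (B * C) * D + C * D + 1)"
  have E: "E > 0" "K * W' \<le> E" "K * (B * C) * D + C * D \<le> E"
  proof -
    have "0 \<le> K * (B * C) * D + C * D" using K B C D by (intro add_nonneg_nonneg mult_nonneg_nonneg) auto
    then show "E > 0" unfolding E_def by linarith
  qed (auto simp: E_def)
  show ?thesis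
  proof (intro exI[of _ E] conjI ballI)
    show "E > 0" by (rule E)
    fix f assume "f \<in> hajlasz_sobolev \<Phi> s p"
    then have fm: "f \<in> borel_measurable lebesgue" and ft: "is_tempered_fun f"
      by (auto simp: hajlasz_sobolev_def hajlasz_hom_def Lp_loc_def)
    let ?T = "regular_dist f"
    have T: "?T \<in> tempered" using ft by (simp add: is_tempered_fun_def)
    have "grand_TL_norm l m s p ?T \<le> ennreal E * (local_hardy_norm \<Phi> p ?T + Lp_norm p (\<lambda>x. ennreal (g x)))"
      if gg: "g \<in> hajlasz_gradients s p f" for g
    proof -
      obtain N where H: "hajlasz_gradient s f g N" using gg by (auto simp: hajlasz_gradients_iff)
      then have gm[measurable]: "g \<in> borel_measurable lebesgue" and g0: "\<forall>x. 0 \<le> g x"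
        by (auto simp: hajlasz_gradient_def)
      define M where "M x = ennreal_powr (hl_max (\<lambda>y. ennreal (g y powr q)) x) (1 / q)" for x
      have [measurable]: "M \<in> borel_measurable lebesgue" unfolding M_def by measurable
      have MD: "Lp_norm p M \<le> ennreal D * Lp_norm p (\<lambda>x. ennreal (g x))"
        unfolding M_def by (rule D(2)[OF gm g0])
      define h where "h x = (SUP t\<in>{0<..<1::real}. ennreal (cmod (conv (dilate t \<Phi>) ?T x)))" for x
      have [measurable]: "h \<in> borel_measurable lebesgue"
        unfolding h_def by (intro borel_measurable_SUP_continuous continuous_intros conv_continuous T dil) auto
      have hh: "local_hardy_norm \<Phi> p ?T = Lp_norm p h" unfolding local_hardy_norm_def h_def ..
      have part2: "(SUP k\<in>{1::nat..}. ennreal (2 powr (real k * s)) *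
         (SUP \<phi>\<in>test_class l 0 m. ennreal (cmod (conv (dilate (2 powr - real k) \<phi>) ?T x)))) \<le> ennreal C * M x" for x
      proof (rule SUP_least)
        fix k :: nat
        have "(SUP \<phi>\<in>test_class l 0 m. ennreal (cmod (conv (dilate (2 powr - real k) \<phi>) ?T x)))
            \<le> ennreal (1 * C * (2 powr - real k) powr s) * M x"
          unfolding M_def
        proof (intro SUP_least mean0[OF fm H ft])
          fix \<phi> :: "real^'n \<Rightarrow> complex" assume \<phi>: "\<phi> \<in> test_class l 0 m"
          then show \<phi>S: "\<phi> \<in> schwartz" by (simp add: test_class_def schwartz_moments_def)
          have "schwartz_norm (nat (0 + int l + 1)) m \<phi> \<le> ennreal 1" using \<phi> by (simp add: test_class_def)
          then have "schwartz_bound (nat (0 + int l + 1)) m \<phi> 1"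
            by (subst (asm) schwartz_norm_le_iff[OF schwartz_smooth[OF \<phi>S]]) auto
          then show "\<forall>z. cmod (\<phi> z) \<le> 1 * (1 + norm z) powr - m" by (auto dest: schwartz_boundD)
          have "int (mi_order (\<lambda>_::'n. 0)) \<le> 0" by (simp add: mi_order_def)
          then have "(LINT x|lebesgue. of_real (mi_power x (\<lambda>_. 0)) * \<phi> x) = 0"
            using \<phi> unfolding test_class_def schwartz_moments_def by blast
          then show "(LINT y|lebesgue. \<phi> y) = 0" by (simp add: mi_power_def)
        qed auto
        then have "ennreal (2 powr (real k * s)) * (SUP \<phi>\<in>test_class l 0 m. ennreal (cmod (conv (dilate (2 powr - real k) \<phi>) ?T x)))
          \<le> ennreal (2 powr (real k * s)) * (ennreal (1 * C * (2 powr - real k) powr s) * M x)"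
          by (intro mult_left_mono) auto
        also have "\<dots> = ennreal (2 powr (real k * s) * (1 * C * (2 powr - real k) powr s)) * M x"
          using C by (simp add: ennreal_mult mult.assoc)
        also have "2 powr (real k * s) * (1 * C * (2 powr - real k) powr s) = C"
        proof -
          have "(2 powr - real k) powr s = inverse (2 powr (real k * s))"
            by (simp only: powr_powr powr_minus[symmetric] mult_minus_left)
          then show ?thesis by simp
        qed
        finally show "ennreal (2 powr (real k * s)) * (SUP \<phi>\<in>test_class l 0 m. ennreal (cmod (conv (dilate (2 powr - real k) \<phi>) ?T x)))
          \<le> ennreal C * M x" .
      qed
      have part1: "(SUP \<phi>\<in>test_class (l + 1) (-1) m. ennreal (cmod (conv \<phi> ?T x))) \<le> ennreal W' * h x + ennreal (B * C) * M x" for x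
      proof (rule SUP_least)
        fix \<phi> :: "real^'n \<Rightarrow> complex" assume \<phi>: "\<phi> \<in> test_class (l + 1) (-1) m"
        then have \<phi>S: "\<phi> \<in> schwartz" by (simp add: test_class_def schwartz_moments_def)
        have "schwartz_norm (nat (- 1 + int (l + 1) + 1)) m \<phi> \<le> ennreal 1" using \<phi> by (simp add: test_class_def)
        then have "schwartz_bound (nat (- 1 + int (l + 1) + 1)) m \<phi> 1"
          by (subst (asm) schwartz_norm_le_iff[OF schwartz_smooth[OF \<phi>S]]) auto
        then have bd: "cmod (\<phi> z) \<le> (1 + norm z) powr - m" for z by (auto dest: schwartz_boundD[of _ _ _ _ z])
        define c where "c = (LINT y|lebesgue. \<phi> y) / (LINT y|lebesgue. \<Phi> y)"
        have "cmod (LINT y|lebesgue. \<phi> y) \<le> W" unfolding W_def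
          by (rule Bochner_Integration.integral_norm_bound_integral)
            (use bd m in \<open>auto intro!: schwartz_integrable \<phi>S integrable_one_plus_norm\<close>)
        then have cW: "cmod c \<le> W'" using c0 by (simp add: c_def W'_def norm_divide c0_def divide_right_mono)
        let ?\<psi> = "\<lambda>x. \<phi> x - c * dilate (1/2) \<Phi> x"
        have cd: "(\<lambda>x. c * dilate (1/2) \<Phi> x) \<in> schwartz" by (intro schwartz_cmult dil) simp
        have \<psi>S: "?\<psi> \<in> schwartz" by (intro schwartz_diff \<phi>S cd)
        have \<psi>bd: "\<forall>z. cmod (?\<psi> z) \<le> B * (1 + norm z) powr - m"
        proof
          fix z
          have "cmod (?\<psi> z) \<le> cmod (\<phi> z) + cmod c * cmod (dilate (1/2) \<Phi> z)"
            by (metis norm_mult norm_triangle_ineq4)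
          also have "\<dots> \<le> (1 + norm z) powr - m + W' * (B0 * (1 + norm z) powr - m)"
            using W' by (intro add_mono mult_mono bd cW schwartz_boundD[OF B0(2)]) auto
          finally show "cmod (?\<psi> z) \<le> B * (1 + norm z) powr - m" by (simp add: B_def algebra_simps)
        qed
        have "(LINT y|lebesgue. ?\<psi> y) = (LINT y|lebesgue. \<phi> y) - c * (LINT y|lebesgue. dilate (1/2) \<Phi> y)"
          using schwartz_integrable[OF \<phi>S] schwartz_integrable[OF cd] by simp
        also have "\<dots> = 0" using \<Phi>0 \<Phi> by (simp add: integral_dilate c_def)
        finally have \<psi>0: "(LINT y|lebesgue. ?\<psi> y) = 0" .
        have d1: "dilate 1 ?\<psi> = ?\<psi>" by (simp add: dilate_def fun_eq_iff)
        have "conv \<phi> ?T x = c * conv (dilate (1/2) \<Phi>) ?T x + conv ?\<psi> ?T x"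
          using conv_diff[OF T \<phi>S cd, of x] conv_cmult[OF T dil, of "1/2" c x] by simp
        then have "cmod (conv \<phi> ?T x) \<le> cmod (c * conv (dilate (1/2) \<Phi>) ?T x) + cmod (conv ?\<psi> ?T x)"
          by (simp only: norm_triangle_ineq)
        then have "ennreal (cmod (conv \<phi> ?T x)) \<le> ennreal (cmod c * cmod (conv (dilate (1/2) \<Phi>) ?T x) + cmod (conv ?\<psi> ?T x))"
          unfolding norm_mult by (rule ennreal_leI)
        also have "\<dots> = ennreal (cmod c) * ennreal (cmod (conv (dilate (1/2) \<Phi>) ?T x)) + ennreal (cmod (conv ?\<psi> ?T x))"
          by (simp add: ennreal_mult)
        also have "\<dots> \<le> ennreal W' * h x + ennreal (B * C) * M x"
        proof (intro add_mono mult_mono)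
          show "ennreal (cmod (conv (dilate (1/2) \<Phi>) ?T x)) \<le> h x"
            unfolding h_def by (rule SUP_upper) simp
          show "ennreal (cmod (conv ?\<psi> ?T x)) \<le> ennreal (B * C) * M x"
            using mean0[OF fm H ft \<psi>S B \<psi>bd, of 1 x] \<psi>0 by (simp add: d1 M_def)
        qed (use cW in \<open>auto intro: ennreal_leI\<close>)
        finally show "ennreal (cmod (conv \<phi> ?T x)) \<le> ennreal W' * h x + ennreal (B * C) * M x" .
      qed
      have "grand_TL_norm l m s p ?T \<le> Lp_norm p (\<lambda>x. ennreal W' * h x + ennreal (B * C) * M x) + Lp_norm p (\<lambda>x. ennreal C * M x)"
        unfolding grand_TL_norm_def by (intro add_mono Lp_norm_mono p0 part1 part2)
      also have "\<dots> \<le> ennreal K * (ennreal W' * Lp_norm p h + ennreal (B * C) * Lp_norm p M) + ennreal C * Lp_norm p M"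
      proof (intro add_mono)
        have "Lp_norm p (\<lambda>x. ennreal W' * h x + ennreal (B * C) * M x)
            \<le> ennreal K * (Lp_norm p (\<lambda>x. ennreal W' * h x) + Lp_norm p (\<lambda>x. ennreal (B * C) * M x))"
          unfolding K_def by (rule Lp_norm_add[OF p0]) auto
        then show "Lp_norm p (\<lambda>x. ennreal W' * h x + ennreal (B * C) * M x)
            \<le> ennreal K * (ennreal W' * Lp_norm p h + ennreal (B * C) * Lp_norm p M)"
          by (simp add: Lp_norm_cmult[OF p0])
      qed (simp add: Lp_norm_cmult[OF p0])
      also have "\<dots> \<le> ennreal K * (ennreal W' * Lp_norm p h + ennreal (B * C) * (ennreal D * Lp_norm p (\<lambda>x. ennreal (g x))))
          + ennreal C * (ennreal D * Lp_norm p (\<lambda>x. ennreal (g x)))"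
        by (intro add_mono mult_left_mono MD) auto
      also have "\<dots> = ennreal (K * W') * Lp_norm p h + ennreal (K * (B * C) * D + C * D) * Lp_norm p (\<lambda>x. ennreal (g x))"
      proof -
        have "ennreal (K * (B * C) * D + C * D) = ennreal (K * (B * C) * D) + ennreal (C * D)"
          using K B C D by (intro ennreal_plus) auto
        moreover have "ennreal (K * (B * C) * D) = ennreal K * (ennreal (B * C) * ennreal D)"
          using K B C D by (simp flip: ennreal_mult add: mult.assoc)
        moreover have "ennreal (K * W') = ennreal K * ennreal W'" "ennreal (C * D) = ennreal C * ennreal D"
          using K W' C D by (simp_all add: ennreal_mult)
        ultimately show ?thesis by (simp only: distrib_left distrib_right mult.assoc add.assoc)
      qed
      also have "\<dots> \<le> ennreal E * Lp_norm p h + ennreal E * Lp_norm p (\<lambda>x. ennreal (g x))"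
        by (intro add_mono mult_right_mono ennreal_leI E) auto
      finally show ?thesis unfolding hh by (simp add: distrib_left)
    qed
    then show "grand_TL_norm l m s p ?T \<le> ennreal E * hajlasz_sobolev_norm \<Phi> s p f"
      unfolding hajlasz_sobolev_norm_def hajlasz_hom_norm_def by (rule le_cmult_add_INF[OF E(1)])
  qed
qed

section \<open>Mollifications of a distribution in the grand space\<close>

definition TL_max0 :: "nat \<Rightarrow> real \<Rightarrow> ((real ^ 'n::finite \<Rightarrow> complex) \<Rightarrow> complex) \<Rightarrow> real ^ 'n \<Rightarrow> ennreal" where
  "TL_max0 l m T x = (SUP \<phi>\<in>test_class (l + 1) (-1) m. ennreal (cmod (conv \<phi> T x)))"

definition TL_max1 ::
    "nat \<Rightarrow> real \<Rightarrow> real \<Rightarrow> ((real ^ 'n::finite \<Rightarrow> complex) \<Rightarrow> complex) \<Rightarrow> real ^ 'n \<Rightarrow> ennreal" where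
  "TL_max1 l m s T x = (SUP k\<in>{1::nat..}. ennreal (2 powr (real k * s)) *
     (SUP \<phi>\<in>test_class l 0 m. ennreal (cmod (conv (dilate (2 powr - real k) \<phi>) T x))))"

lemma grand_TL_norm_eq:
  "grand_TL_norm l m s p T = Lp_norm p (TL_max0 l m T) + Lp_norm p (TL_max1 l m s T)"
  by (simp add: grand_TL_norm_def TL_max0_def[abs_def] TL_max1_def[abs_def])

lemma test_class_schwartz: "\<phi> \<in> test_class l N m \<Longrightarrow> \<phi> \<in> schwartz"
  by (simp add: test_class_def schwartz_moments_def)

lemma TL_max0_measurable: "T \<in> tempered \<Longrightarrow> TL_max0 l m T \<in> borel_measurable lebesgue"
  unfolding TL_max0_def[abs_def]
  by (intro borel_measurable_SUP_continuous continuous_intros conv_continuous test_class_schwartz)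

lemma TL_max1_measurable: "T \<in> tempered \<Longrightarrow> TL_max1 l m s T \<in> borel_measurable lebesgue"
  unfolding TL_max1_def[abs_def]
  by (intro borel_measurable_SUP borel_measurable_times_ennreal borel_measurable_const
      borel_measurable_SUP_continuous continuous_intros conv_continuous dilate_schwartz test_class_schwartz) auto

lemma dilate_cmult: "dilate t (\<lambda>x. c * \<phi> x) = (\<lambda>x. c * dilate t \<phi> x)"
  by (simp add: dilate_def fun_eq_iff)

text \<open>Dividing by \<open>B\<close> normalises \<phi> to a test function. For N = -1 with l + 1
  and for N = 0 with l the order N + l + 1 is computed from different indices but equals l + 1 both
  times, so one bound of this order serves both maximal functions.\<close>

lemma conv_le_TL_max0:
  assumes T: "T \<in> tempered" and \<phi>: "\<phi> \<in> schwartz" and b: "schwartz_bound (l + 1) m \<phi> B" and B: "0 < B"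
  shows "ennreal (cmod (conv \<phi> T x)) \<le> ennreal B * TL_max0 l m T x"
proof -
  let ?\<psi> = "\<lambda>x. of_real (1 / B) * \<phi> x"
  have \<psi>: "?\<psi> \<in> schwartz" by (rule schwartz_cmult[OF \<phi>])
  have "schwartz_bound (l + 1) m ?\<psi> (cmod (of_real (1 / B)) * B)"
    by (rule schwartz_bound_cmult[OF schwartz_smooth[OF \<phi>] b])
  then have "schwartz_bound (l + 1) m ?\<psi> 1" using B by (simp add: norm_divide)
  then have "schwartz_norm (l + 1) m ?\<psi> \<le> ennreal 1" by (subst schwartz_norm_le_iff[OF schwartz_smooth[OF \<psi>]]) auto
  then have "?\<psi> \<in> test_class (l + 1) (-1) m" using \<psi> by (auto simp: test_class_def schwartz_moments_def nat_add_distrib)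
  then have "ennreal (cmod (conv ?\<psi> T x)) \<le> TL_max0 l m T x" unfolding TL_max0_def by (rule SUP_upper)
  then have "ennreal B * ennreal (cmod (conv ?\<psi> T x)) \<le> ennreal B * TL_max0 l m T x" by (rule mult_left_mono) simp
  moreover have "ennreal B * ennreal (cmod (conv ?\<psi> T x)) = ennreal (cmod (conv \<phi> T x))"
    unfolding conv_cmult[OF T \<phi>] using B by (simp add: norm_mult norm_divide flip: ennreal_mult)
  ultimately show ?thesis by simp
qed

lemma conv_le_TL_max1:
  assumes T: "T \<in> tempered" and \<phi>: "\<phi> \<in> schwartz" and b: "schwartz_bound (l + 1) m \<phi> B" and B: "0 < B"
    and \<phi>0: "(LINT x|lebesgue. \<phi> x) = 0" and k: "1 \<le> k"
  shows "ennreal (cmod (conv (dilate (2 powr - real k) \<phi>) T x)) \<le> ennreal (B * 2 powr - (real k * s)) * TL_max1 l m s T x"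
proof -
  let ?\<psi> = "\<lambda>x. of_real (1 / B) * \<phi> x"
  have \<psi>: "?\<psi> \<in> schwartz" by (rule schwartz_cmult[OF \<phi>])
  have "schwartz_bound (l + 1) m ?\<psi> (cmod (of_real (1 / B)) * B)"
    by (rule schwartz_bound_cmult[OF schwartz_smooth[OF \<phi>] b])
  then have "schwartz_bound (l + 1) m ?\<psi> 1" using B by (simp add: norm_divide)
  then have "schwartz_norm (l + 1) m ?\<psi> \<le> ennreal 1" by (subst schwartz_norm_le_iff[OF schwartz_smooth[OF \<psi>]]) auto
  \<comment> \<open>For N = 0 the only multi-index to be tested is 0, so the moment condition says
    that the integral vanishes.\<close>
  moreover have "(LINT x|lebesgue. of_real (mi_power x \<alpha>) * ?\<psi> x) = 0" if "int (mi_order \<alpha>) \<le> 0" for \<alpha>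
  proof -
    have "mi_order \<alpha> = 0" using that by simp
    then have "\<forall>i. \<alpha> i = 0" by (simp add: mi_order_def)
    then show ?thesis using \<phi>0 by (simp add: mi_power_def)
  qed
  ultimately have "?\<psi> \<in> test_class l 0 m" using \<psi> by (auto simp: test_class_def schwartz_moments_def nat_add_distrib)
  then have "ennreal (cmod (conv (dilate (2 powr - real k) ?\<psi>) T x))
      \<le> (SUP \<phi>\<in>test_class l 0 m. ennreal (cmod (conv (dilate (2 powr - real k) \<phi>) T x)))" by (rule SUP_upper)
  then have "ennreal (2 powr (real k * s)) * ennreal (cmod (conv (dilate (2 powr - real k) ?\<psi>) T x))
      \<le> ennreal (2 powr (real k * s)) * (SUP \<phi>\<in>test_class l 0 m. ennreal (cmod (conv (dilate (2 powr - real k) \<phi>) T x)))"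
    by (rule mult_left_mono) simp
  also have "\<dots> \<le> TL_max1 l m s T x" unfolding TL_max1_def by (rule SUP_upper) (use k in simp)
  finally have "ennreal (B * 2 powr - (real k * s)) * (ennreal (2 powr (real k * s)) * ennreal (cmod (conv (dilate (2 powr - real k) ?\<psi>) T x)))
      \<le> ennreal (B * 2 powr - (real k * s)) * TL_max1 l m s T x" by (rule mult_left_mono) simp
  moreover have "ennreal (B * 2 powr - (real k * s)) * (ennreal (2 powr (real k * s)) * ennreal (cmod (conv (dilate (2 powr - real k) ?\<psi>) T x)))
     = ennreal (cmod (conv (dilate (2 powr - real k) \<phi>) T x))"
  proof -
    define P where "P = 2 powr (real k * s)"
    have "0 < P" by (simp add: P_def)
    have "dilate (2 powr - real k) \<phi> \<in> schwartz" by (rule dilate_schwartz[OF \<phi>]) simp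
    then have "conv (dilate (2 powr - real k) ?\<psi>) T x = of_real (1 / B) * conv (dilate (2 powr - real k) \<phi>) T x"
      unfolding dilate_cmult by (rule conv_cmult[OF T])
    then have e: "cmod (conv (dilate (2 powr - real k) ?\<psi>) T x) = cmod (conv (dilate (2 powr - real k) \<phi>) T x) / B"
      using B by (simp add: norm_mult norm_divide)
    define X where "X = cmod (conv (dilate (2 powr - real k) \<phi>) T x)"
    have "0 \<le> X" by (simp add: X_def)
    have P': "2 powr - (real k * s) = inverse P" by (simp add: P_def powr_minus)
    show ?thesis unfolding e unfolding X_def[symmetric] P' P_def[symmetric]
      using \<open>0 < P\<close> B \<open>0 \<le> X\<close> by (simp flip: ennreal_mult)
  qed
  ultimately show ?thesis by simp
qed

section \<open>Differences of dilates and translates\<close>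

lemma dilate_dilate: "0 < t \<Longrightarrow> 0 < u \<Longrightarrow> dilate (t * u) \<phi> = dilate t (dilate u \<phi>)"
  by (simp add: dilate_def fun_eq_iff power_mult_distrib mult.commute)

lemma dilate_diff: "dilate t (\<lambda>x. \<phi> x - \<psi> x) = (\<lambda>x. dilate t \<phi> x - dilate t \<psi> x)"
  by (simp add: dilate_def fun_eq_iff scaleR_diff_right)

text \<open>A dilate by u in [1/2, 2] is a test function up to a constant. The difference of two
  such dilates has mean zero, and so has the difference of \<Phi> and its translate by z = (y -
  x)/t; the latter is moreover of size |z| in the Schwartz norm. The translation costs one
  derivative more, hence \<open>Suc (l + 1)\<close> in the choice of \<open>C\<close>.\<close>

lemma mollification_estimates:
  fixes \<Phi> :: "real ^ 'n::finite \<Rightarrow> complex"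
  assumes \<Phi>: "\<Phi> \<in> schwartz" and m: "0 \<le> m"
  shows "\<exists>B>0. \<forall>T\<in>tempered. \<forall>x.
    (\<forall>u\<in>{1/2..2}. ennreal (cmod (conv (dilate u \<Phi>) T x)) \<le> ennreal B * TL_max0 l m T x) \<and>
    (\<forall>k\<ge>1. \<forall>u\<in>{1/2..2}. ennreal (cmod (conv (dilate (2 powr - real k * u) \<Phi>) T x - conv (dilate (2 powr - real k) \<Phi>) T x))
      \<le> ennreal (B * 2 powr - (real k * s)) * TL_max1 l m s T x) \<and>
    (\<forall>k\<ge>1. \<forall>y. norm (y - x) \<le> 2 powr - real k \<longrightarrow>
      ennreal (cmod (conv (dilate (2 powr - real k) \<Phi>) T y - conv (dilate (2 powr - real k) \<Phi>) T x))
      \<le> ennreal (B * (2 powr real k * norm (y - x)) * 2 powr - (real k * s)) * TL_max1 l m s T x)"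
proof -
  let ?n = "CARD('n)"
  obtain C where C: "0 < C" "schwartz_bound (Suc (l + 1)) m \<Phi> C" using \<Phi> by (rule schwartz_boundE)
  have C': "schwartz_bound (l + 1) m \<Phi> C" using C(2) by (rule schwartz_bound_mono) auto
  \<comment> \<open>2^n bounds the normalising factor u^-n of the dilate; the rest is the affine
    estimate with M = 2 and no translation.\<close>
  define B1 where "B1 = 2 ^ ?n * (2 ^ (l + 1) * (2 * (1 + norm (0::real^'n))) powr m * C)"
  have B1: "B1 > 0" using C by (simp add: B1_def)
  have dil: "dilate u \<Phi> \<in> schwartz" if "0 < u" for u by (rule dilate_schwartz[OF \<Phi> that])
  have bd1: "schwartz_bound (l + 1) m (dilate u \<Phi>) B1" if u: "u \<in> {1/2..2}" for u
  proof -
    have u0: "0 < u" using u by simp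
    have "schwartz_bound (l + 1) m (\<lambda>x. \<Phi> (inverse u *\<^sub>R x + 0)) (2 ^ (l + 1) * (2 * (1 + norm (0::real^'n))) powr m * C)"
      by (rule schwartz_bound_affine[OF schwartz_smooth[OF \<Phi>] C' m]) (use u in \<open>auto simp: field_simps\<close>)
    then have "schwartz_bound (l + 1) m (\<lambda>x. of_real (inverse (u ^ ?n)) * \<Phi> (inverse u *\<^sub>R x + 0))
        (cmod (of_real (inverse (u ^ ?n))) * (2 ^ (l + 1) * (2 * (1 + norm (0::real^'n))) powr m * C))"
      by (intro schwartz_bound_cmult smooth_affine schwartz_smooth[OF \<Phi>])
    moreover have "dilate u \<Phi> = (\<lambda>x. of_real (inverse (u ^ ?n)) * \<Phi> (inverse u *\<^sub>R x + 0))"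
      by (simp add: dilate_def fun_eq_iff scaleR_conv_of_real)
    moreover have "cmod (of_real (inverse (u ^ ?n))) * (2 ^ (l + 1) * (2 * (1 + norm (0::real^'n))) powr m * C) \<le> B1"
    proof -
      have "inverse u ^ ?n \<le> 2 ^ ?n" using u by (intro power_mono) (auto simp: field_simps)
      then show ?thesis unfolding B1_def using u0 C
        by (intro mult_right_mono) (auto simp: norm_inverse norm_power power_inverse)
    qed
    ultimately show ?thesis by (auto elim: schwartz_bound_mono)
  qed
  define B2 where "B2 = real ?n * C * 2 powr m"
  have B2: "B2 > 0" using C by (simp add: B2_def)
  have bd2: "schwartz_bound (l + 1) m (\<lambda>x. \<Phi> (x + z) - \<Phi> x) (B2 * norm z)" if z: "norm z \<le> 1" for z
  proof -
    have "schwartz_bound (l + 1) m (\<lambda>x. \<Phi> (1 *\<^sub>R x + z) - \<Phi> (1 *\<^sub>R x + 0)) (real ?n * C * (1 + norm z + norm (0::real^'n)) powr m * norm (z - 0))"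
      by (rule schwartz_bound_translate_diff[OF schwartz_smooth[OF \<Phi>] C(2) m]) simp
    then have *: "schwartz_bound (l + 1) m (\<lambda>x. \<Phi> (x + z) - \<Phi> x) (real ?n * C * (1 + norm z) powr m * norm z)" by simp
    have "real ?n * C * (1 + norm z) powr m * norm z \<le> real ?n * C * 2 powr m * norm z"
      using C z m by (intro mult_right_mono mult_left_mono powr_mono2) auto
    with * show ?thesis by (auto simp: B2_def elim: schwartz_bound_mono)
  qed
  define B where "B = max (B1 + B1) B2"
  have B: "B > 0" "B1 \<le> B" "B1 + B1 \<le> B" "B2 \<le> B" using B1 B2 by (auto simp: B_def)
  show ?thesis
  proof (intro exI[of _ B] conjI ballI allI impI)
    show "B > 0" by (rule B)
    fix T :: "(real^'n \<Rightarrow> complex) \<Rightarrow> complex" and x assume T: "T \<in> tempered"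
    { fix u :: real assume u: "u \<in> {1/2..2}"
      have "schwartz_bound (l + 1) m (dilate u \<Phi>) B" using bd1[OF u] B by (auto elim: schwartz_bound_mono)
      then show "ennreal (cmod (conv (dilate u \<Phi>) T x)) \<le> ennreal B * TL_max0 l m T x"
        using u by (intro conv_le_TL_max0 T dil B) auto }
    { fix k :: nat and u :: real assume k: "1 \<le> k" and u: "u \<in> {1/2..2}"
      have u0: "0 < u" using u by simp
      let ?d = "\<lambda>x. dilate u \<Phi> x - \<Phi> x"
      have "dilate 1 \<Phi> = \<Phi>" by (simp add: dilate_def fun_eq_iff)
      then have "schwartz_bound (l + 1) m ?d (B1 + B1)"
        using bd1[OF u] bd1[of 1] schwartz_smooth[OF \<Phi>] schwartz_smooth[OF dil[OF u0]]
        by (intro schwartz_bound_diff) auto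
      then have b: "schwartz_bound (l + 1) m ?d B" using B by (auto elim: schwartz_bound_mono)
      have i: "(LINT x|lebesgue. ?d x) = 0"
        using schwartz_integrable[OF \<Phi>] schwartz_integrable[OF dil[OF u0]] by (simp add: integral_dilate \<Phi> u0)
      have "conv (dilate (2 powr - real k * u) \<Phi>) T x - conv (dilate (2 powr - real k) \<Phi>) T x
        = conv (dilate (2 powr - real k) ?d) T x"
        unfolding dilate_diff using u0
        by (subst dilate_dilate) (auto simp: conv_diff[OF T] dil dilate_schwartz)
      then show "ennreal (cmod (conv (dilate (2 powr - real k * u) \<Phi>) T x - conv (dilate (2 powr - real k) \<Phi>) T x))
        \<le> ennreal (B * 2 powr - (real k * s)) * TL_max1 l m s T x"
        using conv_le_TL_max1[OF T schwartz_diff[OF dil[OF u0] \<Phi>] b B(1) i k, of x s] by simp }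
    { fix k :: nat and y :: "real^'n" assume k: "1 \<le> k" and y: "norm (y - x) \<le> 2 powr - real k"
      define t where "t = 2 powr - real k"
      have t: "t > 0" by (simp add: t_def)
      define z where "z = (y - x) /\<^sub>R t"
      have nz: "norm z = 2 powr real k * norm (y - x)" by (simp add: z_def t_def powr_minus)
      have "2 powr real k * norm (y - x) \<le> 2 powr real k * 2 powr - real k" by (intro mult_left_mono y) simp
      then have z1: "norm z \<le> 1" unfolding nz by (simp add: powr_minus)
      show "ennreal (cmod (conv (dilate (2 powr - real k) \<Phi>) T y - conv (dilate (2 powr - real k) \<Phi>) T x))
        \<le> ennreal (B * (2 powr real k * norm (y - x)) * 2 powr - (real k * s)) * TL_max1 l m s T x"
      \<comment> \<open>For y = x the difference vanishes; otherwise |z| > 0, as normalising by the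
        bound \<open>B * norm z\<close> requires.\<close>
      proof (cases "y = x")
        case False
        let ?d = "\<lambda>v. \<Phi> (v + z) - \<Phi> v"
        have z0: "norm z > 0" using False by (simp add: nz)
        have \<Phi>z: "(\<lambda>v. \<Phi> (v + z)) \<in> schwartz" using schwartz_affine[OF \<Phi>, of 1 z] by simp
        have b: "schwartz_bound (l + 1) m ?d (B * norm z)"
          using bd2[OF z1] B by (auto elim!: schwartz_bound_mono intro!: mult_right_mono)
        have i: "(LINT x|lebesgue. ?d x) = 0"
          using schwartz_integrable[OF \<Phi>] schwartz_integrable[OF \<Phi>z] lebesgue_integral_affine[OF schwartz_borel[OF \<Phi>], of 1 z]
          by (simp add: add.commute)
        have "conv (dilate t \<Phi>) T y = conv (dilate t (\<lambda>v. \<Phi> (v + z))) T x"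
        proof -
          have "(y - w) /\<^sub>R t = (x - w) /\<^sub>R t + z" for w by (simp add: z_def algebra_simps)
          then show ?thesis by (simp add: conv_def dilate_def)
        qed
        then have "conv (dilate t \<Phi>) T y - conv (dilate t \<Phi>) T x = conv (dilate t ?d) T x"
          unfolding dilate_diff by (simp add: conv_diff[OF T] dilate_schwartz \<Phi> \<Phi>z t)
        then have "ennreal (cmod (conv (dilate t \<Phi>) T y - conv (dilate t \<Phi>) T x))
            \<le> ennreal (B * norm z * 2 powr - (real k * s)) * TL_max1 l m s T x"
          using conv_le_TL_max1[OF T schwartz_diff[OF \<Phi>z \<Phi>] b _ i k, of x s] B z0 by (simp add: t_def)
        then show ?thesis by (simp add: nz t_def)
      qed simp }
  qed
qed

lemma geometric_telescope:
  fixes a :: "nat \<Rightarrow> complex"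
  assumes "0 \<le> \<rho>" "\<rho> < 1" "0 \<le> D" and *: "\<And>i. k \<le> i \<Longrightarrow> cmod (a (Suc i) - a i) \<le> D * \<rho> ^ i" and "k \<le> j"
  shows "cmod (a j - a k) \<le> D / (1 - \<rho>) * \<rho> ^ k"
proof -
  have "cmod (a (k + d) - a k) \<le> D / (1 - \<rho>) * (\<rho> ^ k - \<rho> ^ (k + d))" for d
  proof (induction d)
    case (Suc d)
    have "cmod (a (k + Suc d) - a k) \<le> cmod (a (Suc (k + d)) - a (k + d)) + cmod (a (k + d) - a k)"
      by (metis add_Suc_right norm_triangle_ineq diff_add_cancel add_diff_eq)
    also have "\<dots> \<le> D * \<rho> ^ (k + d) + D / (1 - \<rho>) * (\<rho> ^ k - \<rho> ^ (k + d))"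
      using Suc * by (intro add_mono) auto
    also have "D * \<rho> ^ (k + d) = D / (1 - \<rho>) * (\<rho> ^ (k + d) - \<rho> ^ (k + Suc d))"
    proof -
      have "\<rho> ^ (k + d) - \<rho> ^ (k + Suc d) = (1 - \<rho>) * \<rho> ^ (k + d)" by (simp add: algebra_simps)
      then show ?thesis using assms(2) by simp
    qed
    finally show ?case by (simp add: algebra_simps)
  qed simp
  from this[of "j - k"] have "cmod (a j - a k) \<le> D / (1 - \<rho>) * (\<rho> ^ k - \<rho> ^ j)" using assms(5) by simp
  also have "\<dots> \<le> D / (1 - \<rho>) * \<rho> ^ k" using assms by (intro mult_left_mono) auto
  finally show ?thesis .
qed

lemma hajlasz_gradient_limit:
  assumes "\<And>k. hajlasz_gradient s (u k) g N" and "\<And>x. x \<notin> N \<Longrightarrow> (\<lambda>k. u k x) \<longlonglongrightarrow> v x"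
  shows "hajlasz_gradient s v g N"
  unfolding hajlasz_gradient_def
proof (intro conjI ballI)
  fix x y assume xy: "x \<in> - N" "y \<in> - N"
  have "(\<lambda>k. cmod (u k x - u k y)) \<longlonglongrightarrow> cmod (v x - v y)"
    using xy by (intro tendsto_intros assms(2)) auto
  moreover have "cmod (u k x - u k y) \<le> norm (x - y) powr s * (g x + g y)" for k
    using assms(1)[of k] xy unfolding hajlasz_gradient_def by blast
  ultimately show "cmod (v x - v y) \<le> norm (x - y) powr s * (g x + g y)"
    by (intro LIMSEQ_le_const2[of "\<lambda>k. cmod (u k x - u k y)"]) auto
qed (use assms(1)[of 0] in \<open>auto simp: hajlasz_gradient_def\<close>)

text \<open>Consecutive dyadic mollifications differ by a multiple of 2^(-ks) h, which gives the
  Cauchy property. For the Hajlasz inequality at scale 2^-K three ranges of |x - y| are treated: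
  below 2^-K the translation estimate applies directly; up to 1/2 the mollification is first
  replaced at both points by one of scale comparable to |x - y|; beyond 1/2 the size of the
  mollifications suffices. Indices start at \<open>Suc k\<close> because the dyadic estimates are
  for scales at most 1/2.\<close>

lemma TL_mollifications:
  fixes \<Psi> :: "real ^ 'n::finite \<Rightarrow> complex"
  assumes s: "0 < s" "s \<le> 1" and m: "0 \<le> m" and \<Psi>: "\<Psi> \<in> schwartz"
  shows "\<exists>C>0. \<forall>T\<in>tempered. \<forall>N h. N \<in> null_sets lebesgue \<longrightarrow> h \<in> borel_measurable lebesgue \<longrightarrow> (\<forall>x. 0 \<le> h x) \<longrightarrow>
    (\<forall>x\<in>- N. TL_max0 l m T x \<le> ennreal (h x) \<and> TL_max1 l m s T x \<le> ennreal (h x)) \<longrightarrow>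
    (\<forall>x\<in>- N. Cauchy (\<lambda>k. conv (dilate (2 powr - real (Suc k)) \<Psi>) T x)) \<and>
    (\<forall>k. hajlasz_gradient s (conv (dilate (2 powr - real (Suc k)) \<Psi>) T) (\<lambda>x. C * h x) N) \<and>
    (\<forall>k. \<forall>x\<in>- N. cmod (conv (dilate (2 powr - real (Suc k)) \<Psi>) T x) \<le> C * h x) \<and>
    (\<forall>t\<in>{0<..<1}. \<forall>x\<in>- N. cmod (conv (dilate t \<Psi>) T x) \<le> C * h x)"
proof -
  obtain B where B: "B > 0" and BB: "\<And>T x. T \<in> tempered \<Longrightarrow>
    (\<forall>u\<in>{1/2..2}. ennreal (cmod (conv (dilate u \<Psi>) T x)) \<le> ennreal B * TL_max0 l m T x) \<and>
    (\<forall>k\<ge>1. \<forall>u\<in>{1/2..2}. ennreal (cmod (conv (dilate (2 powr - real k * u) \<Psi>) T x - conv (dilate (2 powr - real k) \<Psi>) T x))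
      \<le> ennreal (B * 2 powr - (real k * s)) * TL_max1 l m s T x) \<and>
    (\<forall>k\<ge>1. \<forall>y. norm (y - x) \<le> 2 powr - real k \<longrightarrow>
      ennreal (cmod (conv (dilate (2 powr - real k) \<Psi>) T y - conv (dilate (2 powr - real k) \<Psi>) T x))
      \<le> ennreal (B * (2 powr real k * norm (y - x)) * 2 powr - (real k * s)) * TL_max1 l m s T x)"
    using mollification_estimates[OF \<Psi> m, of l s] by blast
  define \<rho> where "\<rho> = 2 powr - s"
  have \<rho>: "0 < \<rho>" "\<rho> < 1" using s by (simp_all add: \<rho>_def powr_less_one)
  have \<rho>k: "2 powr - (real k * s) = \<rho> ^ k" for k by (simp add: \<rho>_def powr_power mult.commute)
  define B' where "B' = B / (1 - \<rho>)"
  have B': "B' > 0" using B \<rho> by (simp add: B'_def)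
  have s2: "2 powr s \<ge> (1::real)" using s by (simp add: ge_one_powr_ge_zero)
  \<comment> \<open>Large enough for all claims: 2^s comes from comparing 2^-j with |x - y| or |x -
    y| with 1/2, and the factor 2 from passing between dyadic and arbitrary scales.\<close>
  define C where "C = 2 * 2 powr s * (B + B')"
  have BBC: "B + B' \<le> C"
  proof -
    have "1 * (B + B') \<le> (2 * 2 powr s) * (B + B')" using s2 B B' by (intro mult_right_mono) auto
    then show ?thesis by (simp add: C_def)
  qed
  show ?thesis
  proof (intro exI[of _ C] conjI ballI allI impI)
    show C: "C > 0" using B B' by (simp add: C_def)
    fix T :: "(real^'n \<Rightarrow> complex) \<Rightarrow> complex" and N h
    assume T: "T \<in> tempered" and N: "N \<in> null_sets lebesgue" and hm: "h \<in> borel_measurable lebesgue"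
      and h0: "\<forall>x. 0 \<le> h x"
      and F: "\<forall>x\<in>- N. TL_max0 l m T x \<le> ennreal (h x) \<and> TL_max1 l m s T x \<le> ennreal (h x)"
    define f where "f k = conv (dilate (2 powr - real k) \<Psi>) T" for k
    have real_le: "a \<le> b * h x" if "ennreal a \<le> ennreal b * M" "M \<le> ennreal (h x)" "0 \<le> b" for a b x M
    proof -
      have "ennreal a \<le> ennreal b * ennreal (h x)" using that by (meson mult_left_mono order_trans zero_le)
      then show ?thesis using that(3) h0 by (simp flip: ennreal_mult)
    qed
    have e1: "cmod (conv (dilate u \<Psi>) T x) \<le> B * h x" if "u \<in> {1/2..2}" "x \<notin> N" for u x
      using BB[OF T] F that B by (intro real_le[of _ B "TL_max0 l m T x"]) auto
    have e2: "cmod (conv (dilate (2 powr - real k * u) \<Psi>) T x - f k x) \<le> B * \<rho> ^ k * h x"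
      if "u \<in> {1/2..2}" "x \<notin> N" "1 \<le> k" for u x k
      unfolding f_def using BB[OF T, of x] F that B \<rho> by (intro real_le[of _ _ "TL_max1 l m s T x"]) (auto simp: \<rho>k)
    have e3: "cmod (f k y - f k x) \<le> B * norm (y - x) powr s * h x"
      if "norm (y - x) \<le> 2 powr - real k" "x \<notin> N" "1 \<le> k" for x y k
    proof (cases "y = x")
      case False
      define v where "v = 2 powr real k * norm (y - x)"
      have "v \<le> 2 powr real k * 2 powr - real k" unfolding v_def by (intro mult_left_mono that) simp
      then have v: "0 < v" "v \<le> 1" using False by (auto simp: v_def powr_minus)
      have "cmod (f k y - f k x) \<le> B * v * \<rho> ^ k * h x"
        unfolding f_def v_def using BB[OF T, of x] F that B \<rho>
        by (intro real_le[of _ _ "TL_max1 l m s T x"]) (auto simp: \<rho>k)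
      also have "\<dots> \<le> B * v powr s * \<rho> ^ k * h x"
      proof -
        \<comment> \<open>As v \<le> 1 and s \<le> 1, the Lipschitz bound within one scale is
          stronger than the required Hoelder bound.\<close>
        have "v powr 1 \<le> v powr s" using v s by (intro powr_mono') auto
        then show ?thesis using v B \<rho> h0 by (intro mult_right_mono mult_left_mono) auto
      qed
      also have "\<dots> = B * (v powr s * \<rho> ^ k) * h x" by (simp only: mult.assoc)
      also have "v powr s * \<rho> ^ k = norm (y - x) powr s"
        unfolding v_def \<rho>k[symmetric] by (simp add: powr_mult powr_powr powr_minus)
      finally show ?thesis by (simp add: mult.assoc)
    qed simp
    have step: "cmod (f (Suc k) x - f k x) \<le> (B * h x) * \<rho> ^ k" if "x \<notin> N" "1 \<le> k" for x k
    proof -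
      have "2 powr - real k * (1/2) = (2::real) powr - real (Suc k)" by (simp add: powr_diff powr_minus field_simps)
      then show ?thesis using e2[of "1/2" x k] that by (simp add: f_def mult_ac)
    qed
    have tele: "cmod (f j x - f k x) \<le> B' * h x * \<rho> ^ k" if "x \<notin> N" "1 \<le> k" "k \<le> j" for x j k
      using geometric_telescope[of \<rho> "B * h x" k "\<lambda>k. f k x" j] step that \<rho> B h0 by (auto simp: B'_def)
    have bound: "cmod (f k x) \<le> (B + B') * h x" if "x \<notin> N" "1 \<le> k" for x k
    proof -
      \<comment> \<open>Scale 1/2 is covered by the first maximal function; every smaller dyadic
        scale is reached from it by telescoping.\<close>
      have "(2::real) powr - real 1 = 1/2" by (simp add: powr_minus)
      then have "cmod (f 1 x) \<le> B * h x" using e1[of "1/2" x] that by (simp add: f_def)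
      moreover have "cmod (f k x - f 1 x) \<le> B' * h x * 1"
      proof (rule order_trans)
        show "cmod (f k x - f 1 x) \<le> B' * h x * \<rho> ^ 1" using that by (intro tele) auto
        show "B' * h x * \<rho> ^ 1 \<le> B' * h x * 1" using \<rho> B' h0 by (intro mult_left_mono) auto
      qed
      ultimately show ?thesis
        using norm_triangle_ineq[of "f 1 x" "f k x - f 1 x"] by (simp add: distrib_right)
    qed
    have boundC: "cmod (f k x) \<le> C * h x" if "x \<notin> N" "1 \<le> k" for x k
      using bound[OF that] BBC h0 by (meson mult_right_mono order_trans)
    { fix x assume x: "x \<in> - N"
      show "Cauchy (\<lambda>k. conv (dilate (2 powr - real (Suc k)) \<Psi>) T x)"
      proof (rule metric_CauchyI)
        fix e :: real assume e: "e > 0"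
        have "(\<lambda>k. B' * h x * \<rho> ^ k) \<longlonglongrightarrow> B' * h x * 0"
          using \<rho> by (intro tendsto_intros LIMSEQ_realpow_zero) auto
        then have "\<forall>\<^sub>F k in sequentially. B' * h x * \<rho> ^ k < e / 2" using e by (intro order_tendstoD) auto
        then obtain K where K: "\<And>k. k \<ge> K \<Longrightarrow> B' * h x * \<rho> ^ k < e / 2" by (auto simp: eventually_sequentially)
        have "dist (f (Suc i) x) (f (Suc j) x) < e" if "K \<le> i" "K \<le> j" for i j
        proof -
          have "cmod (f (Suc i) x - f (Suc K) x) < e / 2" "cmod (f (Suc j) x - f (Suc K) x) < e / 2"
            using tele[of x "Suc K" "Suc i"] tele[of x "Suc K" "Suc j"] K[of "Suc K"] x that by auto
          then show ?thesis using dist_triangle_half_l[of "f (Suc i) x" "f (Suc K) x" e "f (Suc j) x"]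
            by (simp add: dist_norm)
        qed
        then show "\<exists>M. \<forall>i\<ge>M. \<forall>j\<ge>M. dist (conv (dilate (2 powr - real (Suc i)) \<Psi>) T x) (conv (dilate (2 powr - real (Suc j)) \<Psi>) T x) < e"
          unfolding f_def by blast
      qed }
    { fix k
      show "hajlasz_gradient s (conv (dilate (2 powr - real (Suc k)) \<Psi>) T) (\<lambda>x. C * h x) N"
        unfolding hajlasz_gradient_def f_def[symmetric]
      proof (intro conjI N ballI allI)
        show "(\<lambda>x. C * h x) \<in> borel_measurable lebesgue" using hm by measurable
        show "0 \<le> C * h x" for x using C h0 by simp
        fix x y assume xy: "x \<in> - N" "y \<in> - N"
        let ?r = "norm (x - y)"
        define K where "K = Suc k"
        have K: "1 \<le> K" by (simp add: K_def)
        have hxy: "0 \<le> h x" "0 \<le> h y" using h0 by auto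
        have near: "cmod (f j x - f j y) \<le> B * ?r powr s * (h x + h y)" if "?r \<le> 2 powr - real j" "1 \<le> j" for j
        proof -
          have "cmod (f j x - f j y) \<le> B * ?r powr s * h y" using e3[of x y j] that xy by simp
          also have "\<dots> \<le> B * ?r powr s * (h x + h y)" using B hxy by (intro mult_left_mono) auto
          finally show ?thesis .
        qed
        have BC: "B \<le> C" using BBC B' by simp
        have "cmod (f K x - f K y) \<le> C * ?r powr s * (h x + h y)"
        proof (cases "?r \<le> 2 powr - real K")
          case True
          have "cmod (f K x - f K y) \<le> B * ?r powr s * (h x + h y)" by (rule near[OF True K])
          also have "\<dots> \<le> C * ?r powr s * (h x + h y)" using BC hxy by (intro mult_right_mono) auto
          finally show ?thesis .
        next
          case False
          have "0 < (2::real) powr - real K" by simp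
          then have r0: "?r > 0" using False by linarith
          show ?thesis
          proof (cases "?r \<le> 1/2")
            case True
            \<comment> \<open>The finest scale with |x - y| \<le> 2^-j, so that 2^-j < 2 |x - y|.
              Since |x - y| \<le> 1/2 it is at least 1, and since |x - y| > 2^-K it is at most
              K.\<close>
            define j where "j = nat \<lfloor>- log 2 ?r\<rfloor>"
            have "log 2 ?r \<le> -1" using True r0 by (simp add: log_le_iff powr_minus)
            then have j: "real j \<le> - log 2 ?r" "- log 2 ?r < real j + 1" "1 \<le> j"
              unfolding j_def by linarith+
            have rj: "?r \<le> 2 powr - real j" using j(1) r0 by (simp flip: log_le_iff)
            have "- (real j + 1) < log 2 ?r" using j(2) by linarith
            then have "2 powr - (real j + 1) < ?r" using r0 by (simp add: less_log_iff)
            then have "2 powr - real j \<le> 2 * ?r" by (simp add: powr_diff powr_minus field_simps)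
            then have "(2 powr - real j) powr s \<le> (2 * ?r) powr s" using s by (intro powr_mono2) auto
            then have \<rho>j: "\<rho> ^ j \<le> 2 powr s * ?r powr s" by (simp add: powr_powr powr_mult flip: \<rho>k)
            have "j \<le> K"
            proof (rule ccontr)
              assume "\<not> j \<le> K"
              then have "(2::real) powr - real j \<le> 2 powr - real K" by (intro powr_mono) auto
              with rj False show False by linarith
            qed
            have far: "cmod (f K z - f j z) \<le> B' * 2 powr s * ?r powr s * h z" if "z \<notin> N" for z
            proof -
              have "cmod (f K z - f j z) \<le> B' * h z * \<rho> ^ j" using tele that j \<open>j \<le> K\<close> by blast
              also have "\<dots> \<le> B' * h z * (2 powr s * ?r powr s)" using \<rho>j B' h0 by (intro mult_left_mono) auto
              finally show ?thesis by (simp add: mult_ac)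
            qed
            have "f K x - f K y = (f j x - f j y) + (f K x - f j x) - (f K y - f j y)" by simp
            then have "cmod (f K x - f K y) \<le> cmod (f j x - f j y) + cmod (f K x - f j x) + cmod (f K y - f j y)"
              by (metis norm_triangle_ineq norm_triangle_ineq4 add_right_mono order_trans)
            also have "\<dots> \<le> B * ?r powr s * (h x + h y) + B' * 2 powr s * ?r powr s * h x + B' * 2 powr s * ?r powr s * h y"
              using xy by (intro add_mono near rj j far) auto
            also have "\<dots> = (B + B' * 2 powr s) * (?r powr s * (h x + h y))" by (simp add: algebra_simps)
            also have "\<dots> \<le> C * (?r powr s * (h x + h y))"
            proof (intro mult_right_mono)
              have "B * 1 \<le> B * (2 * 2 powr s)" "B' * 2 powr s \<le> B' * (2 * 2 powr s)" using s2 B B' by (auto intro!: mult_left_mono)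
              then show "B + B' * 2 powr s \<le> C" by (simp add: C_def algebra_simps)
            qed (use hxy in auto)
            finally show ?thesis by (simp add: mult.assoc)
          next
            case far: False
            have "(1/2) powr s \<le> ?r powr s" using far s by (intro powr_mono2) auto
            then have one: "1 \<le> 2 powr s * ?r powr s" using s2 by (simp add: powr_divide field_simps)
            have "cmod (f K x - f K y) \<le> (B + B') * h x + (B + B') * h y"
              using bound[of x K] bound[of y K] xy K norm_triangle_ineq4[of "f K x" "f K y"] by auto
            also have "\<dots> = 1 * ((B + B') * (h x + h y))" by (simp add: algebra_simps)
            also have "\<dots> \<le> (2 powr s * ?r powr s) * ((B + B') * (h x + h y))"
              using one B B' hxy by (intro mult_right_mono) auto
            also have "\<dots> \<le> 2 * ((2 powr s * ?r powr s) * ((B + B') * (h x + h y)))"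
              using B B' hxy by simp
            also have "\<dots> = C * ?r powr s * (h x + h y)" by (simp add: C_def mult_ac)
            finally show ?thesis .
          qed
        qed
        then show "cmod (f (Suc k) x - f (Suc k) y) \<le> ?r powr s * (C * h x + C * h y)"
          by (simp add: K_def algebra_simps)
      qed }
    { fix k x assume "x \<in> - N"
      then show "cmod (conv (dilate (2 powr - real (Suc k)) \<Psi>) T x) \<le> C * h x"
        using boundC[of x "Suc k"] by (simp add: f_def) }
    { fix t :: real and x assume t: "t \<in> {0<..<1}" and x: "x \<in> - N"
      \<comment> \<open>Then t = 2^-k u with u between 1/2 and 1. For k = 0 the first maximal
        function applies directly, for larger k the comparison of u with 1 at scale 2^-k.\<close>
      define k where "k = nat \<lfloor>- log 2 t\<rfloor>"
      have "log 2 t < 0" using t by simp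
      then have k: "real k \<le> - log 2 t" "- log 2 t < real k + 1" unfolding k_def by linarith+
      define u where "u = 2 powr real k * t"
      have tu: "t = 2 powr - real k * u" by (simp add: u_def powr_minus)
      have "u = 2 powr (real k + log 2 t)" using t by (simp add: u_def powr_add)
      moreover have "(2::real) powr -1 \<le> 2 powr (real k + log 2 t)" "2 powr (real k + log 2 t) \<le> (2::real) powr 0"
        using k by (intro powr_mono; simp)+
      ultimately have u: "u \<in> {1/2..2}" by (simp add: powr_minus)
      have "cmod (conv (dilate t \<Psi>) T x) \<le> 2 * ((B + B') * h x)"
      proof (cases "k = 0")
        case True
        then have "cmod (conv (dilate t \<Psi>) T x) \<le> B * h x" using e1[OF u] x tu by simp
        also have "\<dots> \<le> 2 * ((B + B') * h x)" using B B' h0 by (auto simp: algebra_simps intro: add_increasing2)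
        finally show ?thesis .
      next
        case False
        then have k1: "1 \<le> k" by simp
        have "cmod (conv (dilate t \<Psi>) T x - f k x) \<le> B * \<rho> ^ k * h x"
          unfolding tu using e2[OF u _ k1] x by simp
        also have "\<dots> \<le> B * 1 * h x" using B \<rho> h0 by (intro mult_right_mono mult_left_mono power_le_one) auto
        also have "\<dots> \<le> (B + B') * h x" using B' h0 by (simp add: mult_right_mono)
        finally have "cmod (conv (dilate t \<Psi>) T x) \<le> (B + B') * h x + cmod (f k x)"
          using norm_triangle_ineq[of "conv (dilate t \<Psi>) T x - f k x" "f k x"] by simp
        also have "cmod (f k x) \<le> (B + B') * h x" using bound x k1 by blast
        finally show ?thesis by (simp only: mult_2)
      qed
      also have "\<dots> \<le> 2 powr s * (2 * ((B + B') * h x))"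
        using s2 B B' h0 mult_right_mono[of 1 "2 powr s" "2 * ((B + B') * h x)"] by simp
      also have "\<dots> = C * h x" unfolding C_def by (simp only: mult_ac)
      finally show "cmod (conv (dilate t \<Psi>) T x) \<le> C * h x" . }
  qed
qed

section \<open>The function represented by a distribution in the grand space\<close>

lemma Lp_norm_finite_AE:
  assumes p: "0 < p" and [measurable]: "h \<in> borel_measurable lebesgue" and fin: "Lp_norm p h < \<infinity>"
  shows "(\<integral>\<^sup>+ x. ennreal_powr (h x) p \<partial>lebesgue) < \<infinity>" and "AE x in lebesgue. h x \<noteq> \<infinity>"
proof -
  show *: "(\<integral>\<^sup>+ x. ennreal_powr (h x) p \<partial>lebesgue) < \<infinity>"
    using fin unfolding Lp_norm_def by (cases "\<integral>\<^sup>+ x. ennreal_powr (h x) p \<partial>lebesgue") auto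
  have "AE x in lebesgue. ennreal_powr (h x) p \<noteq> \<infinity>"
    by (rule nn_integral_noteq_infinite) (use * in auto)
  then show "AE x in lebesgue. h x \<noteq> \<infinity>" by (rule eventually_mono) auto
qed

lemma ex_not_in_null_set:
  assumes "AE x in (lebesgue :: 'a::euclidean_space measure). P x"
  shows "\<exists>x. P x"
proof (rule ccontr)
  assume "\<not> ?thesis"
  then have "AE x in (lebesgue :: 'a measure). False" using assms by simp
  then show False by (simp add: eventually_False ae_filter_eq_bot_iff)
qed

text \<open>Supplies base points at which the oscillation estimate can be used, although g^q itself
  is controlled only through its norm in L^(p/q).\<close>

lemma hl_max_finite_AE:
  fixes g :: "real ^ 'n::finite \<Rightarrow> real"
  assumes q: "0 < q" "q < p" and gm: "g \<in> borel_measurable lebesgue" and g0: "\<forall>x. 0 \<le> g x"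
    and fin: "Lp_norm p (\<lambda>x. ennreal (g x)) < \<infinity>"
  shows "AE x in lebesgue. hl_max (\<lambda>y. ennreal (g y powr q)) x \<noteq> \<infinity>"
proof -
  obtain D where "Lp_norm p (\<lambda>x. ennreal_powr (hl_max (\<lambda>y. ennreal (g y powr q)) x) (1 / q))
      \<le> ennreal D * Lp_norm p (\<lambda>x. ennreal (g x))"
    using Lp_norm_hl_max[OF q] gm g0 by blast
  also have "\<dots> < \<infinity>" using fin by (simp add: ennreal_mult_less_top)
  finally have "Lp_norm p (\<lambda>x. ennreal_powr (hl_max (\<lambda>y. ennreal (g y powr q)) x) (1 / q)) < \<infinity>" .
  then have "AE x in lebesgue. ennreal_powr (hl_max (\<lambda>y. ennreal (g y powr q)) x) (1 / q) \<noteq> \<infinity>"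
    using q by (intro Lp_norm_finite_AE(2)[of p]) auto
  then show ?thesis by (rule eventually_mono) auto
qed

text \<open>The oscillation estimate around a point \<open>x0\<close> with finite maximal function
  bounds |u(y) - u(x0)| for all y outside \<open>N\<close>. Since \<open>K\<close> depends on
  \<open>g\<close>, \<open>N\<close> and the exponents but not on \<open>u\<close>, it dominates all
  functions with this common gradient at once; \<open>u\<close> enters only through |u(x0)|.
  Integrability of \<open>K\<close> is the kernel estimate for 1 and for g^q.\<close>

lemma hajlasz_domination:
  fixes g :: "real ^ 'n::finite \<Rightarrow> real" and N :: "(real ^ 'n) set"
  assumes s: "0 < s" and m: "real CARD('n) + s < m" and p: "real CARD('n) / (real CARD('n) + s) < p"
    and N: "N \<in> null_sets lebesgue" and gm: "g \<in> borel_measurable lebesgue" and g0: "\<forall>x. 0 \<le> g x"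
    and fin: "Lp_norm p (\<lambda>x. ennreal (g x)) < \<infinity>"
  obtains K x0 where "x0 \<notin> N" "integrable lebesgue K" "\<And>y. 0 \<le> K y"
    "\<And>u \<phi> b y. hajlasz_gradient s u g N \<Longrightarrow> (\<And>y. cmod (\<phi> y) \<le> b * (1 + norm y) powr - m) \<Longrightarrow> y \<notin> N \<Longrightarrow>
      cmod (u y * \<phi> y) \<le> b * (cmod (u x0) + 1) * K y"
proof -
  let ?n = "real CARD('n)"
  define q where "q = ?n / (?n + s)"
  have q: "0 < q" "q < p" using s p by (auto simp: q_def)
  have [measurable]: "g \<in> borel_measurable lebesgue" by (rule gm)
  have "AE x in lebesgue. x \<notin> N" using N by (rule AE_not_in)
  then have "AE x in lebesgue. x \<notin> N \<and> hl_max (\<lambda>y. ennreal (g y powr q)) x \<noteq> \<infinity>"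
    using hl_max_finite_AE[OF q gm g0 fin] by auto
  then obtain x0 where x0: "x0 \<notin> N" "hl_max (\<lambda>y. ennreal (g y powr q)) x0 \<noteq> \<infinity>"
    using ex_not_in_null_set by blast
  \<comment> \<open>The summand 1 makes the bound positive, as the oscillation estimate
    requires.\<close>
  define A where "A = enn2real (hl_max (\<lambda>y. ennreal (g y powr q)) x0) + 1"
  have A: "0 < A" "hl_max (\<lambda>y. ennreal (g y powr q)) x0 \<le> ennreal A"
  proof -
    show "0 < A" by (simp add: A_def add_nonneg_pos)
    have "hl_max (\<lambda>y. ennreal (g y powr q)) x0 = ennreal (enn2real (hl_max (\<lambda>y. ennreal (g y powr q)) x0))"
      using x0(2) by (simp add: less_top)
    also have "\<dots> \<le> ennreal A" by (intro ennreal_leI) (simp add: A_def)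
    finally show "hl_max (\<lambda>y. ennreal (g y powr q)) x0 \<le> ennreal A" .
  qed
  obtain C where C: "C > 0" "\<And>(u::real^'n \<Rightarrow> complex) g N x t A y z. hajlasz_gradient s u g N \<Longrightarrow> 0 < t \<Longrightarrow> 0 < A \<Longrightarrow>
    hl_max (\<lambda>y. ennreal (g y powr q)) x \<le> ennreal A \<Longrightarrow> y \<notin> N \<Longrightarrow> z \<in> ball x t - N \<Longrightarrow>
    cmod (u y - u z) \<le> C * (t + norm (x - y)) powr s * A powr (s / ?n) * (A + g y powr q + g z powr q)"
    using hajlasz_oscillation[OF s, where 'a="real^'n"] unfolding q_def by auto
  define Q where "Q = C * A powr (s / ?n) * (A + 1 + g x0 powr q)"
  have Q: "0 \<le> Q" using C A by (simp add: Q_def)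
  \<comment> \<open>The first factor moves the weight of \<phi> from the origin to
    \<open>x0\<close>; 1 + Q absorbs the oscillation constant together with the summand
    |u(x0)|.\<close>
  define R where "R = (1 + norm x0) powr m * (1 + Q)"
  have R: "0 \<le> R" using Q by (simp add: R_def)
  define K where "K y = R * ((1 + norm (x0 - y)) powr - (m - s) * (1 + g y powr q))" for y
  have K0: "0 \<le> K y" for y using R by (simp add: K_def)
  have wm: "(\<lambda>y. (1 + norm (x0 - y)) powr a) \<in> borel_measurable lebesgue" for a
    by (intro borel_measurable_lebesgue_continuous continuous_intros) (auto simp: add_nonneg_eq_0_iff)
  have "integrable lebesgue (\<lambda>y. (1 + norm (x0 - y)) powr - (m - s) * (1 + g y powr q))"
  proof (rule integrableI_nonneg)
    show "(\<lambda>y. (1 + norm (x0 - y)) powr - (m - s) * (1 + g y powr q)) \<in> borel_measurable lebesgue"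
      using wm by measurable
    have "real DIM(real^'n) < m - s" using m by simp
    from hl_max_kernel[OF this] obtain D where D0: "\<forall>(h::real^'n \<Rightarrow> ennreal) x t. h \<in> borel_measurable lebesgue \<longrightarrow> 0 < t \<longrightarrow>
      (\<integral>\<^sup>+ y. ennreal ((1 + norm (x - y) / t) powr - (m - s) / t ^ DIM(real^'n)) * h y \<partial>lebesgue) \<le> ennreal D * hl_max h x"
      by blast
    have D: "(\<integral>\<^sup>+ y. ennreal ((1 + norm (x0 - y)) powr - (m - s)) * h y \<partial>lebesgue) \<le> ennreal D * hl_max h x0"
      if "h \<in> borel_measurable lebesgue" for h :: "real^'n \<Rightarrow> ennreal"
      using D0[rule_format, OF that, of 1 x0] by simp
    have "(\<integral>\<^sup>+ y. ennreal ((1 + norm (x0 - y)) powr - (m - s) * (1 + g y powr q)) \<partial>lebesgue)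
      = (\<integral>\<^sup>+ y. ennreal ((1 + norm (x0 - y)) powr - (m - s)) * ennreal 1
          + ennreal ((1 + norm (x0 - y)) powr - (m - s)) * ennreal (g y powr q) \<partial>lebesgue)"
      by (intro nn_integral_cong) (simp add: distrib_left flip: ennreal_mult)
    also have "\<dots> = (\<integral>\<^sup>+ y. ennreal ((1 + norm (x0 - y)) powr - (m - s)) * ennreal 1 \<partial>lebesgue)
          + (\<integral>\<^sup>+ y. ennreal ((1 + norm (x0 - y)) powr - (m - s)) * ennreal (g y powr q) \<partial>lebesgue)"
      using wm by (subst nn_integral_add) auto
    also have "\<dots> \<le> ennreal D * hl_max (\<lambda>_. ennreal 1) x0 + ennreal D * hl_max (\<lambda>y. ennreal (g y powr q)) x0"
      by (intro add_mono D) auto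
    also have "\<dots> \<le> ennreal D * (ennreal (unit_ball_vol DIM(real^'n)) * ennreal 1) + ennreal D * ennreal A"
      by (intro add_mono mult_left_mono hl_max_const A) auto
    also have "\<dots> < \<infinity>" by (simp add: ennreal_mult_less_top)
    finally show "(\<integral>\<^sup>+ y. ennreal ((1 + norm (x0 - y)) powr - (m - s) * (1 + g y powr q)) \<partial>lebesgue) < \<infinity>" .
  qed auto
  then have Kint: "integrable lebesgue K" unfolding K_def[abs_def] by (rule integrable_mult_right)
  show thesis
  proof (rule that[OF x0(1) Kint K0])
    fix u \<phi> :: "real^'n \<Rightarrow> complex" and b y
    assume u: "hajlasz_gradient s u g N" and \<phi>: "\<And>y. cmod (\<phi> y) \<le> b * (1 + norm y) powr - m" and y: "y \<notin> N"
    have b: "0 \<le> b" using order_trans[OF norm_ge_zero \<phi>, of 0] by simp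
    let ?v = "1 + norm (x0 - y)"
    have v: "?v \<ge> 1" by simp
    have vs: "1 \<le> ?v powr s" using v s by (intro ge_one_powr_ge_zero) auto
    have "cmod (u y - u x0) \<le> C * ?v powr s * A powr (s / ?n) * (A + g y powr q + g x0 powr q)"
      using x0 by (intro C(2)[OF u _ A y]) auto
    also have "\<dots> \<le> C * ?v powr s * A powr (s / ?n) * ((A + 1 + g x0 powr q) * (1 + g y powr q))"
    proof (intro mult_left_mono)
      have "0 \<le> A * g y powr q" "0 \<le> g x0 powr q * g y powr q" using A by auto
      then show "A + g y powr q + g x0 powr q \<le> (A + 1 + g x0 powr q) * (1 + g y powr q)"
        unfolding ring_distribs by simp
    qed (use C in auto)
    also have "\<dots> = ?v powr s * (1 + g y powr q) * Q" by (simp add: Q_def mult_ac)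
    finally have d: "cmod (u y - u x0) \<le> ?v powr s * (1 + g y powr q) * Q" .
    \<comment> \<open>This product is at least 1, so it may also be put in front of |u(x0)|; both
      summands then share the factor that occurs in \<open>K\<close>.\<close>
    have w: "1 \<le> ?v powr s * (1 + g y powr q)" using mult_mono[OF vs, of 1 "1 + g y powr q"] by simp
    have "cmod (u y) \<le> cmod (u x0) + ?v powr s * (1 + g y powr q) * Q"
      using norm_triangle_ineq[of "u x0" "u y - u x0"] d by simp
    also have "\<dots> \<le> (?v powr s * (1 + g y powr q)) * cmod (u x0) + ?v powr s * (1 + g y powr q) * Q"
      using mult_right_mono[OF w, of "cmod (u x0)"] by simp
    also have "\<dots> = (?v powr s * (1 + g y powr q)) * (cmod (u x0) + Q)" by (simp add: distrib_left)
    also have "\<dots> \<le> (?v powr s * (1 + g y powr q)) * ((cmod (u x0) + 1) * (1 + Q))"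
      using Q w by (intro mult_left_mono) (auto simp: algebra_simps)
    finally have uy: "cmod (u y) \<le> (?v powr s * (1 + g y powr q)) * ((cmod (u x0) + 1) * (1 + Q))" .
    have "cmod (\<phi> y) \<le> b * ((1 + norm x0) powr m * ?v powr - m)"
    proof -
      have "?v \<le> (1 + norm x0) * (1 + norm y)" using one_plus_norm_mult[of x0 "-y"] by simp
      then have "(1 + norm y) powr - m \<le> (1 + norm x0) powr m * ?v powr - m"
        using m s by (intro powr_mult_bound) (auto simp: add_pos_nonneg)
      then show ?thesis using \<phi>[of y] b by (meson mult_left_mono order_trans)
    qed
    then have "cmod (u y * \<phi> y) \<le> (?v powr s * (1 + g y powr q)) * ((cmod (u x0) + 1) * (1 + Q)) * (b * ((1 + norm x0) powr m * ?v powr - m))"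
      unfolding norm_mult using uy w Q by (intro mult_mono) auto
    also have "\<dots> = b * (cmod (u x0) + 1) * (R * ((?v powr s * ?v powr - m) * (1 + g y powr q)))"
      by (simp add: R_def mult_ac)
    also have "?v powr s * ?v powr - m = ?v powr - (m - s)" by (simp flip: powr_add)
    finally show "cmod (u y * \<phi> y) \<le> b * (cmod (u x0) + 1) * K y" by (simp add: K_def)
  qed
qed

text \<open>Domination applied to f itself: the pairing with \<phi> is bounded by the weighted
  supremum of \<phi> alone, with the weight exponent just above n + s chosen here.\<close>

lemma hajlasz_is_tempered_fun:
  fixes f :: "real ^ 'n::finite \<Rightarrow> complex"
  assumes s: "0 < s" and p: "real CARD('n) / (real CARD('n) + s) < p"
    and fm: "f \<in> borel_measurable lebesgue" and H: "hajlasz_gradient s f g N" and fin: "Lp_norm p (\<lambda>x. ennreal (g x)) < \<infinity>"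
  shows "is_tempered_fun f"
proof -
  define m where "m = real CARD('n) + s + 1"
  have m: "real CARD('n) + s < m" "0 < m" using s by (auto simp: m_def)
  have N: "N \<in> null_sets lebesgue" and gm: "g \<in> borel_measurable lebesgue" and g0: "\<forall>x. 0 \<le> g x"
    using H by (auto simp: hajlasz_gradient_def)
  obtain K x0 where K: "x0 \<notin> N" "integrable lebesgue K" "\<And>y. 0 \<le> K y"
    "\<And>u \<phi> b y. hajlasz_gradient s u g N \<Longrightarrow> (\<And>y. cmod (\<phi> y) \<le> b * (1 + norm y) powr - m) \<Longrightarrow> y \<notin> N \<Longrightarrow>
      cmod (u y * \<phi> y) \<le> b * (cmod (u x0) + 1) * K y"
    using hajlasz_domination[OF s m(1) p N gm g0 fin] by metis
  have bd: "AE y in lebesgue. cmod (f y * \<phi> y) \<le> b * (cmod (f x0) + 1) * K y"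
    if "schwartz_bound 0 m \<phi> b" for \<phi> b
    by (rule AE_I'[OF N]) (use K(4)[OF H schwartz_boundD[OF that]] in auto)
  have int: "integrable lebesgue (\<lambda>x. f x * \<phi> x)" if \<phi>: "\<phi> \<in> schwartz" for \<phi>
  proof -
    obtain b where b: "0 < b" "schwartz_bound 0 m \<phi> b" using \<phi> by (rule schwartz_boundE)
    have "integrable lebesgue (\<lambda>y. b * (cmod (f x0) + 1) * K y)" using K(2) by (rule integrable_mult_right)
    then show ?thesis
    proof (rule Bochner_Integration.integrable_bound)
      show "(\<lambda>x. f x * \<phi> x) \<in> borel_measurable lebesgue" using fm schwartz_measurable[OF \<phi>] by measurable
      show "AE y in lebesgue. cmod (f y * \<phi> y) \<le> norm (b * (cmod (f x0) + 1) * K y)"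
        using bd[OF b(2)] by (rule eventually_mono) (metis abs_ge_self order_trans real_norm_def)
    qed
  qed
  define D where "D = (cmod (f x0) + 1) * (LINT y|lebesgue. K y)"
  have D: "D \<ge> 0" unfolding D_def using K(3) by (intro mult_nonneg_nonneg integral_nonneg_AE) auto
  have val: "regular_dist f \<phi> = (LINT x|lebesgue. f x * \<phi> x)" if "\<phi> \<in> schwartz" for \<phi>
    using that by (simp add: regular_dist_def)
  have "regular_dist f \<in> tempered"
    unfolding tempered_def
  proof (intro CollectI conjI ballI allI)
    show "regular_dist f \<in> extensional schwartz" by (simp add: regular_dist_def)
    fix \<phi> :: "real^'n \<Rightarrow> complex" assume \<phi>: "\<phi> \<in> schwartz"
    show "regular_dist f (\<lambda>x. \<phi> x + \<psi> x) = regular_dist f \<phi> + regular_dist f \<psi>" if \<psi>: "\<psi> \<in> schwartz" for \<psi>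
    proof -
      have "(\<lambda>x. \<phi> x + \<psi> x) \<in> schwartz" using schwartz_add_cmult[OF \<phi> \<psi>, of 1 1] by simp
      then show ?thesis using \<phi> \<psi> int by (simp add: val distrib_left)
    qed
    show "regular_dist f (\<lambda>x. c * \<phi> x) = c * regular_dist f \<phi>" for c
      using \<phi> schwartz_cmult[OF \<phi>, of c] by (simp add: val mult.left_commute)
  next
    have "ennreal (cmod (regular_dist f \<phi>)) \<le> ennreal D * schwartz_norm 0 m \<phi>" if \<phi>: "\<phi> \<in> schwartz" for \<phi>
    proof -
      have "schwartz_norm 0 m \<phi> < \<infinity>" using \<phi> m by (simp add: schwartz_def)
      then obtain b where b: "schwartz_norm 0 m \<phi> = ennreal b" "0 \<le> b"
        by (metis ennreal_cases infinity_ennreal_def less_irrefl)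
      then have sb: "schwartz_bound 0 m \<phi> b" using schwartz_norm_le_iff[OF schwartz_smooth[OF \<phi>]] by (metis order_refl)
      have "cmod (LINT x|lebesgue. f x * \<phi> x) \<le> (LINT x|lebesgue. cmod (f x * \<phi> x))" by (rule integral_norm_bound)
      also have "\<dots> \<le> (LINT y|lebesgue. b * (cmod (f x0) + 1) * K y)"
        using bd[OF sb] int[OF \<phi>] K(2) by (intro integral_mono_AE) auto
      also have "\<dots> = D * b" by (simp add: D_def mult_ac)
      finally show ?thesis using D b \<phi> by (simp add: val ennreal_leI flip: ennreal_mult)
    qed
    then show "\<exists>k. \<exists>m>0. \<exists>C::real. \<forall>\<phi>\<in>schwartz. ennreal (cmod (regular_dist f \<phi>)) \<le> ennreal C * schwartz_norm k m \<phi>"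
      using m by blast
  qed
  with int show ?thesis by (simp add: is_tempered_fun_def)
qed

section \<open>Construction of the representing function\<close>

lemma grand_TL_representation:
  fixes s p m :: real and \<Phi> :: "real ^ 'n::finite \<Rightarrow> complex"
  assumes s: "0 < s" "s \<le> 1" and p: "real CARD('n) / (real CARD('n) + s) < p"
    and m: "real CARD('n) + 1 < m" and \<Phi>: "\<Phi> \<in> schwartz" and \<Phi>0: "(LINT x|lebesgue. \<Phi> x) \<noteq> 0"
  shows "\<exists>C>0. \<forall>T\<in>grand_TL l m s p. \<exists>f\<in>hajlasz_sobolev \<Phi> s p. regular_dist f = T \<and>
    hajlasz_sobolev_norm \<Phi> s p f \<le> ennreal C * grand_TL_norm l m s p T"
proof -
  have "0 < real CARD('n) / (real CARD('n) + s)" using s by simp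
  then have p0: "0 < p" using p by simp
  have m0: "0 \<le> m" and ms: "real CARD('n) + s < m" using m s by auto
  define c where "c = (LINT x|lebesgue. \<Phi> x)"
  have c: "c \<noteq> 0" using \<Phi>0 by (simp add: c_def)
  \<comment> \<open>Normalised to integral 1, so that the mollifications converge to
    \<open>T\<close> itself and not to a multiple of it.\<close>
  define \<Psi> where "\<Psi> = (\<lambda>x. (1 / c) * \<Phi> x)"
  have \<Psi>: "\<Psi> \<in> schwartz" unfolding \<Psi>_def by (rule schwartz_cmult[OF \<Phi>])
  have \<Psi>1: "(LINT x|lebesgue. \<Psi> x) = 1" using c by (simp add: \<Psi>_def c_def[symmetric])
  have \<Phi>\<Psi>: "\<Phi> = (\<lambda>x. c * \<Psi> x)" using c by (simp add: \<Psi>_def)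
  obtain C where C: "C > 0" and CC: "\<forall>T\<in>tempered. \<forall>N h. N \<in> null_sets lebesgue \<longrightarrow> h \<in> borel_measurable lebesgue \<longrightarrow> (\<forall>x. 0 \<le> h x) \<longrightarrow>
    (\<forall>x\<in>- N. TL_max0 l m T x \<le> ennreal (h x) \<and> TL_max1 l m s T x \<le> ennreal (h x)) \<longrightarrow>
    (\<forall>x\<in>- N. Cauchy (\<lambda>k. conv (dilate (2 powr - real (Suc k)) \<Psi>) T x)) \<and>
    (\<forall>k. hajlasz_gradient s (conv (dilate (2 powr - real (Suc k)) \<Psi>) T) (\<lambda>x. C * h x) N) \<and>
    (\<forall>k. \<forall>x\<in>- N. cmod (conv (dilate (2 powr - real (Suc k)) \<Psi>) T x) \<le> C * h x) \<and>
    (\<forall>t\<in>{0<..<1}. \<forall>x\<in>- N. cmod (conv (dilate t \<Psi>) T x) \<le> C * h x)"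
    using TL_mollifications[OF s m0 \<Psi>, of l] by (elim exE conjE) (rule that)
  define P where "P = 2 * 2 powr (1 / p)"
  have P: "P > 0" by (simp add: P_def)
  \<comment> \<open>The summand |c| C bounds the local Hardy norm, since \<Phi> = c \<Psi>; the
    summand C bounds the gradient; P is the quasi-triangle constant of L^p for the sum of the two
    maximal functions.\<close>
  define E where "E = (cmod c * C + C) * P"
  have E: "E > 0" unfolding E_def using C P by (intro mult_pos_pos add_nonneg_pos) auto
  show ?thesis
  proof (intro exI[of _ E] conjI E ballI)
    fix T :: "(real^'n \<Rightarrow> complex) \<Rightarrow> complex" assume "T \<in> grand_TL l m s p"
    then have T: "T \<in> tempered" and fin: "grand_TL_norm l m s p T < \<infinity>" by (auto simp: grand_TL_def)
    let ?F = "TL_max0 l m T" and ?G = "TL_max1 l m s T"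
    have [measurable]: "?F \<in> borel_measurable lebesgue" "?G \<in> borel_measurable lebesgue"
      by (rule TL_max0_measurable[OF T], rule TL_max1_measurable[OF T])
    have fin': "Lp_norm p ?F < \<infinity>" "Lp_norm p ?G < \<infinity>" using fin by (auto simp: grand_TL_norm_eq)
    define N where "N = {x. ?F x = \<infinity> \<or> ?G x = \<infinity>}"
    have Ns: "N \<in> sets lebesgue"
    proof -
      have "{x \<in> space lebesgue. ?F x = \<infinity> \<or> ?G x = \<infinity>} \<in> sets lebesgue" by measurable
      then show ?thesis by (simp add: N_def)
    qed
    have "AE x in lebesgue. x \<notin> N"
      using Lp_norm_finite_AE(2)[OF p0 _ fin'(1)] Lp_norm_finite_AE(2)[OF p0 _ fin'(2)] by (auto simp: N_def)
    then have N: "N \<in> null_sets lebesgue" using Ns by (simp add: AE_iff_null_sets)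
    \<comment> \<open>A real-valued majorant. \<open>enn2real\<close> sends infinity to 0, which
      falsifies the majorisation only on the null set \<open>N\<close>.\<close>
    define h where "h x = enn2real (?F x) + enn2real (?G x)" for x
    have hm[measurable]: "h \<in> borel_measurable lebesgue" unfolding h_def by measurable
    have h0: "\<forall>x. 0 \<le> h x" by (simp add: h_def)
    have hF: "\<forall>x\<in>- N. ?F x \<le> ennreal (h x) \<and> ?G x \<le> ennreal (h x)"
    proof
      fix x assume "x \<in> - N"
      then have "?F x = ennreal (enn2real (?F x))" "?G x = ennreal (enn2real (?G x))" by (auto simp: N_def less_top)
      moreover have "ennreal (enn2real (?F x)) \<le> ennreal (h x)" "ennreal (enn2real (?G x)) \<le> ennreal (h x)"
        by (auto simp: h_def intro!: ennreal_leI)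
      ultimately show "?F x \<le> ennreal (h x) \<and> ?G x \<le> ennreal (h x)" by metis
    qed
    have hLp: "Lp_norm p (\<lambda>x. ennreal (h x)) \<le> ennreal P * grand_TL_norm l m s p T"
    proof -
      have "ennreal (h x) \<le> ?F x + ?G x" for x
      proof -
        have "ennreal (enn2real y) \<le> y" for y by (cases y) auto
        then show ?thesis unfolding h_def by (simp add: add_mono)
      qed
      then have "Lp_norm p (\<lambda>x. ennreal (h x)) \<le> Lp_norm p (\<lambda>x. ?F x + ?G x)" by (rule Lp_norm_mono[OF p0])
      also have "\<dots> \<le> ennreal P * (Lp_norm p ?F + Lp_norm p ?G)" unfolding P_def by (rule Lp_norm_add[OF p0]) auto
      finally show ?thesis by (simp add: grand_TL_norm_eq)
    qed
    have ChLp: "Lp_norm p (\<lambda>x. ennreal (a * h x)) = ennreal a * Lp_norm p (\<lambda>x. ennreal (h x))" if "0 \<le> a" for a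
      using that h0 by (simp add: ennreal_mult Lp_norm_cmult[OF p0])
    define u where "u k = conv (dilate (2 powr - real (Suc k)) \<Psi>) T" for k
    have uC: "\<And>x. x \<notin> N \<Longrightarrow> Cauchy (\<lambda>k. u k x)" and uH: "\<And>k. hajlasz_gradient s (u k) (\<lambda>x. C * h x) N"
      and ub: "\<And>k x. x \<notin> N \<Longrightarrow> cmod (u k x) \<le> C * h x"
      and ut: "\<And>t x. 0 < t \<Longrightarrow> t < 1 \<Longrightarrow> x \<notin> N \<Longrightarrow> cmod (conv (dilate t \<Psi>) T x) \<le> C * h x"
      using CC[rule_format, OF T N hm h0[rule_format] hF[rule_format]] unfolding u_def by auto
    define f where "f x = (if x \<in> N then 0 else lim (\<lambda>k. u k x))" for x
    have dil: "dilate (2 powr - real (Suc k)) \<Psi> \<in> schwartz" for k by (rule dilate_schwartz[OF \<Psi>]) simp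
    have um[measurable]: "u k \<in> borel_measurable lebesgue" for k unfolding u_def by (rule conv_measurable[OF T dil])
    have uf: "(\<lambda>k. u k x) \<longlonglongrightarrow> f x" if "x \<notin> N" for x
      using uC[OF that] that by (simp add: f_def Cauchy_convergent_iff convergent_LIMSEQ_iff)
    have fm: "f \<in> borel_measurable lebesgue"
    proof (rule borel_measurable_LIMSEQ_metric)
      show "(\<lambda>x. if x \<in> N then 0 else u k x) \<in> borel_measurable lebesgue" for k
        using Ns by (intro measurable_If_set) auto
      show "(\<lambda>k. if x \<in> N then 0 else u k x) \<longlonglongrightarrow> f x" for x
        using uf[of x] by (cases "x \<in> N") (auto simp: f_def)
    qed
    have fH: "hajlasz_gradient s f (\<lambda>x. C * h x) N" by (rule hajlasz_gradient_limit[OF uH uf])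
    have fb: "cmod (f x) \<le> C * h x" for x
    proof (cases "x \<in> N")
      case False
      have "(\<lambda>k. cmod (u k x)) \<longlonglongrightarrow> cmod (f x)" by (intro tendsto_intros uf False)
      then show ?thesis by (rule LIMSEQ_le_const2) (use ub False in auto)
    qed (use C h0 in \<open>simp add: f_def\<close>)
    have hfin: "Lp_norm p (\<lambda>x. ennreal (C * h x)) < \<infinity>"
    proof -
      have "Lp_norm p (\<lambda>x. ennreal (C * h x)) \<le> ennreal C * (ennreal P * grand_TL_norm l m s p T)"
        using C hLp by (simp add: ChLp mult_left_mono)
      also have "\<dots> < \<infinity>" using fin by (simp add: ennreal_mult_less_top)
      finally show ?thesis .
    qed
    have ft: "is_tempered_fun f" by (rule hajlasz_is_tempered_fun[OF s(1) p fm fH hfin])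
    have rd: "regular_dist f = T"
    proof (rule extensionalityI)
      show "regular_dist f \<in> extensional schwartz" "T \<in> extensional schwartz"
        using T by (auto simp: regular_dist_def tempered_def)
      fix \<phi> :: "real^'n \<Rightarrow> complex" assume \<phi>: "\<phi> \<in> schwartz"
      have l1: "(\<lambda>k. LINT x|lebesgue. \<phi> x * u k x) \<longlonglongrightarrow> T \<phi>"
        unfolding u_def
      proof (rule tempered_mollify[OF T \<phi> \<Psi> \<Psi>1])
        have e: "(2::real) powr - real (Suc j) = (1/2) ^ Suc j" for j
          by (simp only: powr_minus powr_realpow zero_less_numeral power_one_over inverse_eq_divide)
        show "2 powr - real (Suc j) \<le> (1::real)" for j unfolding e by (rule power_le_one) auto
        have "(\<lambda>j. (1/2::real) ^ Suc j) \<longlonglongrightarrow> 0" by (intro LIMSEQ_Suc LIMSEQ_realpow_zero) auto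
        then show "(\<lambda>j. 2 powr - real (Suc j)) \<longlonglongrightarrow> (0::real)" unfolding e .
      qed auto
      have hCm: "(\<lambda>x. C * h x) \<in> borel_measurable lebesgue" and hC0: "\<forall>x. 0 \<le> C * h x" using C h0 by auto
      obtain K x0 where K: "x0 \<notin> N" "integrable lebesgue K" "\<And>y. 0 \<le> K y"
        "\<And>u \<phi> b y. hajlasz_gradient s u (\<lambda>x. C * h x) N \<Longrightarrow> (\<And>y. cmod (\<phi> y) \<le> b * (1 + norm y) powr - m) \<Longrightarrow> y \<notin> N \<Longrightarrow>
          cmod (u y * \<phi> y) \<le> b * (cmod (u x0) + 1) * K y"
        using hajlasz_domination[OF s(1) ms p N hCm hC0 hfin] by metis
      obtain b where b: "0 < b" "schwartz_bound 0 m \<phi> b" using \<phi> by (rule schwartz_boundE)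
      have \<phi>m[measurable]: "\<phi> \<in> borel_measurable lebesgue" by (rule schwartz_measurable[OF \<phi>])
      have l2: "(\<lambda>k. LINT x|lebesgue. \<phi> x * u k x) \<longlonglongrightarrow> (LINT x|lebesgue. \<phi> x * f x)"
      \<comment> \<open>All \<open>u k\<close> share the gradient \<open>C * h\<close> off
        \<open>N\<close>, and |u k x0| \<le> C h(x0) for every k, so the dominating function is
        independent of k.\<close>
      proof (rule integral_dominated_convergence[where w="\<lambda>y. b * (C * h x0 + 1) * K y"])
        show "(\<lambda>x. \<phi> x * f x) \<in> borel_measurable lebesgue" using fm by measurable
        show "(\<lambda>x. \<phi> x * u k x) \<in> borel_measurable lebesgue" for k by measurable
        show "integrable lebesgue (\<lambda>y. b * (C * h x0 + 1) * K y)" using K(2) by (rule integrable_mult_right)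
        show "AE x in lebesgue. (\<lambda>k. \<phi> x * u k x) \<longlonglongrightarrow> \<phi> x * f x"
          by (rule AE_I'[OF N]) (auto intro: tendsto_intros uf)
        have "cmod (\<phi> y * u k y) \<le> b * (C * h x0 + 1) * K y" if "y \<notin> N" for k y
        proof -
          have "cmod (\<phi> y * u k y) \<le> b * (cmod (u k x0) + 1) * K y"
            using K(4)[OF uH schwartz_boundD[OF b(2)] that] by (simp add: mult.commute)
          also have "\<dots> \<le> b * (C * h x0 + 1) * K y"
            using b K ub by (intro mult_right_mono mult_left_mono add_right_mono) auto
          finally show ?thesis .
        qed
        then show "AE x in lebesgue. cmod (\<phi> x * u k x) \<le> b * (C * h x0 + 1) * K x" for k
          by (intro AE_I'[OF N]) auto
      qed
      show "regular_dist f \<phi> = T \<phi>"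
        using LIMSEQ_unique[OF l1 l2] \<phi> by (simp add: regular_dist_def mult.commute)
    qed
    have hardy: "local_hardy_norm \<Phi> p T \<le> ennreal (cmod c * C) * Lp_norm p (\<lambda>x. ennreal (h x))"
    proof -
      have "(SUP t\<in>{0<..<1::real}. ennreal (cmod (conv (dilate t \<Phi>) T x))) \<le> ennreal (cmod c * C * h x)" if x: "x \<notin> N" for x
      proof (rule SUP_least)
        fix t :: real assume t: "t \<in> {0<..<1}"
        have "dilate t \<Psi> \<in> schwartz" using t by (intro dilate_schwartz \<Psi>) auto
        then have "conv (dilate t \<Phi>) T x = c * conv (dilate t \<Psi>) T x"
          unfolding \<Phi>\<Psi> dilate_cmult by (rule conv_cmult[OF T])
        then have "cmod (conv (dilate t \<Phi>) T x) \<le> cmod c * (C * h x)"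
          using ut[of t x] t x by (simp add: norm_mult mult_left_mono)
        then show "ennreal (cmod (conv (dilate t \<Phi>) T x)) \<le> ennreal (cmod c * C * h x)"
          by (intro ennreal_leI) (simp add: mult.assoc)
      qed
      then have "local_hardy_norm \<Phi> p T \<le> Lp_norm p (\<lambda>x. ennreal (cmod c * C * h x))"
        unfolding local_hardy_norm_def by (intro Lp_norm_mono_AE p0 AE_I'[OF N]) auto
      also have "\<dots> = ennreal (cmod c * C) * Lp_norm p (\<lambda>x. ennreal (h x))" using C by (intro ChLp) auto
      finally show ?thesis .
    qed
    have grad: "(\<lambda>x. C * h x) \<in> hajlasz_gradients s p f"
      unfolding hajlasz_gradients_iff using hfin fH by blast
    have total: "hajlasz_sobolev_norm \<Phi> s p f \<le> ennreal E * grand_TL_norm l m s p T"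
    proof -
      have "hajlasz_hom_norm s p f \<le> ennreal C * Lp_norm p (\<lambda>x. ennreal (h x))"
        unfolding hajlasz_hom_norm_def using C by (intro INF_lower2[OF grad]) (simp add: ChLp)
      then have "hajlasz_sobolev_norm \<Phi> s p f \<le> ennreal (cmod c * C) * Lp_norm p (\<lambda>x. ennreal (h x)) + ennreal C * Lp_norm p (\<lambda>x. ennreal (h x))"
        unfolding hajlasz_sobolev_norm_def rd using hardy by (rule add_mono[rotated])
      also have "\<dots> = ennreal (cmod c * C + C) * Lp_norm p (\<lambda>x. ennreal (h x))"
        using C by (simp add: ennreal_plus distrib_right)
      also have "\<dots> \<le> ennreal (cmod c * C + C) * (ennreal P * grand_TL_norm l m s p T)"
        by (intro mult_left_mono hLp) auto
      also have "\<dots> = ennreal E * grand_TL_norm l m s p T"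
        unfolding E_def using C P by (simp add: ennreal_mult mult.assoc)
      finally show ?thesis .
    qed
    have "local_hardy_norm \<Phi> p T < \<infinity>"
    proof -
      have "local_hardy_norm \<Phi> p T \<le> ennreal (cmod c * C) * (ennreal P * grand_TL_norm l m s p T)"
        by (rule order_trans[OF hardy]) (intro mult_left_mono hLp, simp)
      also have "\<dots> < \<infinity>" using fin by (simp add: ennreal_mult_less_top)
      finally show ?thesis .
    qed
    moreover have "f \<in> Lp_loc p"
      unfolding Lp_loc_def
    proof (intro CollectI conjI allI impI fm)
      fix X :: "(real^'n) set"
      \<comment> \<open>The majorant C h lies in L^p on the whole space, so integrability of |f|^p
        holds over every set \<open>X\<close>.\<close>
      have "(\<integral>\<^sup>+ x\<in>X. ennreal (cmod (f x) powr p) \<partial>lebesgue) \<le> (\<integral>\<^sup>+ x. ennreal_powr (ennreal (C * h x)) p \<partial>lebesgue)"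
      proof (rule nn_integral_mono)
        fix x
        have "cmod (f x) powr p \<le> (C * h x) powr p" using fb p0 by (intro powr_mono2) auto
        then show "ennreal (cmod (f x) powr p) * indicator X x \<le> ennreal_powr (ennreal (C * h x)) p"
          using C h0 by (auto split: split_indicator intro: ennreal_leI)
      qed
      also have "\<dots> < \<infinity>" using hfin by (intro Lp_norm_finite_AE(1) p0) auto
      finally show "(\<integral>\<^sup>+ x\<in>X. ennreal (cmod (f x) powr p) \<partial>lebesgue) < \<infinity>" .
    qed
    ultimately have "f \<in> hajlasz_sobolev \<Phi> s p"
      using ft T rd grad by (auto simp: hajlasz_sobolev_def hajlasz_hom_def local_hardy_def)
    with rd total show "\<exists>f\<in>hajlasz_sobolev \<Phi> s p. regular_dist f = T \<and>
      hajlasz_sobolev_norm \<Phi> s p f \<le> ennreal E * grand_TL_norm l m s p T" by blast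
  qed
qed

text \<open>The functional determines all convolutions with dilates of \<Phi>, and these tend almost
  everywhere to f times the integral of \<Phi>. The convergence does not rest on Lebesgue's
  differentiation theorem: where the maximal function is finite, the oscillation estimate gives the
  rate t^s.\<close>

lemma hajlasz_sobolev_regular_dist_inj:
  fixes s p :: real and \<Phi> :: "real ^ 'n::finite \<Rightarrow> complex"
  assumes s: "0 < s" and p: "real CARD('n) / (real CARD('n) + s) < p"
    and \<Phi>: "\<Phi> \<in> schwartz" and \<Phi>0: "(LINT x|lebesgue. \<Phi> x) \<noteq> 0"
    and f: "f \<in> hajlasz_sobolev \<Phi> s p" and f': "f' \<in> hajlasz_sobolev \<Phi> s p" and eq: "regular_dist f = regular_dist f'"
  shows "AE x in lebesgue. f x = f' x"
proof -
  define q where "q = real CARD('n) / (real CARD('n) + s)"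
  have q: "0 < q" "q < p" using s p by (auto simp: q_def)
  define m where "m = real CARD('n) + s + 1"
  have ms: "real CARD('n) + s < m" by (simp add: m_def)
  obtain C where C: "C > 0" and CC: "\<And>(f::real^'n \<Rightarrow> complex) g N (\<phi>::real^'n \<Rightarrow> complex) x t A B.
    f \<in> borel_measurable lebesgue \<Longrightarrow> hajlasz_gradient s f g N \<Longrightarrow> is_tempered_fun f \<Longrightarrow>
    \<phi> \<in> schwartz \<Longrightarrow> 0 < B \<Longrightarrow> (\<forall>z. cmod (\<phi> z) \<le> B * (1 + norm z) powr - m) \<Longrightarrow> 0 < t \<Longrightarrow> 0 < A \<Longrightarrow>
    hl_max (\<lambda>y. ennreal (g y powr q)) x \<le> ennreal A \<Longrightarrow>
    (\<forall>z\<in>ball x t - N. cmod (conv (dilate t \<phi>) (regular_dist f) x - f z * (LINT y|lebesgue. \<phi> y))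
      \<le> B * C * t powr s * A powr (s / CARD('n)) * (A + g z powr q))"
    using hajlasz_conv_estimate[OF s ms] unfolding q_def by blast
  obtain B where B: "0 < B" "schwartz_bound 0 m \<Phi> B" using \<Phi> by (rule schwartz_boundE)
  let ?t = "\<lambda>j::nat. (1/2) ^ j :: real"
  have lim: "AE x in lebesgue. (\<lambda>j. conv (dilate (?t j) \<Phi>) (regular_dist f) x) \<longlonglongrightarrow> f x * (LINT y|lebesgue. \<Phi> y)"
    if f: "f \<in> hajlasz_sobolev \<Phi> s p" for f
  proof -
    have fm: "f \<in> borel_measurable lebesgue" and ft: "is_tempered_fun f" and "hajlasz_gradients s p f \<noteq> {}"
      using f by (auto simp: hajlasz_sobolev_def hajlasz_hom_def Lp_loc_def)
    then obtain g N where H: "hajlasz_gradient s f g N" and fin: "Lp_norm p (\<lambda>x. ennreal (g x)) < \<infinity>"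
      by (auto simp: hajlasz_gradients_iff)
    have N: "N \<in> null_sets lebesgue" and gm: "g \<in> borel_measurable lebesgue" and g0: "\<forall>x. 0 \<le> g x"
      using H by (auto simp: hajlasz_gradient_def)
    have "AE x in lebesgue. x \<notin> N \<and> hl_max (\<lambda>y. ennreal (g y powr q)) x \<noteq> \<infinity>"
      using hl_max_finite_AE[OF q gm g0 fin] AE_not_in[OF N] by auto
    then show ?thesis
    proof (rule eventually_mono)
      fix x assume x: "x \<notin> N \<and> hl_max (\<lambda>y. ennreal (g y powr q)) x \<noteq> \<infinity>"
      define A where "A = enn2real (hl_max (\<lambda>y. ennreal (g y powr q)) x) + 1"
      have A: "0 < A" by (simp add: A_def add_nonneg_pos)
      have "hl_max (\<lambda>y. ennreal (g y powr q)) x = ennreal (enn2real (hl_max (\<lambda>y. ennreal (g y powr q)) x))"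
        using x by (simp add: less_top)
      also have "\<dots> \<le> ennreal A" by (intro ennreal_leI) (simp add: A_def)
      finally have M: "hl_max (\<lambda>y. ennreal (g y powr q)) x \<le> ennreal A" .
      let ?D = "B * C"
      let ?R = "A powr (s / CARD('n)) * (A + g x powr q)"
      show "(\<lambda>j. conv (dilate (?t j) \<Phi>) (regular_dist f) x) \<longlonglongrightarrow> f x * (LINT y|lebesgue. \<Phi> y)"
      proof (rule LIM_zero_cancel, rule Lim_null_comparison)
        show "\<forall>\<^sub>F j in sequentially. cmod (conv (dilate (?t j) \<Phi>) (regular_dist f) x - f x * (LINT y|lebesgue. \<Phi> y))
          \<le> ?D * ?t j powr s * ?R"
        proof (intro always_eventually allI)
          fix j
          have "\<forall>z\<in>ball x (?t j) - N. cmod (conv (dilate (?t j) \<Phi>) (regular_dist f) x - f z * (LINT y|lebesgue. \<Phi> y))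
            \<le> B * C * ?t j powr s * A powr (s / CARD('n)) * (A + g z powr q)"
            by (rule CC[OF fm H ft \<Phi> B(1) _ _ A M]) (use schwartz_boundD[OF B(2)] in auto)
          \<comment> \<open>The estimate for all \<open>z\<close> is used at z = x, which lies in
            every ball and outside \<open>N\<close>.\<close>
          moreover have "x \<in> ball x (?t j) - N" using x by simp
          ultimately show "cmod (conv (dilate (?t j) \<Phi>) (regular_dist f) x - f x * (LINT y|lebesgue. \<Phi> y)) \<le> ?D * ?t j powr s * ?R"
            by (metis (no_types, lifting) mult.assoc)
        qed
        have "?t j powr s = ((1/2) powr s) ^ j" for j
        proof -
          have "?t j powr s = ((1/2) powr real j) powr s" by (simp only: powr_realpow half_gt_zero zero_less_one)
          also have "\<dots> = ((1/2) powr s) powr real j" by (simp only: powr_powr mult.commute)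
          also have "\<dots> = ((1/2) powr s) ^ j" by (rule powr_realpow) simp
          finally show ?thesis .
        qed
        then have "(\<lambda>j. ?t j powr s) = (\<lambda>j. ((1/2) powr s) ^ j)" by (simp only:)
        moreover have "(\<lambda>j. ((1/2::real) powr s) ^ j) \<longlonglongrightarrow> 0"
          using s powr_less_mono2[of s "1/2" 1] by (intro LIMSEQ_realpow_zero) auto
        ultimately have "(\<lambda>j. ?t j powr s) \<longlonglongrightarrow> 0" by simp
        then have "(\<lambda>j. ?D * ?t j powr s * ?R) \<longlonglongrightarrow> ?D * 0 * ?R" by (intro tendsto_intros)
        then show "(\<lambda>j. ?D * ?t j powr s * ?R) \<longlonglongrightarrow> 0" by simp
      qed
    qed
  qed
  from lim[OF f] lim[OF f'] show ?thesis
  proof eventually_elim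
    case (elim x)
    have "f x * (LINT y|lebesgue. \<Phi> y) = f' x * (LINT y|lebesgue. \<Phi> y)"
      by (rule LIMSEQ_unique[OF elim(1) elim(2)[folded eq]])
    then show ?case using \<Phi>0 by simp
  qed
qed

text \<open>Each gradient of f' is also a gradient of f after the exceptional set is enlarged by the
  null set where the two differ.\<close>

lemma hajlasz_hom_norm_AE_le:
  assumes "AE x in lebesgue. f x = f' x"
  shows "hajlasz_hom_norm s p f \<le> hajlasz_hom_norm s p f'"
  unfolding hajlasz_hom_norm_def
proof (rule INF_superset_mono)
  obtain Z where Z: "{x. f x \<noteq> f' x} \<subseteq> Z" "Z \<in> null_sets lebesgue"
    using assms by (auto simp: eventually_ae_filter)
  show "hajlasz_gradients s p f' \<subseteq> hajlasz_gradients s p f"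
  proof
    fix g assume "g \<in> hajlasz_gradients s p f'"
    then obtain N where H: "hajlasz_gradient s f' g N" and fin: "Lp_norm p (\<lambda>x. ennreal (g x)) < \<infinity>"
      by (auto simp: hajlasz_gradients_iff)
    have "hajlasz_gradient s f g (N \<union> Z)"
    proof -
      have "f x = f' x" if "x \<in> - (N \<union> Z)" for x using Z(1) that by auto
      moreover have "N \<union> Z \<in> null_sets lebesgue" using H Z(2) by (simp add: hajlasz_gradient_def null_sets.Un)
      ultimately show ?thesis using H unfolding hajlasz_gradient_def by simp
    qed
    with fin show "g \<in> hajlasz_gradients s p f" by (auto simp: hajlasz_gradients_iff)
  qed
qed simp

theorem theorem3p2:
  fixes s p m :: real and l :: nat and \<Phi> :: "real ^ 'n::finite \<Rightarrow> complex"
  assumes "0 < s" and "s \<le> 1"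
    and "real CARD('n) / (real CARD('n) + s) < p"
    and "real CARD('n) + 1 < m"
    and "\<Phi> \<in> schwartz" and "(LINT x|lebesgue. \<Phi> x) \<noteq> 0"
  shows "regular_dist ` hajlasz_sobolev \<Phi> s p = grand_TL l m s p \<and>
    (\<exists>C::real. 0 < C \<and> (\<forall>f\<in>hajlasz_sobolev \<Phi> s p.
       hajlasz_sobolev_norm \<Phi> s p f \<le> ennreal C * grand_TL_norm l m s p (regular_dist f) \<and>
       grand_TL_norm l m s p (regular_dist f) \<le> ennreal C * hajlasz_sobolev_norm \<Phi> s p f))"
proof -
  obtain C1 where C1: "C1 > 0" "\<And>f. f \<in> hajlasz_sobolev \<Phi> s p \<Longrightarrow>
    grand_TL_norm l m s p (regular_dist f) \<le> ennreal C1 * hajlasz_sobolev_norm \<Phi> s p f"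
    using grand_TL_le_hajlasz[OF assms] by blast
  obtain C2 where C2: "C2 > 0" "\<And>T. T \<in> grand_TL l m s p \<Longrightarrow> \<exists>f\<in>hajlasz_sobolev \<Phi> s p. regular_dist f = T \<and>
    hajlasz_sobolev_norm \<Phi> s p f \<le> ennreal C2 * grand_TL_norm l m s p T"
    using grand_TL_representation[OF assms] by blast
  have mem: "regular_dist f \<in> grand_TL l m s p" if f: "f \<in> hajlasz_sobolev \<Phi> s p" for f
  proof -
    have "hajlasz_hom_norm s p f < \<infinity>"
    proof -
      obtain g where g: "g \<in> hajlasz_gradients s p f" using f by (auto simp: hajlasz_sobolev_def hajlasz_hom_def)
      then have "hajlasz_hom_norm s p f \<le> Lp_norm p (\<lambda>x. ennreal (g x))"
        unfolding hajlasz_hom_norm_def by (rule INF_lower)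
      also have "\<dots> < \<infinity>" using g by (simp add: hajlasz_gradients_iff)
      finally show ?thesis .
    qed
    then have "hajlasz_sobolev_norm \<Phi> s p f < \<infinity>"
      using f by (auto simp: hajlasz_sobolev_norm_def hajlasz_sobolev_def local_hardy_def)
    then have "ennreal C1 * hajlasz_sobolev_norm \<Phi> s p f < \<infinity>" by (simp add: ennreal_mult_less_top)
    then have "grand_TL_norm l m s p (regular_dist f) < \<infinity>" using C1(2)[OF f] by (rule le_less_trans[rotated])
    then show ?thesis using f by (auto simp: grand_TL_def hajlasz_sobolev_def is_tempered_fun_def)
  qed
  \<comment> \<open>The representation supplies the bound for some f' with the same functional. The
    Hardy parts of f and f' coincide because they depend on the functional alone, the gradient parts
    because f = f' almost everywhere.\<close>
  have le2: "hajlasz_sobolev_norm \<Phi> s p f \<le> ennreal C2 * grand_TL_norm l m s p (regular_dist f)"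
    if f: "f \<in> hajlasz_sobolev \<Phi> s p" for f
  proof -
    obtain f' where f': "f' \<in> hajlasz_sobolev \<Phi> s p" "regular_dist f' = regular_dist f"
      "hajlasz_sobolev_norm \<Phi> s p f' \<le> ennreal C2 * grand_TL_norm l m s p (regular_dist f)"
      using C2(2)[OF mem[OF f]] by blast
    have "AE x in lebesgue. f x = f' x"
      using hajlasz_sobolev_regular_dist_inj[OF assms(1,3,5,6) f f'(1)] f'(2) by simp
    then have "hajlasz_sobolev_norm \<Phi> s p f \<le> hajlasz_sobolev_norm \<Phi> s p f'"
      unfolding hajlasz_sobolev_norm_def f'(2) by (intro add_left_mono hajlasz_hom_norm_AE_le)
    then show ?thesis using f'(3) by (rule order_trans)
  qed
  show ?thesis
  proof (intro conjI exI[of _ "max C1 C2"] ballI)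
    show "regular_dist ` hajlasz_sobolev \<Phi> s p = grand_TL l m s p" using mem C2(2) by blast
    show "0 < max C1 C2" using C1 by simp
    fix f assume f: "f \<in> hajlasz_sobolev \<Phi> s p"
    have "ennreal C1 \<le> ennreal (max C1 C2)" "ennreal C2 \<le> ennreal (max C1 C2)" by (auto intro!: ennreal_leI)
    then show "hajlasz_sobolev_norm \<Phi> s p f \<le> ennreal (max C1 C2) * grand_TL_norm l m s p (regular_dist f)"
      "grand_TL_norm l m s p (regular_dist f) \<le> ennreal (max C1 C2) * hajlasz_sobolev_norm \<Phi> s p f"
      using le2[OF f] C1(2)[OF f] by (meson mult_right_mono order_trans zero_le)+
  qed
qed

end
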